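(* Let $G$ be a virtually polycyclic group. Then $d(G) \leq d(\widehat{G}) + 1$.
   Context: For a finitely generated group $G$, $d(G)$ denotes the minimal size of a generating set of $G$. $\widehat{G}$ denotes the profinite completion of $G$, and $d(\widehat{G})$ denotes the minimal size of a (topological) generating set of $\widehat{G}$; equivalently, $d(\widehat{G}) = \max\{ d(G/N) : N \vartriangleleft G,\ G/N \text{ finite}\}$. A group is virtually polycyclic if it has a polycyclic subgroup of finite index. *)

theory Defs
  imports
    "HOL-Algebra.Product_Groups"
    "HOL-Analysis.Function_Topology"
    "HOL-Library.Extended_Nat"
begin

text \<open>A subnormal series with cyclic factors, built from the bottom up.\<close>

inductive polycyclic_seq :: "('a, 'b) monoid_scheme \<Rightarrow> 'a set \<Rightarrow> bool"
  for G where
    unity: "polycyclic_seq G {\<one>\<^bsub>G\<^esub>}"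
  | extension: "\<lbrakk> polycyclic_seq G K; K \<lhd> (G\<lparr>carrier := H\<rparr>); subgroup H G;
                  cyclic_group ((G\<lparr>carrier := H\<rparr>) Mod K) \<rbrakk> \<Longrightarrow> polycyclic_seq G H"

definition polycyclic :: "('a, 'b) monoid_scheme \<Rightarrow> bool"
  where "polycyclic G \<longleftrightarrow> polycyclic_seq G (carrier G)"

definition virtually_polycyclic :: "('a, 'b) monoid_scheme \<Rightarrow> bool"
  where "virtually_polycyclic G \<longleftrightarrow>
    (\<exists>H. subgroup H G \<and> finite (rcosets\<^bsub>G\<^esub> H) \<and> polycyclic (G\<lparr>carrier := H\<rparr>))"


text \<open>The value is \<open>\<infinity>\<close> when there is no finite generating set.\<close>

definition gen_rank :: "('a, 'b) monoid_scheme \<Rightarrow> enat"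
  where "gen_rank G =
    (INF S \<in> {S. finite S \<and> S \<subseteq> carrier G \<and> generate G S = carrier G}. enat (card S))"

definition top_gen_rank :: "('a, 'b) monoid_scheme \<Rightarrow> 'a topology \<Rightarrow> enat"
  where "top_gen_rank G T =
    (INF S \<in> {S. finite S \<and> S \<subseteq> carrier G \<and> T closure_of (generate G S) = carrier G}.
      enat (card S))"


definition fin_index_normal :: "('a, 'b) monoid_scheme \<Rightarrow> 'a set set"
  where "fin_index_normal G = {N. N \<lhd> G \<and> finite (carrier (G Mod N))}"

text \<open>
  The inverse limit of the finite quotients \<open>G Mod N\<close>, as a subgroup of their product. For
  \<open>N \<subseteq> M\<close> the transition map \<open>G Mod N \<rightarrow> G Mod M\<close> is \<open>N #> g \<mapsto> M #> g\<close>, which as an operation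
  on cosets is \<open>C \<mapsto> M <#> C\<close>.
\<close>

definition profinite_completion :: "('a, 'b) monoid_scheme \<Rightarrow> ('a set \<Rightarrow> 'a set) monoid"
  where "profinite_completion G =
    (product_group (fin_index_normal G) (\<lambda>N. G Mod N))
      \<lparr>carrier := {x \<in> carrier (product_group (fin_index_normal G) (\<lambda>N. G Mod N)).
        \<forall>N \<in> fin_index_normal G. \<forall>M \<in> fin_index_normal G. N \<subseteq> M \<longrightarrow> M <#>\<^bsub>G\<^esub> x N = x M}\<rparr>"

definition profinite_topology :: "('a, 'b) monoid_scheme \<Rightarrow> ('a set \<Rightarrow> 'a set) topology"
  where "profinite_topology G =
    subtopology
      (product_topology (\<lambda>N. discrete_topology (carrier (G Mod N))) (fin_index_normal G))
      (carrier (profinite_completion G))"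

lemma topspace_profinite_topology:
  "topspace (profinite_topology G) = carrier (profinite_completion G)"
  by (auto simp: profinite_topology_def profinite_completion_def)

lemma (in group) transition_map:
  assumes "N \<lhd> G" "M \<lhd> G" "N \<subseteq> M" "g \<in> carrier G"
  shows "M <#> (N #> g) = M #> g"
proof -
  have M: "subgroup M G" and N: "subgroup N G"
    using assms normal_imp_subgroup by auto
  have "M <#> N = M"
  proof
    show "M <#> N \<subseteq> M"
      using assms(3) subgroup.m_closed[OF M] by (auto simp: set_mult_def)
    show "M \<subseteq> M <#> N"
      using subgroup.one_closed[OF N] subgroup.mem_carrier[OF M]
      by (force simp: set_mult_def)
  qed
  then show ?thesis
    using setmult_rcos_assoc[OF subgroup.subset[OF M] subgroup.subset[OF N] assms(4)] by simp
qed

lemma (in group) subgroup_profinite_completion: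
  "subgroup (carrier (profinite_completion G))
     (product_group (fin_index_normal G) (\<lambda>N. G Mod N))"
proof -
  let ?I = "fin_index_normal G"
  let ?P = "product_group ?I (\<lambda>N. G Mod N)"
  have grp: "group (G Mod N)" if "N \<in> ?I" for N
    using that normal.factorgroup_is_group by (auto simp: fin_index_normal_def)
  interpret P: group ?P using grp by simp
  have hom: "(\<lambda>C. M <#> C) \<in> hom (G Mod N) (G Mod M)"
    if "N \<in> ?I" "M \<in> ?I" "N \<subseteq> M" for N M
  proof (rule homI)
    have nN: "N \<lhd> G" and nM: "M \<lhd> G" using that by (auto simp: fin_index_normal_def)
    fix C D assume "C \<in> carrier (G Mod N)" "D \<in> carrier (G Mod N)"
    then obtain g h where g: "g \<in> carrier G" "C = N #> g" and h: "h \<in> carrier G" "D = N #> h"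
      by (auto simp: FactGroup_def RCOSETS_def)
    show "M <#> C \<in> carrier (G Mod M)"
      using g transition_map[OF nN nM that(3)] by (auto simp: FactGroup_def RCOSETS_def)
    show "M <#> (C \<otimes>\<^bsub>G Mod N\<^esub> D) = (M <#> C) \<otimes>\<^bsub>G Mod M\<^esub> (M <#> D)"
      using g h transition_map[OF nN nM that(3)]
      by (simp add: FactGroup_def normal.rcos_sum[OF nN] normal.rcos_sum[OF nM])
  qed
  show ?thesis
  proof (rule P.subgroupI)
    show "carrier (profinite_completion G) \<subseteq> carrier ?P"
      by (auto simp: profinite_completion_def)
    have "\<one>\<^bsub>?P\<^esub> \<in> carrier (profinite_completion G)"
      using P.one_closed hom_one[OF hom grp grp] by (auto simp: profinite_completion_def)
    then show "carrier (profinite_completion G) \<noteq> {}" by auto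
  next
    fix x assume x: "x \<in> carrier (profinite_completion G)"
    then have xP: "x \<in> carrier ?P" by (auto simp: profinite_completion_def)
    have "M <#> (inv\<^bsub>G Mod N\<^esub> x N) = inv\<^bsub>G Mod M\<^esub> x M"
      if "N \<in> ?I" "M \<in> ?I" "N \<subseteq> M" for N M
    proof -
      interpret group_hom "G Mod N" "G Mod M" "\<lambda>C. M <#> C"
        by (intro group_hom.intro group_hom_axioms.intro grp hom that)
      have "x N \<in> carrier (G Mod N)" using xP that by auto
      moreover have "M <#> x N = x M" using x that by (simp add: profinite_completion_def)
      ultimately show ?thesis using hom_inv[of "x N"] by simp
    qed
    moreover have "inv\<^bsub>?P\<^esub> x = (\<lambda>N\<in>?I. inv\<^bsub>G Mod N\<^esub> x N)"
      using xP grp by (intro inv_product_group) auto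
    ultimately show "inv\<^bsub>?P\<^esub> x \<in> carrier (profinite_completion G)"
      using P.inv_closed[OF xP] by (simp add: profinite_completion_def)
  next
    fix x y assume x: "x \<in> carrier (profinite_completion G)"
      and y: "y \<in> carrier (profinite_completion G)"
    then have xy: "x \<in> carrier ?P" "y \<in> carrier ?P" by (auto simp: profinite_completion_def)
    have "M <#> (x N \<otimes>\<^bsub>G Mod N\<^esub> y N) = x M \<otimes>\<^bsub>G Mod M\<^esub> y M"
      if "N \<in> ?I" "M \<in> ?I" "N \<subseteq> M" for N M
    proof -
      have "x N \<in> carrier (G Mod N)" "y N \<in> carrier (G Mod N)" using xy that by auto
      moreover have "M <#> x N = x M" "M <#> y N = y M"
        using x y that by (simp_all add: profinite_completion_def)
      ultimately show ?thesis using hom_mult[OF hom[OF that], of "x N" "y N"] by simp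
    qed
    then show "x \<otimes>\<^bsub>?P\<^esub> y \<in> carrier (profinite_completion G)"
      using P.m_closed[OF xy] by (simp add: profinite_completion_def)
  qed
qed

lemma (in group) group_profinite_completion: "group (profinite_completion G)"
proof -
  have "group (product_group (fin_index_normal G) (\<lambda>N. G Mod N))"
    using normal.factorgroup_is_group by (intro product_group) (auto simp: fin_index_normal_def)
  from group.subgroup_imp_group[OF this subgroup_profinite_completion]
  show ?thesis by (simp add: profinite_completion_def)
qed

end

theory Submission
  imports Defs "HOL-Algebra.Solvable_Groups" "HOL-Algebra.Zassenhaus" "HOL-Number_Theory.Cong"
    "Jordan_Normal_Form.Char_Poly"
begin

text \<open>
  Suppose that all finite quotients of \<open>G\<close> are \<open>d\<close>-generated; by Zorn's lemma all proper quotients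
  of \<open>G\<close> may be assumed to be \<open>(d+1)\<close>-generated. If \<open>G\<close> is infinite, the last nontrivial term of a derived series
  yields an abelian normal subgroup \<open>A\<close>; torsion in it is removed by a version of
  Gaschuetz's lemma, so \<open>A\<close> can be taken torsion-free and rationally irreducible. Lift
  \<open>d + 1\<close> generators \<open>g\<^sub>i\<close> of \<open>G/A\<close> to \<open>g\<^sub>i b\<^sub>i\<close> with \<open>b\<^sub>i \<in> A\<close>. The subgroup they generate meets
  \<open>A\<close> in the set of values \<open>\<tau>(b)\<close> of the relators \<open>\<tau>\<close> of \<open>G/A\<close>, and \<open>b \<mapsto> \<tau>(1)\<inverse> \<tau>(b)\<close>
  is additive. If the relators move in at least two rationally independent directions (or one
  of them is a nontrivial constant), a determinant argument produces a \<open>b\<close> which works at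
  all primes. Otherwise, for almost all primes \<open>p\<close>, there are at least
  \<open>|A/A\<^sup>p|\<^sup>d\<close> subgroups \<open>X\<close> with \<open>X A = G\<close> and \<open>X \<inter> A = A\<^sup>p\<close>, which is too many for the finite
  quotients of \<open>G\<close> to be \<open>d\<close>-generated.
\<close>

section \<open>Counting supplements\<close>

text \<open>Lifting modulo a single \<open>A^m\<close> is always possible; the obstacle is one tuple
  \<open>b\<close> that is good at all primes at once. Since \<open>A\<close> is abelian, relator
  values are affine in \<open>b\<close>, and a subgroup containing \<open>A^l\<close>,
  \<open>A^J\<close> and \<open>A^f\<close> with \<open>gcd(l, J, f) = 1\<close> contains
  \<open>A\<close>. The exponents are obtained in an order that avoids circularity: \<open>m\<close>
  first; then \<open>J\<close>, from relators whose values the final adjustment leaves alone, so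
  that only the finitely many primes dividing \<open>J\<close> stay dangerous; then the adjustment,
  which keeps the determinant \<open>f\<close> prime to those not dividing \<open>m\<close>. The
  remaining primes are covered by \<open>l\<close>, congruent to 1 modulo \<open>m\<close>. Such a
  \<open>J\<close> needs relators that are killed by one direction and moved by another. If there
  are none, no finite set of dangerous primes can be isolated in this way, and the argument turns to
  counting. There the extra generator is spent: fixing the value of one relator modulo
  \<open>A^p\<close> costs one factor \<open>|A/A^p|\<close> out of \<open>d + 1\<close>. The
  remaining \<open>d\<close> factors contradict the count only because the bound in
  \<open>complement_count\<close> is strict.\<close>

definition generated_mod :: "('a, 'b) monoid_scheme \<Rightarrow> nat \<Rightarrow> 'a set \<Rightarrow> bool"
  where "generated_mod G d N \<longleftrightarrow>
    (\<exists>h. h ` {..<d} \<subseteq> carrier G \<and> generate G (h ` {..<d} \<union> N) = carrier G)"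

text \<open>For a subgroup \<open>U\<close> of \<open>A\<close> the elements of \<open>S\<close>
  represent the cosets \<open>s U\<close>, so \<open>card S\<close> is the index of \<open>U\<close>
  in \<open>A\<close>, available without forming the quotient.\<close>

definition transversal :: "('a, 'b) monoid_scheme \<Rightarrow> 'a set \<Rightarrow> 'a set \<Rightarrow> 'a set \<Rightarrow> bool"
  where "transversal G S A U \<longleftrightarrow>
    finite S \<and> S \<subseteq> A \<and> (\<forall>x\<in>A. \<exists>!s. s \<in> S \<and> inv\<^bsub>G\<^esub> s \<otimes>\<^bsub>G\<^esub> x \<in> U)"

context group
begin

lemma inv_mult_cancel:
  "x \<in> carrier G \<Longrightarrow> y \<in> carrier G \<Longrightarrow> inv x \<otimes> (x \<otimes> y) = y"
  "x \<in> carrier G \<Longrightarrow> y \<in> carrier G \<Longrightarrow> x \<otimes> (inv x \<otimes> y) = y"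
  by (simp_all flip: m_assoc)

text \<open>These rules, with the simplifier's own, normalise products as reduced words of a free
  group, once the factors are known to lie in the carrier.\<close>

lemmas free_simps = m_assoc inv_mult_group inv_mult_cancel

lemma subgroup_set_mult_normal:
  assumes "subgroup H G" "N \<lhd> G"
  shows "subgroup (H <#> N) G"
  using mult_norm_subgroup[OF assms(2,1)] commut_normal[OF assms] by simp

lemma generate_Un_normal:
  assumes "Y \<subseteq> carrier G" "N \<lhd> G"
  shows "generate G (Y \<union> N) = generate G Y <#> N"
proof
  interpret N: normal N G by fact
  have sY: "subgroup (generate G Y) G" using assms(1) by (rule generate_is_subgroup)
  have "subgroup (generate G Y <#> N) G"
    by (rule subgroup_set_mult_normal[OF sY assms(2)])
  moreover have "Y \<union> N \<subseteq> generate G Y <#> N"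
  proof -
    have "y \<in> generate G Y <#> N" if "y \<in> Y" for y
      unfolding set_mult_def using that assms(1) generate.incl[OF that, of G]
      by (intro UN_I[of y] UN_I[of \<one>]) auto
    moreover have "y \<in> generate G Y <#> N" if "y \<in> N" for y
      unfolding set_mult_def using that generate.one[of G Y] N.mem_carrier
      by (intro UN_I[of \<one>] UN_I[of y]) auto
    ultimately show ?thesis by blast
  qed
  ultimately show "generate G (Y \<union> N) \<subseteq> generate G Y <#> N"
    by (rule generate_subgroup_incl[rotated])
  have "h \<otimes> k \<in> generate G (Y \<union> N)" if "h \<in> generate G Y" "k \<in> N" for h k
    using that mono_generate[of Y "Y \<union> N"] generate.incl[of k "Y \<union> N" G]
    by (intro generate.eng) auto
  then show "generate G Y <#> N \<subseteq> generate G (Y \<union> N)" by (auto simp: set_mult_def)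
qed

lemma normal_conj:
  assumes "N \<lhd> G" "x \<in> N" "g \<in> carrier G"
  shows "g \<otimes> x \<otimes> inv g \<in> N" "inv g \<otimes> x \<otimes> g \<in> N"
  using assms by (auto simp: normal.inv_op_closed1 normal.inv_op_closed2)

lemma normal_swap:
  assumes "N \<lhd> G" "x \<in> carrier G" "y \<in> carrier G"
  shows "x \<otimes> y \<in> N \<longleftrightarrow> y \<otimes> x \<in> N"
proof -
  have "y \<otimes> x \<in> N" if "x \<otimes> y \<in> N" "x \<in> carrier G" "y \<in> carrier G" for x y
    using normal_conj(2)[OF assms(1) that(1,2)] that(2,3) by (simp add: free_simps)
  then show ?thesis using assms by blast
qed

text \<open>\<open>N\<close> is the kernel of the action of \<open>G\<close> by right multiplication
  on the finite set of all right cosets of members of \<open>XX\<close>. An element that fixes the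
  coset \<open>X\<close> lies in \<open>X\<close>.\<close>

lemma finite_index_core:
  assumes "finite XX" "\<And>X. X \<in> XX \<Longrightarrow> subgroup X G \<and> finite (rcosets X)"
  shows "\<exists>N\<in>fin_index_normal G. \<forall>X\<in>XX. N \<subseteq> X"
proof -
  define CC where "CC = (\<Union>X\<in>XX. rcosets X)"
  have fin: "finite CC" using assms by (auto simp: CC_def)
  define act where "act = (\<lambda>g. \<lambda>C\<in>CC. C #> g)"
  have CCsub: "C \<subseteq> carrier G" if "C \<in> CC" for C
    using that assms(2) subgroup.rcosets_carrier[OF _ group_axioms] by (auto simp: CC_def)
  have closed: "C #> g \<in> CC" if "C \<in> CC" "g \<in> carrier G" for C g
  proof -
    from that obtain X x where X: "X \<in> XX" "x \<in> carrier G" "C = X #> x"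
      by (auto simp: CC_def RCOSETS_def)
    have "X \<subseteq> carrier G" using assms(2)[OF X(1)] subgroup.subset by blast
    then have "C #> g = X #> (x \<otimes> g)" using X that by (simp add: coset_mult_assoc)
    then show ?thesis using X that by (auto simp: CC_def RCOSETS_def)
  qed
  define N where "N = {g \<in> carrier G. \<forall>C\<in>CC. C #> g = C}"
  have inv_fix: "C #> inv g = C" if "C \<in> CC" "g \<in> carrier G" "C #> g = C" for C g
    using that coset_mult_assoc[OF CCsub[OF that(1)], of g "inv g"] CCsub[OF that(1)] by simp
  have "subgroup N G"
  proof (rule subgroupI)
    show "N \<subseteq> carrier G" by (auto simp: N_def)
    show "N \<noteq> {}" using CCsub by (auto simp: N_def intro!: exI[of _ \<one>])
    show "inv g \<in> N" if "g \<in> N" for g using that inv_fix by (auto simp: N_def)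
    show "g \<otimes> h \<in> N" if "g \<in> N" "h \<in> N" for g h
      using that CCsub by (auto simp: N_def simp flip: coset_mult_assoc)
  qed
  moreover have "g \<otimes> n \<otimes> inv g \<in> N" if "g \<in> carrier G" "n \<in> N" for g n
  proof -
    have "C #> (g \<otimes> n \<otimes> inv g) = C" if C: "C \<in> CC" for C
    proof -
      have "C #> (g \<otimes> n \<otimes> inv g) = ((C #> g) #> n) #> inv g"
        using \<open>g \<in> carrier G\<close> \<open>n \<in> N\<close> CCsub[OF C] by (simp add: N_def coset_mult_assoc m_assoc)
      also have "(C #> g) #> n = C #> g"
        using closed[OF C \<open>g \<in> carrier G\<close>] \<open>n \<in> N\<close> by (auto simp: N_def)
      also have "(C #> g) #> inv g = C"
        using \<open>g \<in> carrier G\<close> CCsub[OF C] by (simp add: coset_mult_assoc)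
      finally show ?thesis .
    qed
    then show ?thesis using that by (auto simp: N_def)
  qed
  ultimately have N: "N \<lhd> G" by (auto simp: normal_inv_iff)
  have "finite (rcosets N)"
  proof -
    \<comment> \<open>Cosets of \<open>N\<close> correspond to the maps on \<open>CC\<close> that
      their elements induce, so there are at most as many as maps from \<open>CC\<close> to
      itself.\<close>
    have eq: "N #> g = {x \<in> carrier G. act x = act g}" if g: "g \<in> carrier G" for g
    proof -
      have "x \<in> N #> g \<longleftrightarrow> act x = act g" if x: "x \<in> carrier G" for x
      proof -
        have "x \<in> N #> g \<longleftrightarrow> x \<otimes> inv g \<in> N"
          using subgroup.rcos_module[OF normal_imp_subgroup[OF N] group_axioms g x] by simp
        also have "\<dots> \<longleftrightarrow> (\<forall>C\<in>CC. C #> x #> inv g = C)"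
          using x g CCsub by (simp add: N_def coset_mult_assoc)
        also have "\<dots> \<longleftrightarrow> (\<forall>C\<in>CC. C #> x = C #> g)"
        proof (intro ball_cong refl)
          fix C assume C: "C \<in> CC"
          have xC: "C #> x \<subseteq> carrier G" using CCsub[OF closed[OF C x]] .
          show "C #> x #> inv g = C \<longleftrightarrow> C #> x = C #> g"
            using coset_mult_inv2[OF _ x g CCsub[OF C]] coset_mult_assoc[OF xC, of "inv g" g]
              coset_mult_assoc[OF CCsub[OF C], of g "inv g"] g xC CCsub[OF C]
            by (metis coset_mult_one inv_closed l_inv r_inv)
        qed
        also have "\<dots> \<longleftrightarrow> act x = act g" by (force simp: act_def fun_eq_iff restrict_def)
        finally show ?thesis .
      qed
      moreover have "N #> g \<subseteq> carrier G"
        using g N normal_imp_subgroup subgroup.subset r_coset_subset_G by metis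
      ultimately show ?thesis by auto
    qed
    have "rcosets N \<subseteq> (\<lambda>f. {x \<in> carrier G. act x = f}) ` (CC \<rightarrow>\<^sub>E CC)"
      using eq closed by (auto simp: RCOSETS_def act_def)
    then show ?thesis by (rule finite_subset) (simp add: fin finite_PiE)
  qed
  moreover have "N \<subseteq> X" if X: "X \<in> XX" for X
  proof
    fix g assume g: "g \<in> N"
    have sX: "subgroup X G" using assms(2)[OF X] by simp
    have "X \<in> CC" using X subgroup.subgroup_in_rcosets[OF sX group_axioms] by (auto simp: CC_def)
    then have "X #> g = X" using g by (auto simp: N_def)
    then show "g \<in> X" using g coset_join1[OF _ _ sX] rcos_self[OF _ sX] by (auto simp: N_def)
  qed
  ultimately show ?thesis using N by (intro bexI[of _ N]) (auto simp: fin_index_normal_def FactGroup_def)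
qed

lemma transversal_exists:
  assumes "subgroup U G" "U \<subseteq> A" "A \<subseteq> carrier G" "finite F" "F \<subseteq> A"
    and cover: "\<And>x. x \<in> A \<Longrightarrow> \<exists>y\<in>F. inv y \<otimes> x \<in> U"
  shows "\<exists>S. transversal G S A U"
proof -
  interpret U: subgroup U G by fact
  have Uc: "U \<subseteq> carrier G" by (rule U.subset)
  define r where "r x = (SOME y. y \<in> F \<and> inv y \<otimes> x \<in> U)" for x
  have r: "r x \<in> F" "inv (r x) \<otimes> x \<in> U" if "x \<in> A" for x
    using someI_ex[of "\<lambda>y. y \<in> F \<and> inv y \<otimes> x \<in> U"] cover[OF that] unfolding r_def by blast+
  have trans: "inv a \<otimes> c \<in> U"
    if "inv a \<otimes> b \<in> U" "inv b \<otimes> c \<in> U" "a \<in> carrier G" "b \<in> carrier G" "c \<in> carrier G" for a b c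
    using U.m_closed[OF that(1,2)] that(3-) by (simp add: free_simps)
  have sym: "inv b \<otimes> a \<in> U" if "inv a \<otimes> b \<in> U" "a \<in> carrier G" "b \<in> carrier G" for a b
    using U.m_inv_closed[OF that(1)] that(2-) by (simp add: free_simps)
  \<comment> \<open>The predicates under the two choice operators coincide, so \<open>r\<close>
    takes a single value on each coset of \<open>U\<close>.\<close>
  have req: "r x = r y" if "inv x \<otimes> y \<in> U" "x \<in> A" "y \<in> A" for x y
  proof -
    have "inv z \<otimes> x \<in> U \<longleftrightarrow> inv z \<otimes> y \<in> U" if "z \<in> F" for z
      using trans[of z x y] trans[of z y x] sym[of x y] \<open>inv x \<otimes> y \<in> U\<close> that assms(3,5)
        \<open>x \<in> A\<close> \<open>y \<in> A\<close> by blast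
    then have "(\<lambda>z. z \<in> F \<and> inv z \<otimes> x \<in> U) = (\<lambda>z. z \<in> F \<and> inv z \<otimes> y \<in> U)" by blast
    then show ?thesis unfolding r_def by simp
  qed
  have "transversal G (r ` A) A U"
    unfolding transversal_def
  proof (intro conjI ballI)
    show "finite (r ` A)" using r(1) assms(4) by (meson finite_subset image_subsetI)
    show "r ` A \<subseteq> A" using r(1) assms(5) by auto
    fix x assume x: "x \<in> A"
    show "\<exists>!s. s \<in> r ` A \<and> inv s \<otimes> x \<in> U"
    proof (rule ex1I[of _ "r x"])
      show "r x \<in> r ` A \<and> inv (r x) \<otimes> x \<in> U" using x r by auto
      fix s assume s: "s \<in> r ` A \<and> inv s \<otimes> x \<in> U"
      then obtain y where y: "y \<in> A" "s = r y" by auto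
      have c: "r y \<in> carrier G" "y \<in> carrier G" "x \<in> carrier G" using r y x assms(3,5) by blast+
      have "inv y \<otimes> x \<in> U" using trans[of y "r y" x] sym[of "r y" y] r(2)[OF y(1)] s c unfolding y(2) by blast
      then show "s = r x" using req[of y x] x y by simp
    qed
  qed
  then show ?thesis by blast
qed

text \<open>
  Choose \<open>h\<^sub>1, \<dots>, h\<^sub>d\<close> generating \<open>G\<close> modulo a normal subgroup of finite index contained in all
  members of \<open>XX\<close>. Sending \<open>X\<close> to the tuple of those \<open>s\<^sub>i \<in> S\<close> with \<open>h\<^sub>i s\<^sub>i\<inverse> \<in> X\<close> is injective, and
  it misses the tuple representing the trivial cosets.
\<close>

lemma complement_count:
  assumes A: "A \<lhd> G" and U: "U \<lhd> G" "U \<subseteq> A" "U \<noteq> A" and S: "transversal G S A U"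
    and fin: "finite XX"
    and XX: "\<And>X. X \<in> XX \<Longrightarrow> subgroup X G \<and> X \<inter> A = U \<and> X <#> A = carrier G"
    and gen: "\<And>N. N \<in> fin_index_normal G \<Longrightarrow> generated_mod G d N"
  shows "card XX < card S ^ d"
proof -
  interpret A: normal A G by fact
  interpret U: normal U G by fact
  note Ac = A.mem_carrier
  have SA: "s \<in> A" "s \<in> carrier G" if "s \<in> S" for s using that S Ac by (auto simp: transversal_def)
  have finS: "finite S" using S by (simp add: transversal_def)
  have decomp: "\<exists>s\<in>S. g \<otimes> inv s \<in> X" if X: "X \<in> XX" and g: "g \<in> carrier G" for X g
  proof -
    interpret X: subgroup X G using XX X by blast
    obtain x a where xa: "x \<in> X" "a \<in> A" "g = x \<otimes> a"
      using XX[OF X] g unfolding set_mult_def by blast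
    obtain s where s: "s \<in> S" "inv s \<otimes> a \<in> U" using S xa(2) unfolding transversal_def by metis
    have "a \<otimes> inv s \<in> U" using s(2) normal_swap[OF U(1), of "inv s" a] SA s xa Ac by auto
    then have "x \<otimes> (a \<otimes> inv s) \<in> X" using xa XX[OF X] by blast
    then show ?thesis using s xa SA Ac by (auto simp: m_assoc)
  qed
  have uniq: "s = t" if X: "X \<in> XX" "g \<in> carrier G" "s \<in> S" "t \<in> S" "g \<otimes> inv s \<in> X" "g \<otimes> inv t \<in> X"
    for X g s t
  proof -
    interpret X: subgroup X G using XX X by blast
    have "inv (g \<otimes> inv s) \<otimes> (g \<otimes> inv t) \<in> X" using that by blast
    then have "s \<otimes> inv t \<in> X" using that SA by (simp add: free_simps)
    moreover have "s \<otimes> inv t \<in> A" using that SA by blast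
    ultimately have "s \<otimes> inv t \<in> U" using XX[OF X(1)] by blast
    then have "inv t \<otimes> s \<in> U" using normal_swap[OF U(1)] SA that by auto
    moreover have "inv s \<otimes> s \<in> U" using SA that by simp
    ultimately show ?thesis using S SA that unfolding transversal_def by blast
  qed
  have index: "finite (rcosets X)" if X: "X \<in> XX" for X
  proof -
    have sX: "subgroup X G" using XX X by blast
    have "rcosets X \<subseteq> (\<lambda>s. X #> s) ` S"
    proof
      fix C assume "C \<in> rcosets X"
      then obtain g where g: "g \<in> carrier G" "C = X #> g" by (auto simp: RCOSETS_def)
      obtain s where s: "s \<in> S" "g \<otimes> inv s \<in> X" using decomp[OF X g(1)] by blast
      have "g \<in> X #> s" using s subgroup.rcos_module_rev[OF sX group_axioms] SA g by blast
      then have "X #> g = X #> s" using repr_independence[OF _ _ sX] SA s by metis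
      then show "C \<in> (\<lambda>s. X #> s) ` S" using g s by blast
    qed
    then show ?thesis using finS finite_surj by blast
  qed
  have "\<exists>N\<in>fin_index_normal G. \<forall>X\<in>XX. N \<subseteq> X"
    by (rule finite_index_core[OF fin]) (use XX index in simp)
  then obtain N where N: "N \<in> fin_index_normal G" "\<And>X. X \<in> XX \<Longrightarrow> N \<subseteq> X"
    by blast
  obtain h where h: "h ` {..<d} \<subseteq> carrier G" "generate G (h ` {..<d} \<union> N) = carrier G"
    using gen[OF N(1)] by (auto simp: generated_mod_def)
  have Nc: "N \<subseteq> carrier G" using N(1) normal_imp_subgroup[of N G] subgroup.subset[of N G]
    unfolding fin_index_normal_def by blast
  define f where "f X = (\<lambda>i\<in>{..<d}. SOME s. s \<in> S \<and> h i \<otimes> inv s \<in> X)" for X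
  have f: "f X i \<in> S" "h i \<otimes> inv (f X i) \<in> X" if "X \<in> XX" "i < d" for X i
    using someI_ex[of "\<lambda>s. s \<in> S \<and> h i \<otimes> inv s \<in> X"] decomp[of X "h i"] that h(1)
    unfolding f_def by auto
  \<comment> \<open>\<open>X\<close> and \<open>Y\<close> share the elements
    \<open>h i \<otimes> inv (f X i)\<close> and all of \<open>N\<close>, so
    \<open>X \<inter> Y\<close> already supplements \<open>A\<close>. By Dedekind's argument an
    element of \<open>X\<close> differs from one of \<open>X \<inter> Y\<close> by an element of
    \<open>X \<inter> A = U\<close>, which lies in \<open>Y\<close>.\<close>
  have incl: "X \<subseteq> Y" if XY: "X \<in> XX" "Y \<in> XX" "f X = f Y" for X Y
  proof
    interpret X: subgroup X G using XX XY by blast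
    interpret Y: subgroup Y G using XX XY by blast
    have sXY: "subgroup (X \<inter> Y) G" using X.subgroup_axioms Y.subgroup_axioms subgroups_Inter_pair by blast
    have sW: "subgroup ((X \<inter> Y) <#> A) G" by (rule subgroup_set_mult_normal[OF sXY A])
    have "h i \<in> (X \<inter> Y) <#> A" if i: "i < d" for i
    proof -
      have "h i \<otimes> inv (f X i) \<in> X \<inter> Y" using f[OF XY(1) i] f[OF XY(2) i] XY(3) by simp
      moreover have "h i = (h i \<otimes> inv (f X i)) \<otimes> f X i"
        using SA f[OF XY(1) i] h(1) i by (auto simp: free_simps)
      ultimately show ?thesis unfolding set_mult_def using f[OF XY(1) i] SA by blast
    qed
    moreover have "n \<in> (X \<inter> Y) <#> A" if "n \<in> N" for n
      unfolding set_mult_def using that N(2) XY Nc by (intro UN_I[of n] UN_I[of \<one>]) auto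
    ultimately have "h ` {..<d} \<union> N \<subseteq> (X \<inter> Y) <#> A" by blast
    from generate_subgroup_incl[OF this sW] h(2) have W: "carrier G \<subseteq> (X \<inter> Y) <#> A" by simp
    fix x assume x: "x \<in> X"
    then obtain y a where ya: "y \<in> X" "y \<in> Y" "a \<in> A" "x = y \<otimes> a"
      using W X.mem_carrier unfolding set_mult_def by blast
    have "inv y \<otimes> x = a" using ya Ac X.mem_carrier by (simp add: free_simps)
    moreover have "inv y \<otimes> x \<in> X" using ya x by blast
    ultimately have "a \<in> X \<inter> A" using ya by simp
    then have "a \<in> Y" using XX XY by blast
    then show "x \<in> Y" using ya by simp
  qed
  have inj: "inj_on f XX" by (rule inj_onI) (use incl in \<open>metis subset_antisym\<close>)
  obtain s0 where s0: "s0 \<in> S" "inv s0 \<in> U"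
    using S A.one_closed SA unfolding transversal_def by (metis inv_closed r_one)
  then have s0U: "s0 \<in> U" using U.m_inv_closed SA by fastforce
  \<comment> \<open>\<open>s0\<close> represents the trivial coset. A member of \<open>XX\<close>
    with this tuple would contain every \<open>h i\<close> and \<open>N\<close>, hence be all of
    \<open>G\<close>, against \<open>U \<noteq> A\<close>.\<close>
  define c where "c = (\<lambda>i\<in>{..<d}. s0)"
  have "c \<notin> f ` XX"
  proof
    assume "c \<in> f ` XX"
    then obtain X where X: "X \<in> XX" "f X = c" by auto
    interpret X: subgroup X G using XX X by blast
    have "h i \<in> X" if "i < d" for i
    proof -
      have "f X i = s0" using X that by (simp add: c_def)
      then have "h i \<otimes> inv s0 \<in> X" using f(2)[OF X(1) that] by simp
      moreover have "s0 \<in> X" using s0U XX[OF X(1)] by blast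
      ultimately have "h i \<otimes> inv s0 \<otimes> s0 \<in> X" by blast
      then show ?thesis using h(1) that SA[OF s0(1)] by (auto simp: free_simps)
    qed
    then have "h ` {..<d} \<union> N \<subseteq> X" using N X by blast
    then have "carrier G \<subseteq> X" using generate_subgroup_incl[OF _ X.subgroup_axioms] h(2) by metis
    then show False using XX[OF X(1)] A.subset U(3) by blast
  qed
  moreover have "c \<in> {..<d} \<rightarrow>\<^sub>E S" using s0 by (auto simp: c_def)
  moreover have "f ` XX \<subseteq> {..<d} \<rightarrow>\<^sub>E S"
    using f(1) by (auto simp: PiE_iff f_def extensional_def) (metis f(1) f_def lessThan_iff restrict_apply')
  ultimately have "f ` XX \<subset> {..<d} \<rightarrow>\<^sub>E S" by blast
  then have "card (f ` XX) < card ({..<d} \<rightarrow>\<^sub>E S)"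
    by (intro psubset_card_mono finite_PiE) (auto simp: finS)
  then show ?thesis using inj by (simp add: card_image card_PiE)
qed

end

section \<open>Lifting generators modulo a finite quotient\<close>

context group begin

lemma generated_subset_eq:
  assumes "generate G Y = carrier G" "Y \<subseteq> X" "subgroup X G"
  shows "X = carrier G"
  using assms generate_subgroup_incl[OF assms(2,3)] subgroup.subset[OF assms(3)] by auto

lemma transversalD:
  assumes "transversal G S A U" "x \<in> A"
  shows "\<exists>s. s \<in> S \<and> s \<in> A \<and> inv s \<otimes> x \<in> U"
  using assms unfolding transversal_def by blast

text \<open>For a subgroup \<open>V\<close> between \<open>U\<close> and \<open>A\<close>,
  \<open>card (V \<inter> S)\<close> is the index of \<open>U\<close> in \<open>V\<close>. It serves
  as the measure for minimal and maximal choices among such subgroups.\<close>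

lemma transversal_card_less:
  assumes "subgroup V G" "V \<subset> W" "subgroup W G" "W \<subseteq> A" "A \<subseteq> carrier G" "U \<subseteq> V" "transversal G S A U"
  shows "card (V \<inter> S) < card (W \<inter> S)"
proof -
  interpret V: subgroup V G by fact
  interpret W: subgroup W G by fact
  obtain x where x: "x \<in> W" "x \<notin> V" using assms(2) by blast
  have "x \<in> A" using x(1) assms(4) by blast
  from transversalD[OF assms(7) this] obtain s where s: "s \<in> S" "s \<in> A" "inv s \<otimes> x \<in> U" by blast
  have sc: "s \<in> carrier G" using s(2) assms(5) by blast
  have W: "inv s \<otimes> x \<in> W" using s assms by blast
  have "x \<otimes> inv (inv s \<otimes> x) = s" using sc x by (simp add: free_simps)
  then have "s \<in> W" using W x by (metis W.m_closed W.m_inv_closed)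
  moreover have "s \<notin> V"
  proof
    assume "s \<in> V"
    then have "s \<otimes> (inv s \<otimes> x) \<in> V" using s assms(6) by blast
    then show False using sc x by (simp add: free_simps)
  qed
  ultimately have "V \<inter> S \<subset> W \<inter> S" using assms(2) s(1) by blast
  moreover have "finite (W \<inter> S)" using assms(7) by (simp add: transversal_def)
  ultimately show ?thesis by (rule psubset_card_mono[rotated])
qed

text \<open>
  A variant of Gaschuetz' lemma in which \<open>G\<close> itself need not be \<open>k\<close>-generated. If all lifts from
  \<open>U\<close> to the next smaller normal subgroup \<open>V\<close> failed, they would give \<open>|U/V|\<^sup>k\<close> supplements,
  contradicting the preceding count.
\<close>

theorem lift_generators:
  assumes A: "A \<lhd> G" and comm: "\<And>x y. x \<in> A \<Longrightarrow> y \<in> A \<Longrightarrow> x \<otimes> y = y \<otimes> x"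
    and U0: "U0 \<lhd> G" "U0 \<subseteq> A" and S: "transversal G S A U0"
    and g: "g ` {..<k} \<subseteq> carrier G" "generate G (g ` {..<k} \<union> A) = carrier G"
    and gen: "\<And>N. N \<in> fin_index_normal G \<Longrightarrow> generated_mod G k N"
  shows "\<exists>a. (\<forall>i. a i \<in> A) \<and> generate G ((\<lambda>i. g i \<otimes> a i) ` {..<k} \<union> U0) = carrier G"
proof -
  interpret A: normal A G by fact
  define P where "P U \<longleftrightarrow> U \<lhd> G \<and> U0 \<subseteq> U \<and> U \<subseteq> A \<and>
    (\<exists>a. (\<forall>i. a i \<in> A) \<and> generate G ((\<lambda>i. g i \<otimes> a i) ` {..<k} \<union> U) = carrier G)" for U
  have finS: "finite S" using S by (simp add: transversal_def)
  have "(\<lambda>i. g i \<otimes> \<one>) ` {..<k} = g ` {..<k}" using g(1) by (intro image_cong) auto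
  then have "P A" unfolding P_def using A U0 g(2) by (intro conjI exI[of _ "\<lambda>i. \<one>"]) auto
  \<comment> \<open>Among the normal subgroups modulo which a lift exists, \<open>U\<close> has
    least index over \<open>U0\<close>.\<close>
  then obtain U where PU: "P U" and min: "\<And>V. P V \<Longrightarrow> card (U \<inter> S) \<le> card (V \<inter> S)"
    using ex_has_least_nat[of P A "\<lambda>U. card (U \<inter> S)"] by blast
  obtain a where a: "\<And>i. a i \<in> A" "generate G ((\<lambda>i. g i \<otimes> a i) ` {..<k} \<union> U) = carrier G"
    and U: "U \<lhd> G" "U0 \<subseteq> U" "U \<subseteq> A" using PU unfolding P_def by blast
  interpret U: normal U G by fact
  have "U = U0"
  proof (rule ccontr)
    assume ne: "U \<noteq> U0"
    define Q where "Q V \<longleftrightarrow> V \<lhd> G \<and> U0 \<subseteq> V \<and> V \<subset> U" for V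
    have "Q U0" using U0 U ne by (auto simp: Q_def)
    moreover have "\<forall>V. Q V \<longrightarrow> card (V \<inter> S) < Suc (card S)"
      using finS by (auto simp: less_Suc_eq_le intro: card_mono)
    \<comment> \<open>By maximality of \<open>V\<close>, \<open>U/V\<close> is a chief factor of
      \<open>G\<close>.\<close>
    ultimately obtain V where QV: "Q V" and max: "\<And>W. Q W \<Longrightarrow> card (W \<inter> S) \<le> card (V \<inter> S)"
      using ex_has_greatest_nat[of Q U0 "\<lambda>U. card (U \<inter> S)" "Suc (card S)"] by blast
    have V: "V \<lhd> G" "U0 \<subseteq> V" "V \<subset> U" using QV by (auto simp: Q_def)
    interpret V: normal V G by fact
    have between: "W = V \<or> W = U" if W: "W \<lhd> G" "V \<subseteq> W" "W \<subseteq> U" for W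
    proof (rule ccontr)
      assume "\<not> (W = V \<or> W = U)"
      then have "Q W" "V \<subset> W" using W V by (auto simp: Q_def)
      then show False
        using max[of W] transversal_card_less[OF V.subgroup_axioms _ normal_imp_subgroup[OF W(1)] _ A.subset V(2) S]
          W U by fastforce
    qed
    have notP: "\<not> P V"
      using min[of V] transversal_card_less[OF V.subgroup_axioms V(3) U.subgroup_axioms U(3) A.subset V(2) S]
      by auto
    have "\<exists>F. finite F \<and> F \<subseteq> U \<and> (\<forall>x\<in>U. \<exists>y\<in>F. inv y \<otimes> x \<in> V)"
    proof (intro exI conjI ballI)
      show "finite (S \<inter> U)" using finS by simp
      fix x assume x: "x \<in> U"
      from x U(3) have "x \<in> A" by blast
      from transversalD[OF S this] obtain s where s: "s \<in> S" "s \<in> A" "inv s \<otimes> x \<in> U0" by blast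
      have "s = x \<otimes> inv (inv s \<otimes> x)" using s x by (simp add: free_simps)
      moreover have "inv s \<otimes> x \<in> U" using s U by blast
      ultimately have "s \<in> U" using x by (metis U.m_closed U.m_inv_closed)
      then show "\<exists>y\<in>S \<inter> U. inv y \<otimes> x \<in> V" using s V(2) by blast
    qed auto
    then obtain F where F: "finite F" "F \<subseteq> U" "\<And>x. x \<in> U \<Longrightarrow> \<exists>y\<in>F. inv y \<otimes> x \<in> V" by blast
    obtain T where T: "transversal G T U V"
      using transversal_exists[OF V.subgroup_axioms psubset_imp_subset[OF V(3)] U.subset F] by blast
    have TU: "t \<in> U" if "t \<in> T" for t using T that by (auto simp: transversal_def)
    have finT: "finite T" using T by (simp add: transversal_def)
    \<comment> \<open>Members of the extensional function space are \<open>undefined\<close> from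
      \<open>k\<close> on; the correction is switched off there so that every entry stays in
      \<open>A\<close>.\<close>
    define ab where "ab b i = a i \<otimes> (if i < k then b i else \<one>)" for b i
    define X where "X b = generate G ((\<lambda>i. g i \<otimes> ab b i) ` {..<k} \<union> V)" for b
    have B: "b i \<in> U" if "b \<in> {..<k} \<rightarrow>\<^sub>E T" "i < k" for b i using that TU by blast
    have abA: "ab b i \<in> A" if "b \<in> {..<k} \<rightarrow>\<^sub>E T" for b i
      using B[OF that, of i] a(1)[of i] U(3) by (auto simp: ab_def)
    have gab: "(\<lambda>i. g i \<otimes> ab b i) ` {..<k} \<subseteq> carrier G" if "b \<in> {..<k} \<rightarrow>\<^sub>E T" for b
      using abA[OF that] g(1) by auto
    have sX: "subgroup (X b) G" if "b \<in> {..<k} \<rightarrow>\<^sub>E T" for b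
      unfolding X_def by (rule generate_is_subgroup) (use gab[OF that] V.subset in blast)
    have inX: "g i \<otimes> ab b i \<in> X b" if "i < k" for b i
      unfolding X_def using that by (intro generate.incl) auto
    have VX: "V \<subseteq> X b" for b unfolding X_def by (auto intro: generate.incl)
    have XU: "X b <#> U = carrier G" if b: "b \<in> {..<k} \<rightarrow>\<^sub>E T" for b
    proof (rule generated_subset_eq[OF a(2) _ subgroup_set_mult_normal[OF sX[OF b] U(1)]])
      have "g i \<otimes> a i \<in> X b <#> U" if i: "i < k" for i
      proof -
        have "g i \<otimes> a i = (g i \<otimes> ab b i) \<otimes> inv (b i)"
          using i B[OF b i] a(1)[of i] g(1) by (auto simp: ab_def free_simps)
        then show ?thesis unfolding set_mult_def using inX[OF i] B[OF b i] by blast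
      qed
      moreover have "U \<subseteq> X b <#> U"
        using subgroup.one_closed[OF sX[OF b]] unfolding set_mult_def by force
      ultimately show "(\<lambda>i. g i \<otimes> a i) ` {..<k} \<union> U \<subseteq> X b <#> U" by blast
    qed
    \<comment> \<open>\<open>X b \<inter> U\<close> is normalised by \<open>X b\<close> and
      centralised by the abelian \<open>U\<close>, hence normal in \<open>G = X b U\<close>. As
      \<open>U/V\<close> is a chief factor, it is \<open>V\<close> or \<open>U\<close>, and in the
      second case \<open>b\<close> would be a lift modulo \<open>V\<close>.\<close>
    have Xint: "X b \<inter> U = V" if b: "b \<in> {..<k} \<rightarrow>\<^sub>E T" for b
    proof -
      interpret X: subgroup "X b" G by (rule sX[OF b])
      have sW: "subgroup (X b \<inter> U) G"
        using X.subgroup_axioms U.subgroup_axioms subgroups_Inter_pair by blast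
      have "y \<otimes> w \<otimes> inv y \<in> X b \<inter> U" if y: "y \<in> carrier G" and w: "w \<in> X b \<inter> U" for y w
      proof -
        obtain x u where xu: "x \<in> X b" "u \<in> U" "y = x \<otimes> u"
          using y XU[OF b] unfolding set_mult_def by blast
        have "u \<otimes> w = w \<otimes> u" using comm xu w U by blast
        then have "u \<otimes> w \<otimes> inv u = w" using xu w by (simp add: m_assoc)
        then have "y \<otimes> w \<otimes> inv y = x \<otimes> w \<otimes> inv x" using xu w
          by (simp add: inv_mult_group flip: m_assoc) (simp add: m_assoc)
        moreover have "x \<otimes> w \<otimes> inv x \<in> X b" using xu w by blast
        moreover have "x \<otimes> w \<otimes> inv x \<in> U" using xu w by (simp add: U.inv_op_closed2)
        ultimately show ?thesis by simp
      qed
      then have "X b \<inter> U \<lhd> G" using sW by (auto simp: normal_inv_iff)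
      then consider "X b \<inter> U = V" | "X b \<inter> U = U"
        using between[of "X b \<inter> U"] VX V(3) by blast
      then show ?thesis
      proof cases
        case 2
        then have "U \<subseteq> X b" by blast
        then have "X b <#> U \<subseteq> X b" unfolding set_mult_def by blast
        then have "X b = carrier G" using XU[OF b] X.subset by blast
        then have "P V" unfolding P_def X_def using V U abA[OF b] by blast
        then show ?thesis using notP by simp
      qed
    qed
    have inj: "inj_on X ({..<k} \<rightarrow>\<^sub>E T)"
    proof (rule inj_onI)
      fix b c assume b: "b \<in> {..<k} \<rightarrow>\<^sub>E T" and c: "c \<in> {..<k} \<rightarrow>\<^sub>E T" and eq: "X b = X c"
      have "b i = c i" if i: "i < k" for i
      proof -
        interpret X: subgroup "X b" G by (rule sX[OF b])
        have "inv (g i \<otimes> ab b i) \<otimes> (g i \<otimes> ab c i) \<in> X b"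
          using inX[OF i, of b] inX[OF i, of c] eq by auto
        then have "inv (b i) \<otimes> c i \<in> X b"
          using i B[OF b i] B[OF c i] a(1)[of i] g(1) by (auto simp: ab_def free_simps)
        then have "inv (b i) \<otimes> c i \<in> V" using Xint[OF b] B[OF b i] B[OF c i] by blast
        moreover have "inv (c i) \<otimes> c i \<in> V" using B[OF c i] by simp
        moreover have "b i \<in> T" "c i \<in> T" using b c i by auto
        ultimately show ?thesis using T B[OF c i] unfolding transversal_def by blast
      qed
      then show "b = c" using b c by (intro PiE_ext) auto
    qed
    have "card (X ` ({..<k} \<rightarrow>\<^sub>E T)) < card T ^ k"
    proof (rule complement_count[OF U(1) V(1) _ _ T])
      show "V \<subseteq> U" "V \<noteq> U" using V by auto
      show "finite (X ` ({..<k} \<rightarrow>\<^sub>E T))" using finT by (simp add: finite_PiE)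
      fix Y assume "Y \<in> X ` ({..<k} \<rightarrow>\<^sub>E T)"
      then show "subgroup Y G \<and> Y \<inter> U = V \<and> Y <#> U = carrier G"
        using sX Xint XU by blast
    qed (rule gen)
    then show False using card_image[OF inj] by (simp add: card_PiE)
  qed
  then show ?thesis using a by blast
qed

end

section \<open>Finitely generated abelian normal subgroups\<close>

lemma monic_root_bound:
  fixes f :: "int poly"
  assumes "prime (p::int)" "coeff f n = 1" "degree f = n" "finite X"
    "\<And>x. x \<in> X \<Longrightarrow> p dvd poly f x"
    "\<And>x y. x \<in> X \<Longrightarrow> y \<in> X \<Longrightarrow> p dvd x - y \<Longrightarrow> x = y"
  shows "card X \<le> n"
  using assms(2-)
proof (induction n arbitrary: f X)
  case 0
  then obtain c where "f = [:c:]" using degree_eq_zeroE by blast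
  then have "poly f x = 1" for x using 0 by simp
  then have "X = {}" using 0(4) assms(1) not_prime_unit by fastforce
  then show ?case by simp
next
  case (Suc n)
  show ?case
  proof (cases "X = {}")
    case False
    then obtain c where c: "c \<in> X" by blast
    define g where "g = synthetic_div f c"
    have deg: "degree g = n" using Suc.prems(2) by (simp add: g_def degree_synthetic_div)
    \<comment> \<open>Comparing coefficients of degree \<open>n + 1\<close> in the division identity
      shows that the quotient \<open>g\<close> is again monic.\<close>
    have "coeff (f + Polynomial.smult c g) (Suc n) = coeff (pCons (poly f c) g) (Suc n)"
      unfolding g_def by (simp only: synthetic_div_correct)
    then have lead: "coeff g n = 1" using Suc.prems(1) deg by (simp add: coeff_eq_0)
    have "p dvd poly g x" if x: "x \<in> X - {c}" for x
    proof -
      have "poly f x = (x - c) * poly g x + poly f c"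
        using arg_cong[OF synthetic_div_correct'[of c f], of "\<lambda>h. poly h x"]
        by (simp add: g_def algebra_simps)
      then have "(x - c) * poly g x = poly f x - poly f c" by simp
      then have "p dvd (x - c) * poly g x" using Suc.prems(4) x c by simp
      moreover have "\<not> p dvd x - c" using Suc.prems(5)[of x c] x c by auto
      ultimately show ?thesis using prime_dvd_multD[OF assms(1)] by blast
    qed
    then have "card (X - {c}) \<le> n"
      using Suc.prems by (intro Suc.IH[OF lead deg]) auto
    then show ?thesis using c Suc.prems(3) by simp
  qed simp
qed

text \<open>The determinant is the characteristic polynomial of \<open>-N\<close> at
  \<open>c * s\<close>. By \<open>small\<close>, a prime not dividing \<open>c\<close> exceeds
  \<open>r\<close>, so this monic polynomial of degree \<open>r\<close> has a nonroot modulo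
  \<open>p\<close> among \<open>0, ..., r\<close>. As \<open>c\<close> is invertible modulo
  \<open>p\<close>, \<open>c * s\<close> can be made congruent to that nonroot, and the Chinese
  remainder theorem treats the prime divisors of \<open>J\<close> together.\<close>

lemma det_add_scalar_avoids_primes:
  fixes N :: "nat \<Rightarrow> nat \<Rightarrow> int" and c :: int
  assumes J: "J \<noteq> 0" and small: "\<And>p::nat. prime p \<Longrightarrow> p \<le> r \<Longrightarrow> int p dvd c"
  shows "\<exists>s::int. \<forall>p::nat. prime p \<longrightarrow> int p dvd J \<longrightarrow> \<not> int p dvd c \<longrightarrow>
    \<not> int p dvd det (mat r r (\<lambda>(i,j). N i j + (if i = j then c * s else 0)))"
proof -
  define B :: "int mat" where "B = mat r r (\<lambda>(i,j). - N i j)"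
  define f where "f = char_poly B"
  have B: "B \<in> carrier_mat r r" by (simp add: B_def)
  have f: "degree f = r" "coeff f r = 1" using degree_monic_char_poly[OF B] by (simp_all add: f_def)
  have ev: "poly f x = det (mat r r (\<lambda>(i,j). N i j + (if i = j then x else 0)))" for x
    unfolding f_def char_poly_def
    by (rule poly_det_cong[of _ r]) (use B in \<open>auto simp: char_poly_matrix_def B_def\<close>)
  have ex: "\<exists>t. \<forall>s. [s = t] (mod int p) \<longrightarrow> \<not> int p dvd poly f (c * s)"
    if p: "prime p" "\<not> int p dvd c" for p :: nat
  proof -
    have pr: "r < p" using small[OF p(1)] p(2) by force
    have "\<exists>x\<in>{0..int r}. \<not> int p dvd poly f x"
    proof (rule ccontr)
      assume neg: "\<not> ?thesis"
      have "card {0..int r} \<le> r"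
      proof (rule monic_root_bound[of "int p" f])
        fix x y assume xy: "x \<in> {0..int r}" "y \<in> {0..int r}" "int p dvd x - y"
        then have "\<bar>x - y\<bar> < int p" using pr by auto
        then show "x = y" using xy(3) dvd_imp_le_int[of "x - y" "int p"] by fastforce
      qed (use p f neg in auto)
      then show False by simp
    qed
    then obtain x where x: "\<not> int p dvd poly f x" by blast
    have "coprime c (int p)" using p by (metis coprime_commute prime_imp_coprime prime_nat_int_transfer)
    then obtain d where d: "[c * d = 1] (mod int p)" using cong_solve_coprime_int by blast
    have "\<not> int p dvd poly f (c * s)" if s: "[s = d * x] (mod int p)" for s
    proof -
      have "[c * s = c * (d * x)] (mod int p)" using s cong_scalar_left by blast
      also have "[c * (d * x) = x] (mod int p)" using cong_scalar_right[OF d, of x] by (simp add: mult.assoc)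
      finally have "int p dvd c * s - x" by (simp add: cong_iff_dvd_diff)
      moreover have "c * s - x dvd poly f (c * s) - poly f x"
        using arg_cong[OF synthetic_div_correct'[of x f], of "\<lambda>h. poly h (c * s)"]
        by (intro dvdI[of _ _ "poly (synthetic_div f x) (c * s)"]) (simp add: algebra_simps)
      ultimately have "int p dvd poly f (c * s) - poly f x" by (rule dvd_trans)
      then show ?thesis using x by (metis dvd_diff_right_iff dvd_diff_commute)
    qed
    then show ?thesis by blast
  qed
  define PP where "PP = {p::nat. prime p \<and> int p dvd J}"
  have "PP \<subseteq> {..nat \<bar>J\<bar>}"
  proof
    fix p assume "p \<in> PP"
    then have "\<bar>int p\<bar> \<le> \<bar>J\<bar>" using J by (intro dvd_imp_le_int) (auto simp: PP_def)
    then show "p \<in> {..nat \<bar>J\<bar>}" by simp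
  qed
  then have fin: "finite PP" using finite_subset by blast
  define t where "t p = (SOME t. \<forall>s. [s = t] (mod int p) \<longrightarrow> \<not> int p dvd poly f (c * s))" for p :: nat
  have t: "\<not> int p dvd poly f (c * s)" if "prime p" "\<not> int p dvd c" "[s = t p] (mod int p)" for p s
    using someI_ex[OF ex[OF that(1,2)]] that(3) unfolding t_def by blast
  \<comment> \<open>The remainder theorem is used over the naturals, so the integer residues are
    first reduced to nonnegative ones.\<close>
  obtain x where x: "\<And>p. p \<in> PP \<Longrightarrow> [x = nat (t p mod int p)] (mod p)"
    using chinese_remainder_nat[OF fin, of "\<lambda>p. p" "\<lambda>p. nat (t p mod int p)"]
      primes_coprime by (auto simp: PP_def)
  have "[int x = t p] (mod int p)" if p: "p \<in> PP" for p
  proof -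
    have "0 \<le> t p mod int p" using p by (simp add: PP_def prime_gt_0_nat)
    then have "[int x = t p mod int p] (mod int p)" using x[OF p] by (metis cong_int_iff int_nat_eq)
    then show ?thesis by (simp add: cong_def)
  qed
  then show ?thesis using t unfolding ev by (intro exI[of _ "int x"]) (auto simp: PP_def ev)
qed

lemma det_cong_mod:
  fixes p :: int
  assumes "\<And>i j. i < r \<Longrightarrow> j < r \<Longrightarrow> [M i j = N i j] (mod p)"
  shows "[det (mat r r (\<lambda>(i,j). M i j)) = det (mat r r (\<lambda>(i,j). N i j))] (mod p)"
proof -
  have "i < r \<and> \<pi> i < r" if "\<pi> permutes {0..<r}" "i \<in> {0..<r}" for \<pi> i
    using that permutes_in_image[of \<pi> "{0..<r}" i] by auto
  then show ?thesis
    by (subst (1 2) det_def'[where n = r])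
      (auto intro!: cong_sum cong_prod cong_mult cong_refl assms)
qed

section \<open>Powers and integer coordinates in an abelian normal subgroup\<close>

locale abelian_normal = group G for G (structure) +
  fixes A
  assumes normal: "A \<lhd> G"
    and comm: "x \<in> A \<Longrightarrow> y \<in> A \<Longrightarrow> x \<otimes> y = y \<otimes> x"
begin

sublocale A: normal A G by (rule normal)

text \<open>This is the subgroup \<open>A^m\<close>. The exponent is an integer because determinants
  will serve as exponents.\<close>

definition pows :: "int \<Rightarrow> 'a set"
  where "pows m = (\<lambda>x. x [^] m) ` A"

lemma pow_closed: "x \<in> A \<Longrightarrow> x [^] (m::int) \<in> A"
  by (rule subgroup_int_pow_closed[OF A.subgroup_axioms])

lemma pow_mult: "x \<in> A \<Longrightarrow> y \<in> A \<Longrightarrow> (x \<otimes> y) [^] (m::int) = x [^] m \<otimes> y [^] m"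
  by (rule int_pow_mult_distrib) (auto simp: comm)

lemma conj_closed: "g \<in> carrier G \<Longrightarrow> x \<in> A \<Longrightarrow> g \<otimes> x \<otimes> inv g \<in> A"
  by (rule A.inv_op_closed2)

lemma conj_pow:
  assumes "g \<in> carrier G" "x \<in> carrier G"
  shows "g \<otimes> x [^] (m::int) \<otimes> inv g = (g \<otimes> x \<otimes> inv g) [^] m"
proof -
  interpret group_hom G G "\<lambda>x. g \<otimes> x \<otimes> inv g"
    by unfold_locales (use assms(1) in \<open>auto intro!: homI simp: free_simps\<close>)
  show ?thesis by (rule hom_int_pow[OF assms(2)])
qed

lemma pows_subset: "pows m \<subseteq> A"
  by (auto simp: pows_def pow_closed)

lemma pows_normal: "pows m \<lhd> G"
proof -
  have "subgroup (pows m) G"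
  proof (rule subgroupI)
    show "pows m \<subseteq> carrier G" using pows_subset A.subset by blast
    show "pows m \<noteq> {}" using A.one_closed unfolding pows_def by blast
    show "inv x \<in> pows m" if "x \<in> pows m" for x
    proof -
      obtain y where y: "y \<in> A" "x = y [^] m" using \<open>x \<in> pows m\<close> by (auto simp: pows_def)
      then have "inv x = inv y [^] m" by (simp add: int_pow_inv)
      then show ?thesis using A.m_inv_closed[OF y(1)] unfolding pows_def by blast
    qed
    show "x \<otimes> y \<in> pows m" if "x \<in> pows m" "y \<in> pows m" for x y
    proof -
      obtain u v where u: "u \<in> A" "v \<in> A" "x = u [^] m" "y = v [^] m"
        using \<open>x \<in> pows m\<close> \<open>y \<in> pows m\<close> by (auto simp: pows_def)
      then have "x \<otimes> y = (u \<otimes> v) [^] m" by (simp add: pow_mult)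
      then show ?thesis using A.m_closed[OF u(1,2)] unfolding pows_def by blast
    qed
  qed
  moreover have "g \<otimes> x \<otimes> inv g \<in> pows m" if "g \<in> carrier G" "x \<in> pows m" for g x
  proof -
    obtain y where y: "y \<in> A" "x = y [^] m" using \<open>x \<in> pows m\<close> by (auto simp: pows_def)
    then have "g \<otimes> x \<otimes> inv g = (g \<otimes> y \<otimes> inv g) [^] m" using that by (simp add: conj_pow)
    then show ?thesis using conj_closed[OF that(1) y(1)] unfolding pows_def by blast
  qed
  ultimately show ?thesis by (auto simp: normal_inv_iff)
qed

lemma pows_mult: "pows (m * n) \<subseteq> pows m"
proof
  fix x assume "x \<in> pows (m * n)"
  then obtain y where y: "y \<in> A" "x = y [^] (m * n)" by (auto simp: pows_def)
  then have "x = (y [^] n) [^] m" by (simp add: int_pow_pow mult.commute)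
  then show "x \<in> pows m" using y pow_closed by (auto simp: pows_def)
qed

end

context group begin

text \<open>The fixed order of factors gives the product a meaning in the nonabelian
  \<open>G\<close>. The \<open>a i\<close> will generate \<open>A\<close> without being a basis, so
  an element may have several exponent vectors.\<close>

primrec lincomb :: "(nat \<Rightarrow> 'a) \<Rightarrow> nat \<Rightarrow> (nat \<Rightarrow> int) \<Rightarrow> 'a"
  where "lincomb a 0 v = \<one>"
  | "lincomb a (Suc n) v = lincomb a n v \<otimes> a n [^] v n"

lemma lincomb_cong: "(\<And>i. i < n \<Longrightarrow> v i = w i) \<Longrightarrow> lincomb a n v = lincomb a n w"
  by (induction n) auto

end

locale fg_abelian_normal = abelian_normal +
  fixes a :: "nat \<Rightarrow> 'a" and r :: nat
  assumes gens: "generate G (a ` {..<r}) = A"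
begin

lemma a_closed: "i < r \<Longrightarrow> a i \<in> A"
  using generate.incl[of "a i" "a ` {..<r}" G] gens by auto

lemma lincomb_closed: "n \<le> r \<Longrightarrow> lincomb a n v \<in> A"
  by (induction n) (auto intro!: A.m_closed pow_closed a_closed)

lemma lincomb_add:
  "n \<le> r \<Longrightarrow> lincomb a n (\<lambda>i. v i + w i) = lincomb a n v \<otimes> lincomb a n w"
proof (induction n)
  case (Suc n)
  define x y s t where "x = lincomb a n v" "y = lincomb a n w" "s = a n [^] v n" "t = a n [^] w n"
  have A: "x \<in> A" "y \<in> A" "s \<in> A" "t \<in> A"
    using Suc by (auto simp: x_y_s_t_def lincomb_closed pow_closed a_closed)
  have "lincomb a (Suc n) (\<lambda>i. v i + w i) = (x \<otimes> y) \<otimes> (s \<otimes> t)"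
    using Suc a_closed by (simp add: x_y_s_t_def int_pow_mult)
  also have "\<dots> = x \<otimes> (y \<otimes> s) \<otimes> t" using A by (simp add: m_assoc)
  also have "y \<otimes> s = s \<otimes> y" using A by (simp add: comm)
  also have "x \<otimes> (s \<otimes> y) \<otimes> t = (x \<otimes> s) \<otimes> (y \<otimes> t)" using A by (simp add: m_assoc)
  finally show ?case by (simp add: x_y_s_t_def)
qed simp

lemma lincomb_scale:
  "n \<le> r \<Longrightarrow> lincomb a n (\<lambda>i. c * v i) = lincomb a n v [^] c"
proof (induction n)
  case (Suc n)
  have "lincomb a (Suc n) v [^] c = lincomb a n v [^] c \<otimes> (a n [^] v n) [^] c"
    using Suc.prems by (simp add: pow_mult lincomb_closed pow_closed a_closed)
  then show ?case using Suc a_closed by (simp add: int_pow_pow mult.commute)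
qed simp

text \<open>The range \<open>j \<ge> n\<close> supplies the zero vector, which is how
  \<open>lincomb_surj\<close> and \<open>lincomb_sum_mem\<close> obtain \<one>.\<close>

lemma lincomb_unit:
  "n \<le> r \<Longrightarrow> lincomb a n (\<lambda>i. if i = j then c else 0) = (if j < n then a j [^] c else \<one>)"
proof (induction n)
  case (Suc n)
  have "a j [^] c \<in> A" if "j < r" using that by (simp add: pow_closed a_closed)
  then show ?case using Suc by (auto simp: less_Suc_eq)
qed simp

lemma lincomb_surj:
  assumes "x \<in> A" shows "\<exists>v. x = lincomb a r v"
proof -
  have "x \<in> generate G (a ` {..<r})" using assms gens by simp
  then show ?thesis
  proof (induction x rule: generate.induct)
    case one
    have "lincomb a r (\<lambda>i. if i = r then 1 else 0) = \<one>" by (simp add: lincomb_unit)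
    then show ?case by metis
  next
    case (incl h)
    then obtain j where j: "j < r" "h = a j" by blast
    then have "lincomb a r (\<lambda>i. if i = j then 1 else 0) = h"
      using a_closed by (simp add: lincomb_unit)
    then show ?case by metis
  next
    case (inv h)
    then obtain j where j: "j < r" "h = a j" by blast
    then have "lincomb a r (\<lambda>i. if i = j then -1 else 0) = inv h"
      using a_closed by (simp add: lincomb_unit int_pow_neg)
    then show ?case by metis
  next
    case (eng x y)
    then show ?case by (metis lincomb_add order_refl)
  qed
qed

lemma lincomb_sum_mem:
  fixes n :: nat
  assumes B: "subgroup B G" and M: "\<And>i. i < n \<Longrightarrow> lincomb a r (M i) \<in> B"
  shows "lincomb a r (\<lambda>j. \<Sum>i<n. c i * M i j) \<in> B"
  using M
proof (induction n)
  case 0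
  have "lincomb a r (\<lambda>i. if i = r then 1 else 0) = \<one>" by (simp add: lincomb_unit)
  moreover have "lincomb a r (\<lambda>i. if i = r then 1 else 0) = lincomb a r (\<lambda>i. 0)"
    by (rule lincomb_cong) simp
  ultimately show ?case using subgroup.one_closed[OF B] by simp
next
  case (Suc n)
  have "lincomb a r (\<lambda>j. c n * M n j) \<in> B"
    using Suc.prems[of n] subgroup_int_pow_closed[OF B] by (simp add: lincomb_scale)
  then show ?case using Suc by (simp add: lincomb_add subgroup.m_closed[OF B])
qed

text \<open>Cramer's rule: row \<open>j\<close> of the adjugate times the matrix is the determinant
  times the \<open>j\<close>-th unit vector, so the power is a product of powers of the elements
  given by the rows.\<close>

lemma pow_det_mem:
  assumes B: "subgroup B G" and M: "\<And>i. i < r \<Longrightarrow> lincomb a r (M i) \<in> B" and j: "j < r"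
  shows "a j [^] det (mat r r (\<lambda>(i,j). M i j)) \<in> B"
proof -
  define N where "N = mat r r (\<lambda>(i,j). M i j)"
  have N: "N \<in> carrier_mat r r" by (simp add: N_def)
  have "(adj_mat N * N) $$ (j, l) = (\<Sum>i<r. adj_mat N $$ (j, i) * M i l)" if "l < r" for l
    using adj_mat(1)[OF N] that j
    by (auto simp: times_mat_def scalar_prod_def N_def atLeast0LessThan intro!: sum.cong)
  moreover have "(adj_mat N * N) $$ (j, l) = (if l = j then det N else 0)" if "l < r" for l
    unfolding adj_mat(3)[OF N] using that j by simp
  ultimately have "(\<Sum>i<r. adj_mat N $$ (j, i) * M i l) = (if l = j then det N else 0)"
    if "l < r" for l using that by simp
  then have "lincomb a r (\<lambda>l. \<Sum>i<r. adj_mat N $$ (j, i) * M i l) = a j [^] det N"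
    using lincomb_unit[of r j "det N"] j by (subst lincomb_cong[of r _ "\<lambda>l. if l = j then det N else 0"]) auto
  moreover have "lincomb a r (\<lambda>l. \<Sum>i<r. adj_mat N $$ (j, i) * M i l) \<in> B"
    by (rule lincomb_sum_mem[OF B M])
  ultimately show ?thesis by (simp add: N_def)
qed

lemma pows_subset_of_gens:
  assumes B: "subgroup B G" and m: "\<And>j. j < r \<Longrightarrow> a j [^] m \<in> B"
  shows "pows m \<subseteq> B"
proof
  fix x assume "x \<in> pows m"
  then obtain v where v: "x = lincomb a r v [^] m" using lincomb_surj by (auto simp: pows_def)
  have "x = lincomb a r (\<lambda>j. \<Sum>i<r. v i * (if j = i then m else 0))"
    unfolding v lincomb_scale[OF order_refl, symmetric]
    by (rule lincomb_cong) (simp add: if_distrib[of "(*) _"] mult.commute cong: if_cong)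
  also have "\<dots> \<in> B" using m by (intro lincomb_sum_mem[OF B]) (simp add: lincomb_unit)
  finally show "x \<in> B" .
qed

text \<open>Reducing the exponents modulo \<open>m\<close> leaves finitely many elements that meet
  every coset of \<open>A^m\<close>.\<close>

lemma pows_transversal:
  assumes "m > 0" shows "\<exists>S. transversal G S A (pows m)"
proof (rule transversal_exists)
  define F where "F = lincomb a r ` ({..<r} \<rightarrow>\<^sub>E {0..<m})"
  show "finite F" unfolding F_def by (intro finite_imageI finite_PiE) simp_all
  show "F \<subseteq> A" unfolding F_def by (simp add: image_subset_iff lincomb_closed)
  show "subgroup (pows m) G" by (rule normal_imp_subgroup[OF pows_normal])
  show "pows m \<subseteq> A" by (rule pows_subset)
  show "A \<subseteq> carrier G" by (rule A.subset)
  fix x assume "x \<in> A"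
  then obtain v where v: "x = lincomb a r v" using lincomb_surj by blast
  define y where "y = lincomb a r (\<lambda>i\<in>{..<r}. v i mod m)"
  have y: "y = lincomb a r (\<lambda>i. v i mod m)" unfolding y_def by (rule lincomb_cong) simp
  have "x = lincomb a r (\<lambda>i. v i mod m + m * (v i div m))" unfolding v by (rule lincomb_cong) simp
  also have "\<dots> = y \<otimes> lincomb a r (\<lambda>i. v i div m) [^] m"
    unfolding lincomb_add[OF order_refl] lincomb_scale[OF order_refl] y ..
  finally have "inv y \<otimes> x = lincomb a r (\<lambda>i. v i div m) [^] m"
    using lincomb_closed pow_closed by (simp add: y inv_mult_cancel)
  moreover have "y \<in> F" using assms by (auto simp: F_def y_def)
  ultimately show "\<exists>y\<in>F. inv y \<otimes> x \<in> pows m" using lincomb_closed by (auto simp: pows_def)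
qed

text \<open>Nakayama's argument: the determinant of a matrix congruent to \<open>1\<close> modulo \<open>p\<close> is prime to \<open>p\<close>.\<close>

lemma pow_mem_of_supplement:
  assumes B: "subgroup B G" and p: "A \<subseteq> B <#> pows p"
  shows "\<exists>l. [l = 1] (mod p) \<and> pows l \<subseteq> B"
proof -
  have "\<exists>v. lincomb a r (\<lambda>j. (if j = i then 1 else 0) + p * v j) \<in> B" if i: "i < r" for i
  proof -
    obtain b x where b: "b \<in> B" "x \<in> A" "a i = b \<otimes> x [^] p"
      using p a_closed[OF i] unfolding set_mult_def pows_def by blast
    obtain v where v: "inv x = lincomb a r v" using lincomb_surj b(2) by blast
    have "lincomb a r (\<lambda>j. (if j = i then 1 else 0) + p * v j) = a i \<otimes> inv x [^] p"
      using i a_closed[OF i] by (simp add: lincomb_add lincomb_scale lincomb_unit v)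
    also have "\<dots> = b" using b subgroup.mem_carrier[OF B] by (simp add: m_assoc int_pow_inv)
    finally show ?thesis using b by auto
  qed
  then have "\<forall>i. \<exists>v. i < r \<longrightarrow> lincomb a r (\<lambda>j. (if j = i then 1 else 0) + p * v j) \<in> B"
    by blast
  from choice[OF this] obtain v
    where v: "\<And>i. i < r \<Longrightarrow> lincomb a r (\<lambda>j. (if j = i then 1 else 0) + p * v i j) \<in> B"
    by blast
  define l where "l = det (mat r r (\<lambda>(i,j). (if j = i then 1 else 0) + p * v i j))"
  have "[l = det (mat r r (\<lambda>(i,j). if j = i then 1 else 0))] (mod p)"
    unfolding l_def by (rule det_cong_mod) (simp add: cong_def)
  also have "mat r r (\<lambda>(i,j). if j = i then 1 else 0) = (1\<^sub>m r :: int mat)"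
    by (auto intro!: eq_matI)
  finally have "[l = 1] (mod p)" by simp
  moreover have "pows l \<subseteq> B"
    unfolding l_def by (intro pows_subset_of_gens[OF B] pow_det_mem[OF B v])
  ultimately show ?thesis by blast
qed

end

section \<open>Relators as affine maps\<close>

locale lifting_problem = fg_abelian_normal +
  fixes g :: "nat \<Rightarrow> 'a" and k :: nat
  assumes g_closed: "i < k \<Longrightarrow> g i \<in> carrier G"
    and g_gens: "generate G (g ` {..<k} \<union> A) = carrier G"
begin

definition tuples :: "(nat \<Rightarrow> 'a) set"
  where "tuples = {b. \<forall>i. b i \<in> A}"

abbreviation base :: "nat \<Rightarrow> 'a"
  where "base \<equiv> (\<lambda>i. \<one>)"

text \<open>
  A word \<open>w\<close> in \<open>k\<close> letters is represented by the function sending \<open>b \<in> A\<^sup>k\<close> to the value of \<open>w\<close> at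
  \<open>g\<^sub>1 b\<^sub>1, \<dots>, g\<^sub>k b\<^sub>k\<close>. Tuples are total functions, of which only the first \<open>k\<close> entries matter.
  The map \<open>delta\<close> is the Fox derivative.
\<close>

inductive_set words :: "((nat \<Rightarrow> 'a) \<Rightarrow> 'a) set"
  where one: "(\<lambda>b. \<one>) \<in> words"
  | gen: "i < k \<Longrightarrow> (\<lambda>b. g i \<otimes> b i) \<in> words"
  | inv: "\<tau> \<in> words \<Longrightarrow> (\<lambda>b. inv (\<tau> b)) \<in> words"
  | mult: "\<tau> \<in> words \<Longrightarrow> \<sigma> \<in> words \<Longrightarrow> (\<lambda>b. \<tau> b \<otimes> \<sigma> b) \<in> words"

definition delta :: "((nat \<Rightarrow> 'a) \<Rightarrow> 'a) \<Rightarrow> (nat \<Rightarrow> 'a) \<Rightarrow> 'a"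
  where "delta \<tau> b = inv (\<tau> base) \<otimes> \<tau> b"

text \<open>These are the words that vanish in \<open>G/A\<close>. Testing at \<open>base\<close> is
  enough, since by \<open>relators_iff\<close> other tuples change the value only by elements of
  \<open>A\<close>.\<close>

definition relators :: "((nat \<Rightarrow> 'a) \<Rightarrow> 'a) set"
  where "relators = {\<tau> \<in> words. \<tau> base \<in> A}"

text \<open>The endomorphisms of \<open>A\<close> as a module over \<open>G\<close> acting by
  conjugation.\<close>

definition equivariant :: "('a \<Rightarrow> 'a) \<Rightarrow> bool"
  where "equivariant \<psi> \<longleftrightarrow> (\<forall>x\<in>A. \<psi> x \<in> A) \<and> (\<forall>x\<in>A. \<forall>y\<in>A. \<psi> (x \<otimes> y) = \<psi> x \<otimes> \<psi> y) \<and>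
    (\<forall>x\<in>A. \<forall>y\<in>carrier G. \<psi> (y \<otimes> x \<otimes> inv y) = y \<otimes> \<psi> x \<otimes> inv y)"

lemma tuplesI: "(\<And>i. b i \<in> A) \<Longrightarrow> b \<in> tuples"
  by (simp add: tuples_def)

lemma base_tuples [simp]: "base \<in> tuples"
  by (simp add: tuples_def)

lemma mult_tuples [simp]: "b \<in> tuples \<Longrightarrow> c \<in> tuples \<Longrightarrow> (\<lambda>i. b i \<otimes> c i) \<in> tuples"
  by (simp add: tuples_def)

lemma pow_tuples [simp]: "b \<in> tuples \<Longrightarrow> (\<lambda>i. b i [^] (n::int)) \<in> tuples"
  by (simp add: tuples_def pow_closed)

lemma tuplesD [simp]: "b \<in> tuples \<Longrightarrow> b i \<in> A"
  by (simp add: tuples_def)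

lemma words_closed [simp]: "\<tau> \<in> words \<Longrightarrow> b \<in> tuples \<Longrightarrow> \<tau> b \<in> carrier G"
  by (induction rule: words.induct) (auto simp: g_closed)

lemma A_swap:
  assumes "p \<in> A" "q \<in> A" "u \<in> A" "v \<in> A"
  shows "(p \<otimes> q) \<otimes> (u \<otimes> v) = (p \<otimes> u) \<otimes> (q \<otimes> v)"
proof -
  have "(p \<otimes> q) \<otimes> (u \<otimes> v) = p \<otimes> (q \<otimes> u) \<otimes> v" using assms by (simp add: m_assoc)
  also have "q \<otimes> u = u \<otimes> q" using assms by (simp add: comm)
  finally show ?thesis using assms by (simp add: m_assoc)
qed

lemma equivariant_one: "equivariant \<psi> \<Longrightarrow> \<psi> \<one> = \<one>"
proof -
  assume \<psi>: "equivariant \<psi>"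
  then have c: "\<psi> \<one> \<in> A" and "\<psi> (\<one> \<otimes> \<one>) = \<psi> \<one> \<otimes> \<psi> \<one>"
    unfolding equivariant_def using A.one_closed by blast+
  then have "\<psi> \<one> \<otimes> \<psi> \<one> = \<psi> \<one>" by simp
  then show ?thesis using c by (simp add: l_cancel_one)
qed

lemma equivariant_inv:
  assumes "equivariant \<psi>" "x \<in> A" shows "\<psi> (inv x) = inv (\<psi> x)"
proof -
  have c: "\<psi> (inv x) \<in> A" "\<psi> x \<in> A" and e: "\<psi> (inv x \<otimes> x) = \<psi> (inv x) \<otimes> \<psi> x"
    using assms unfolding equivariant_def by (meson A.m_inv_closed)+
  have "\<psi> (inv x) \<otimes> \<psi> x = \<one>" using e assms equivariant_one[OF assms(1)] by simp
  then show ?thesis using c by (metis A.mem_carrier inv_equality)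
qed

lemma equivariant_pow: "equivariant (\<lambda>x. x [^] (n::int))"
  unfolding equivariant_def using conj_pow by (auto simp: pow_closed pow_mult)

lemma conj_inv_closed: "y \<in> carrier G \<Longrightarrow> x \<in> A \<Longrightarrow> inv y \<otimes> x \<otimes> y \<in> A"
  by (rule A.inv_op_closed1)

text \<open>Induction along the derivation rules: inverting or multiplying words conjugates their
  derivatives by base values, and \<open>A\<close> is normal.\<close>

lemma delta_closed [simp]: "\<tau> \<in> words \<Longrightarrow> b \<in> tuples \<Longrightarrow> delta \<tau> b \<in> A"
proof (induction rule: words.induct)
  case (gen i)
  then show ?case by (simp add: delta_def g_closed inv_mult_cancel)
next
  case (inv \<tau>)
  have "\<tau> base \<otimes> inv (delta \<tau> b) \<otimes> inv (\<tau> base) \<in> A" using inv by (intro conj_closed) auto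
  also have "\<tau> base \<otimes> inv (delta \<tau> b) \<otimes> inv (\<tau> base) = delta (\<lambda>b. inv (\<tau> b)) b"
    using inv by (simp add: delta_def free_simps)
  finally show ?case .
next
  case (mult \<tau> \<sigma>)
  have "inv (\<sigma> base) \<otimes> delta \<tau> b \<otimes> \<sigma> base \<otimes> delta \<sigma> b \<in> A"
    using mult by (intro A.m_closed conj_inv_closed) auto
  also have "inv (\<sigma> base) \<otimes> delta \<tau> b \<otimes> \<sigma> base \<otimes> delta \<sigma> b = delta (\<lambda>b. \<tau> b \<otimes> \<sigma> b) b"
    using mult by (simp add: delta_def free_simps)
  finally show ?case .
qed (simp add: delta_def)

lemma word_delta: "\<tau> \<in> words \<Longrightarrow> b \<in> tuples \<Longrightarrow> \<tau> b = \<tau> base \<otimes> delta \<tau> b"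
  by (simp add: delta_def inv_mult_cancel)

lemma delta_gen: "i < k \<Longrightarrow> b \<in> tuples \<Longrightarrow> delta (\<lambda>b. g i \<otimes> b i) b = b i"
  by (simp add: delta_def g_closed inv_mult_cancel)

lemma delta_inv:
  "\<tau> \<in> words \<Longrightarrow> b \<in> tuples \<Longrightarrow>
    delta (\<lambda>b. inv (\<tau> b)) b = \<tau> base \<otimes> inv (delta \<tau> b) \<otimes> inv (\<tau> base)"
  by (simp add: delta_def free_simps)

lemma delta_mult:
  "\<tau> \<in> words \<Longrightarrow> \<sigma> \<in> words \<Longrightarrow> b \<in> tuples \<Longrightarrow>
    delta (\<lambda>b. \<tau> b \<otimes> \<sigma> b) b = (inv (\<sigma> base) \<otimes> delta \<tau> b \<otimes> inv (inv (\<sigma> base))) \<otimes> delta \<sigma> b"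
  by (simp add: delta_def free_simps)

text \<open>\<open>delta \<tau> b\<close> is a product of conjugates of the entries of
  \<open>b\<close> and their inverses, so it commutes with every module endomorphism. Besides
  powers, this is applied to the map \<open>\<psi>\<close> in
  \<open>one_direction_impossible\<close>.\<close>

lemma delta_equivariant:
  assumes \<psi>: "equivariant \<psi>" and "\<tau> \<in> words" "b \<in> tuples"
  shows "delta \<tau> (\<lambda>i. \<psi> (b i)) = \<psi> (delta \<tau> b)"
proof -
  have t: "(\<lambda>i. \<psi> (b i)) \<in> tuples" using \<psi> assms(3) unfolding tuples_def equivariant_def by blast
  have cl: "\<And>x. x \<in> A \<Longrightarrow> \<psi> x \<in> A"
    and mu: "\<And>x y. x \<in> A \<Longrightarrow> y \<in> A \<Longrightarrow> \<psi> (x \<otimes> y) = \<psi> x \<otimes> \<psi> y"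
    and co: "\<And>x y. x \<in> A \<Longrightarrow> y \<in> carrier G \<Longrightarrow> \<psi> (y \<otimes> x \<otimes> inv y) = y \<otimes> \<psi> x \<otimes> inv y"
    using \<psi> unfolding equivariant_def by blast+
  from assms(2) show ?thesis
  proof (induction rule: words.induct)
    case one
    then show ?case using equivariant_one[OF \<psi>] by (simp add: delta_def)
  next
    case (gen i)
    then show ?case using t assms(3) by (simp add: delta_gen)
  next
    case (inv \<tau>)
    then show ?case using t assms(3) by (simp add: delta_inv co equivariant_inv[OF \<psi>])
  next
    case (mult \<tau> \<sigma>)
    then have "\<psi> (inv (\<sigma> base) \<otimes> delta \<tau> b \<otimes> \<sigma> base) = inv (\<sigma> base) \<otimes> \<psi> (delta \<tau> b) \<otimes> \<sigma> base"
      using co[of "delta \<tau> b" "inv (\<sigma> base)"] assms(3) by simp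
    then show ?case
      using mult t assms(3) conj_inv_closed[of "\<sigma> base" "delta \<tau> b"] by (simp add: delta_mult mu)
  qed
qed

lemma delta_pow:
  "\<tau> \<in> words \<Longrightarrow> b \<in> tuples \<Longrightarrow> delta \<tau> (\<lambda>i. b i [^] (n::int)) = delta \<tau> b [^] n"
  using delta_equivariant[OF equivariant_pow] .

lemma delta_add:
  assumes "\<tau> \<in> words" and b: "b \<in> tuples" and c: "c \<in> tuples"
  shows "delta \<tau> (\<lambda>i. b i \<otimes> c i) = delta \<tau> b \<otimes> delta \<tau> c"
  using assms(1)
proof (induction rule: words.induct)
  case one
  then show ?case by (simp add: delta_def)
next
  case (gen i)
  then show ?case using b c by (simp add: delta_gen)
next
  case (inv \<tau>)
  define p q x where pq: "p = delta \<tau> b" "q = delta \<tau> c" "x = \<tau> base"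
  have A: "p \<in> A" "q \<in> A" "x \<in> carrier G" using inv b c by (auto simp: pq)
  have "inv (p \<otimes> q) = inv p \<otimes> inv q" using A comm[of p q] by (simp add: inv_mult_group)
  then show ?case using inv b c A by (simp add: delta_inv free_simps flip: pq)
next
  case (mult \<tau> \<sigma>)
  define p q u v x where pq: "p = delta \<tau> b" "q = delta \<tau> c" "u = delta \<sigma> b" "v = delta \<sigma> c"
    "x = \<sigma> base"
  have A: "p \<in> A" "q \<in> A" "u \<in> A" "v \<in> A" "x \<in> carrier G" using mult b c by (auto simp: pq)
  have "delta (\<lambda>b. \<tau> b \<otimes> \<sigma> b) (\<lambda>i. b i \<otimes> c i) = (inv x \<otimes> (p \<otimes> q) \<otimes> x) \<otimes> (u \<otimes> v)"
    using mult b c by (simp add: delta_mult pq)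
  also have "inv x \<otimes> (p \<otimes> q) \<otimes> x = (inv x \<otimes> p \<otimes> x) \<otimes> (inv x \<otimes> q \<otimes> x)"
    using A by (simp add: free_simps)
  also have "(inv x \<otimes> p \<otimes> x) \<otimes> (inv x \<otimes> q \<otimes> x) \<otimes> (u \<otimes> v) =
      ((inv x \<otimes> p \<otimes> x) \<otimes> u) \<otimes> ((inv x \<otimes> q \<otimes> x) \<otimes> v)"
    using A conj_inv_closed by (intro A_swap) auto
  finally show ?case using mult b c by (simp add: delta_mult pq)
qed

lemma words_pow: "\<tau> \<in> words \<Longrightarrow> (\<lambda>b. \<tau> b [^] (n::int)) \<in> words"
proof -
  assume \<tau>: "\<tau> \<in> words"
  have nat: "(\<lambda>b. \<tau> b [^] (n::nat)) \<in> words" for n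
    using \<tau> by (induction n) (auto intro: words.intros)
  show ?thesis
  proof (cases "n < 0")
    case True
    then have "(\<lambda>b. \<tau> b [^] n) = (\<lambda>b. inv (\<tau> b [^] nat (-n)))"
      unfolding int_pow_def2 by simp
    then show ?thesis using words.inv[OF nat[of "nat (-n)"]] by (simp only:)
  next
    case False
    then have "(\<lambda>b. \<tau> b [^] n) = (\<lambda>b. \<tau> b [^] nat n)" unfolding int_pow_def2 by simp
    then show ?thesis using nat[of "nat n"] by (simp only:)
  qed
qed

lemma generate_eq_words:
  assumes b: "b \<in> tuples"
  shows "generate G ((\<lambda>i. g i \<otimes> b i) ` {..<k}) = (\<lambda>\<tau>. \<tau> b) ` words"
proof
  show "generate G ((\<lambda>i. g i \<otimes> b i) ` {..<k}) \<subseteq> (\<lambda>\<tau>. \<tau> b) ` words"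
  proof
    fix x assume "x \<in> generate G ((\<lambda>i. g i \<otimes> b i) ` {..<k})"
    then show "x \<in> (\<lambda>\<tau>. \<tau> b) ` words"
    proof (induction x rule: generate.induct)
      case one
      show ?case using words.one by (rule rev_image_eqI) simp
    next
      case (incl h)
      then obtain i where "i < k" "h = g i \<otimes> b i" by auto
      then show ?case by (intro rev_image_eqI[OF words.gen]) auto
    next
      case (inv h)
      then obtain i where "i < k" "h = g i \<otimes> b i" by auto
      then show ?case by (intro rev_image_eqI[OF words.inv[OF words.gen]]) auto
    next
      case (eng x y)
      then obtain \<tau> \<sigma> where "\<tau> \<in> words" "\<sigma> \<in> words" "x = \<tau> b" "y = \<sigma> b" by auto
      then show ?case by (intro rev_image_eqI[OF words.mult]) auto
    qed
  qed
  have sub: "(\<lambda>i. g i \<otimes> b i) ` {..<k} \<subseteq> carrier G" using b g_closed by auto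
  have "\<tau> b \<in> generate G ((\<lambda>i. g i \<otimes> b i) ` {..<k})" if "\<tau> \<in> words" for \<tau>
    using that
    by (induction rule: words.induct)
      (auto intro: generate.intros generate_m_inv_closed[OF sub])
  then show "(\<lambda>\<tau>. \<tau> b) ` words \<subseteq> generate G ((\<lambda>i. g i \<otimes> b i) ` {..<k})" by auto
qed

text \<open>For \<open>base\<close> this is \<open>g_gens\<close>; passing to \<open>b\<close>
  changes the word value only by a factor in \<open>A\<close>, which \<open>x\<close>
  absorbs.\<close>

lemma word_mod_A:
  assumes y: "y \<in> carrier G" and b: "b \<in> tuples"
  shows "\<exists>\<sigma>\<in>words. \<exists>x\<in>A. y = \<sigma> b \<otimes> x"
proof -
  have "(\<lambda>i. g i \<otimes> \<one>) ` {..<k} = g ` {..<k}" by (intro image_cong) (auto simp: g_closed)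
  then have "carrier G = generate G ((\<lambda>i. g i \<otimes> base i) ` {..<k}) <#> A"
    using g_gens generate_Un_normal[OF _ normal, of "g ` {..<k}"] g_closed by auto
  then obtain \<sigma> x where \<sigma>: "\<sigma> \<in> words" "x \<in> A" "y = \<sigma> base \<otimes> x"
    using y unfolding generate_eq_words[OF base_tuples] set_mult_def by auto
  have "y = \<sigma> b \<otimes> (inv (delta \<sigma> b) \<otimes> x)"
    unfolding \<sigma>(3) word_delta[OF \<sigma>(1) b] using \<sigma>(1,2) b by (simp add: m_assoc inv_mult_cancel)
  moreover have "inv (delta \<sigma> b) \<otimes> x \<in> A" using \<sigma>(1,2) b by simp
  ultimately show ?thesis using \<sigma>(1) by blast
qed

lemma relators_words: "\<tau> \<in> relators \<Longrightarrow> \<tau> \<in> words"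
  by (simp add: relators_def)

lemma relatorsI: "\<tau> \<in> words \<Longrightarrow> \<tau> base \<in> A \<Longrightarrow> \<tau> \<in> relators"
  by (simp add: relators_def)

lemma relators_iff: "\<tau> \<in> words \<Longrightarrow> b \<in> tuples \<Longrightarrow> \<tau> b \<in> A \<longleftrightarrow> \<tau> \<in> relators"
proof -
  assume *: "\<tau> \<in> words" "b \<in> tuples"
  have "\<tau> base = \<tau> b \<otimes> inv (delta \<tau> b)" using * by (simp add: delta_def free_simps)
  then have "\<tau> base \<in> A" if "\<tau> b \<in> A" using that * by simp
  moreover have "\<tau> b \<in> A" if "\<tau> base \<in> A" using that * word_delta[OF *] by simp
  ultimately show ?thesis using * by (auto simp: relators_def)
qed

lemma relators_closed [simp]: "\<tau> \<in> relators \<Longrightarrow> b \<in> tuples \<Longrightarrow> \<tau> b \<in> A"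
  using relators_iff relators_words by blast

lemma relator_values:
  assumes "b \<in> tuples"
  shows "generate G ((\<lambda>i. g i \<otimes> b i) ` {..<k}) \<inter> A = (\<lambda>\<tau>. \<tau> b) ` relators"
  unfolding generate_eq_words[OF assms] using relators_iff[OF _ assms] relators_words by auto

lemma supplement_relator_values:
  assumes "b \<in> tuples" "U \<lhd> G" "U \<subseteq> A"
    and "generate G ((\<lambda>i. g i \<otimes> b i) ` {..<k} \<union> U) = carrier G"
  shows "A \<subseteq> (\<lambda>\<tau>. \<tau> b) ` relators <#> U"
proof
  fix x assume x: "x \<in> A"
  have sub: "(\<lambda>i. g i \<otimes> b i) ` {..<k} \<subseteq> carrier G" using assms(1) g_closed by auto
  have "x \<in> generate G ((\<lambda>i. g i \<otimes> b i) ` {..<k}) <#> U"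
    using x assms(4) generate_Un_normal[OF sub assms(2)] A.mem_carrier by simp
  then obtain h u where hu: "h \<in> generate G ((\<lambda>i. g i \<otimes> b i) ` {..<k})" "u \<in> U" "x = h \<otimes> u"
    by (auto simp: set_mult_def)
  have "h \<in> carrier G" using generate_in_carrier[OF sub hu(1)] .
  then have "h = x \<otimes> inv u" using hu assms(3) A.mem_carrier[of u] by (auto simp: free_simps)
  moreover have "x \<otimes> inv u \<in> A" using x hu assms(3) by blast
  ultimately have "h \<in> A" by simp
  then show "x \<in> (\<lambda>\<tau>. \<tau> b) ` relators <#> U"
    using hu relator_values[OF assms(1)] unfolding set_mult_def by blast
qed

lemma generate_eq_carrier:
  assumes b: "b \<in> tuples" and "A \<subseteq> (\<lambda>\<tau>. \<tau> b) ` relators"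
  shows "generate G ((\<lambda>i. g i \<otimes> b i) ` {..<k}) = carrier G"
proof
  let ?H = "generate G ((\<lambda>i. g i \<otimes> b i) ` {..<k})"
  show "?H \<subseteq> carrier G" using b words_closed by (auto simp: generate_eq_words)
  have AH: "A \<subseteq> ?H" using assms(2) relator_values[OF b] by blast
  show "carrier G \<subseteq> ?H"
  proof
    fix y assume "y \<in> carrier G"
    then obtain \<sigma> x where "\<sigma> \<in> words" "x \<in> A" "y = \<sigma> b \<otimes> x" using word_mod_A[OF _ b] by blast
    moreover have "\<sigma> b \<in> ?H" using generate_eq_words[OF b] \<open>\<sigma> \<in> words\<close> by simp
    ultimately show "y \<in> ?H" using AH by (auto intro: generate.eng)
  qed
qed

text \<open>Under these conditions evaluation at a tuple, and likewise \<open>delta\<close> at a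
  tuple, maps \<open>S\<close> onto a normal subgroup of \<open>G\<close>, to which irreducibility
  can be applied. Conjugation is asked for only up to agreement on \<open>tuples\<close>, because
  the conjugating element \<open>y\<close> is fixed while word values vary.\<close>

definition stable :: "((nat \<Rightarrow> 'a) \<Rightarrow> 'a) set \<Rightarrow> bool"
  where "stable S \<longleftrightarrow> S \<subseteq> relators \<and> (\<lambda>b. \<one>) \<in> S \<and> (\<forall>\<tau>\<in>S. (\<lambda>b. inv (\<tau> b)) \<in> S) \<and>
    (\<forall>\<tau>\<in>S. \<forall>\<sigma>\<in>S. (\<lambda>b. \<tau> b \<otimes> \<sigma> b) \<in> S) \<and>
    (\<forall>\<tau>\<in>S. \<forall>y\<in>carrier G. \<exists>\<tau>'\<in>S. \<forall>b\<in>tuples. \<tau>' b = y \<otimes> \<tau> b \<otimes> inv y)"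

lemma stable_relators: "stable relators"
proof -
  have "\<exists>\<tau>'\<in>relators. \<forall>b\<in>tuples. \<tau>' b = y \<otimes> \<tau> b \<otimes> inv y"
    if \<tau>: "\<tau> \<in> relators" and y: "y \<in> carrier G" for \<tau> y
  proof -
    \<comment> \<open>A word can only conjugate by its varying value \<open>\<sigma> b\<close>. This
      differs from the fixed \<open>y\<close> by an element of \<open>A\<close>, which centralises
      the values of relators.\<close>
    obtain \<sigma> x where \<sigma>: "\<sigma> \<in> words" "x \<in> A" "y = \<sigma> base \<otimes> x" using word_mod_A[OF y base_tuples] by blast
    define \<tau>' where "\<tau>' = (\<lambda>b. \<sigma> b \<otimes> \<tau> b \<otimes> inv (\<sigma> b))"
    have \<tau>': "\<tau>' \<in> words"
      unfolding \<tau>'_def by (intro words.intros \<sigma> relators_words[OF \<tau>])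
    have eq: "\<tau>' b = y \<otimes> \<tau> b \<otimes> inv y" if b: "b \<in> tuples" for b
    proof -
      have swap: "z \<otimes> \<tau> b \<otimes> inv z = \<tau> b" if "z \<in> A" for z
        using that comm[of z "\<tau> b"] relators_closed[OF \<tau> b] by (simp add: m_assoc)
      have "\<tau>' b = \<sigma> base \<otimes> (delta \<sigma> b \<otimes> \<tau> b \<otimes> inv (delta \<sigma> b)) \<otimes> inv (\<sigma> base)"
        unfolding \<tau>'_def using \<sigma> b relators_words[OF \<tau>]
        by (subst (1 2) word_delta[OF \<sigma>(1) b]) (simp add: free_simps)
      also have "\<dots> = \<sigma> base \<otimes> (x \<otimes> \<tau> b \<otimes> inv x) \<otimes> inv (\<sigma> base)"
        using \<sigma> b by (simp add: swap)
      also have "\<dots> = y \<otimes> \<tau> b \<otimes> inv y"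
        using \<sigma> b relators_words[OF \<tau>] by (simp add: free_simps)
      finally show ?thesis .
    qed
    have "\<tau>' base \<in> A" unfolding eq[OF base_tuples]
      by (rule conj_closed[OF y relators_closed[OF \<tau> base_tuples]])
    then have "\<tau>' \<in> relators" using \<tau>' by (rule relatorsI[rotated])
    then show ?thesis using eq by blast
  qed
  moreover have "(\<lambda>b. \<one>) \<in> relators"
    by (rule relatorsI[OF words.one]) simp
  moreover have "(\<lambda>b. inv (\<tau> b)) \<in> relators" if "\<tau> \<in> relators" for \<tau>
    by (rule relatorsI[OF words.inv[OF relators_words[OF that]]]) (use that in simp)
  moreover have "(\<lambda>b. \<tau> b \<otimes> \<sigma> b) \<in> relators" if "\<tau> \<in> relators" "\<sigma> \<in> relators" for \<tau> \<sigma>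
    by (rule relatorsI[OF words.mult[OF that[THEN relators_words]]]) (use that in simp)
  ultimately show ?thesis unfolding stable_def by blast
qed

lemma stableD:
  assumes "stable S"
  shows "\<tau> \<in> S \<Longrightarrow> \<tau> \<in> relators" "(\<lambda>b. \<one>) \<in> S" "\<tau> \<in> S \<Longrightarrow> (\<lambda>b. inv (\<tau> b)) \<in> S"
    "\<tau> \<in> S \<Longrightarrow> \<sigma> \<in> S \<Longrightarrow> (\<lambda>b. \<tau> b \<otimes> \<sigma> b) \<in> S"
    "\<tau> \<in> S \<Longrightarrow> y \<in> carrier G \<Longrightarrow> \<exists>\<tau>'\<in>S. \<forall>b\<in>tuples. \<tau>' b = y \<otimes> \<tau> b \<otimes> inv y"
  using assms unfolding stable_def by blast+

lemma relator_delta_inv: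
  "\<tau> \<in> relators \<Longrightarrow> b \<in> tuples \<Longrightarrow> delta (\<lambda>b. inv (\<tau> b)) b = inv (delta \<tau> b)"
  using comm[of "\<tau> base" "inv (delta \<tau> b)"] by (simp add: delta_inv relators_words m_assoc)

lemma relator_delta_mult:
  "\<tau> \<in> relators \<Longrightarrow> \<sigma> \<in> relators \<Longrightarrow> b \<in> tuples \<Longrightarrow>
    delta (\<lambda>b. \<tau> b \<otimes> \<sigma> b) b = delta \<tau> b \<otimes> delta \<sigma> b"
  using comm[of "delta \<tau> b" "\<sigma> base"] by (simp add: delta_mult relators_words m_assoc inv_mult_cancel)

lemma delta_conj:
  assumes "\<tau> \<in> relators" "b \<in> tuples" "y \<in> carrier G"
    and "\<And>b. b \<in> tuples \<Longrightarrow> \<tau>' b = y \<otimes> \<tau> b \<otimes> inv y"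
  shows "delta \<tau>' b = y \<otimes> delta \<tau> b \<otimes> inv y"
  using assms relators_words by (simp add: delta_def free_simps)

lemma relator_delta_pow:
  assumes "\<tau> \<in> relators" "b \<in> tuples"
  shows "(\<lambda>b. \<tau> b [^] (n::int)) \<in> relators" "delta (\<lambda>b. \<tau> b [^] n) b = delta \<tau> b [^] n"
proof -
  have \<tau>: "\<tau> \<in> words" "\<tau> base \<in> A" "\<tau> b \<in> A"
    using assms relators_words by auto
  show "(\<lambda>b. \<tau> b [^] n) \<in> relators"
    by (rule relatorsI[OF words_pow[OF \<tau>(1)] pow_closed[OF \<tau>(2)]])
  have "inv (\<tau> base [^] n) = inv (\<tau> base) [^] n" using \<tau>(2) by (simp add: int_pow_inv)
  then show "delta (\<lambda>b. \<tau> b [^] n) b = delta \<tau> b [^] n"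
    unfolding delta_def using pow_mult[OF A.m_inv_closed[OF \<tau>(2)] \<tau>(3)] by simp
qed

lemma normal_eval_image:
  assumes S: "stable S" and b: "b \<in> tuples"
  shows "(\<lambda>\<tau>. \<tau> b) ` S \<lhd> G"
proof -
  have "subgroup ((\<lambda>\<tau>. \<tau> b) ` S) G"
  proof (rule subgroupI)
    show "(\<lambda>\<tau>. \<tau> b) ` S \<subseteq> carrier G"
      using relators_closed[OF stableD(1)[OF S] b] A.subset by auto
    show "(\<lambda>\<tau>. \<tau> b) ` S \<noteq> {}" using stableD(2)[OF S] by blast
    show "inv x \<in> (\<lambda>\<tau>. \<tau> b) ` S" if x: "x \<in> (\<lambda>\<tau>. \<tau> b) ` S" for x
    proof -
      obtain \<tau> where \<tau>: "\<tau> \<in> S" "x = \<tau> b" using x by auto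
      show ?thesis by (rule rev_image_eqI[OF stableD(3)[OF S \<tau>(1)]]) (simp add: \<tau>)
    qed
    show "x \<otimes> y \<in> (\<lambda>\<tau>. \<tau> b) ` S"
      if x: "x \<in> (\<lambda>\<tau>. \<tau> b) ` S" and y: "y \<in> (\<lambda>\<tau>. \<tau> b) ` S" for x y
    proof -
      obtain \<tau> \<sigma> where \<tau>: "\<tau> \<in> S" "x = \<tau> b" "\<sigma> \<in> S" "y = \<sigma> b" using x y by auto
      show ?thesis by (rule rev_image_eqI[OF stableD(4)[OF S \<tau>(1,3)]]) (simp add: \<tau>)
    qed
  qed
  moreover have "y \<otimes> x \<otimes> inv y \<in> (\<lambda>\<tau>. \<tau> b) ` S" if "y \<in> carrier G" "x \<in> (\<lambda>\<tau>. \<tau> b) ` S" for x y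
  proof -
    obtain \<tau> where \<tau>: "\<tau> \<in> S" "x = \<tau> b" using \<open>x \<in> _\<close> by auto
    obtain \<tau>' where "\<tau>' \<in> S" "\<tau>' b = y \<otimes> \<tau> b \<otimes> inv y"
      using stableD(5)[OF S \<tau>(1) \<open>y \<in> _\<close>] b by blast
    then show ?thesis using \<tau> by (metis image_eqI)
  qed
  ultimately show ?thesis by (auto simp: normal_inv_iff)
qed

lemma normal_delta_image:
  assumes S: "stable S" and b: "b \<in> tuples"
  shows "(\<lambda>\<tau>. delta \<tau> b) ` S \<lhd> G"
proof -
  have "subgroup ((\<lambda>\<tau>. delta \<tau> b) ` S) G"
  proof (rule subgroupI)
    show "(\<lambda>\<tau>. delta \<tau> b) ` S \<subseteq> carrier G"
      using delta_closed[OF relators_words[OF stableD(1)[OF S]] b] A.subset by auto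
    show "(\<lambda>\<tau>. delta \<tau> b) ` S \<noteq> {}" using stableD(2)[OF S] by blast
    show "inv x \<in> (\<lambda>\<tau>. delta \<tau> b) ` S" if x: "x \<in> (\<lambda>\<tau>. delta \<tau> b) ` S" for x
    proof -
      obtain \<tau> where \<tau>: "\<tau> \<in> S" "x = delta \<tau> b" using x by auto
      show ?thesis
        by (rule rev_image_eqI[OF stableD(3)[OF S \<tau>(1)]])
          (use \<tau> b stableD(1)[OF S] in \<open>simp add: relator_delta_inv\<close>)
    qed
    show "x \<otimes> y \<in> (\<lambda>\<tau>. delta \<tau> b) ` S"
      if x: "x \<in> (\<lambda>\<tau>. delta \<tau> b) ` S" and y: "y \<in> (\<lambda>\<tau>. delta \<tau> b) ` S" for x y
    proof -
      obtain \<tau> \<sigma> where \<tau>: "\<tau> \<in> S" "x = delta \<tau> b" "\<sigma> \<in> S" "y = delta \<sigma> b" using x y by auto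
      show ?thesis
        by (rule rev_image_eqI[OF stableD(4)[OF S \<tau>(1,3)]])
          (use \<tau> b stableD(1)[OF S] in \<open>simp add: relator_delta_mult\<close>)
    qed
  qed
  moreover have "y \<otimes> x \<otimes> inv y \<in> (\<lambda>\<tau>. delta \<tau> b) ` S"
    if y: "y \<in> carrier G" and x: "x \<in> (\<lambda>\<tau>. delta \<tau> b) ` S" for x y
  proof -
    obtain \<tau> where \<tau>: "\<tau> \<in> S" "x = delta \<tau> b" using x by auto
    obtain \<tau>' where \<tau>': "\<tau>' \<in> S" "\<And>b. b \<in> tuples \<Longrightarrow> \<tau>' b = y \<otimes> \<tau> b \<otimes> inv y"
      using stableD(5)[OF S \<tau>(1) y] by blast
    have "delta \<tau>' b = y \<otimes> x \<otimes> inv y"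
      unfolding \<tau>(2) by (rule delta_conj[OF stableD(1)[OF S \<tau>(1)] b y \<tau>'(2)])
    then show ?thesis using \<tau>'(1) by (metis image_eqI)
  qed
  ultimately show ?thesis by (auto simp: normal_inv_iff)
qed

lemma stable_eval_vimage:
  assumes S: "stable S" and b: "b \<in> tuples" and N: "N \<lhd> G"
  shows "stable {\<tau> \<in> S. \<tau> b \<in> N}"
proof -
  interpret N: normal N G by fact
  have "\<exists>\<tau>'\<in>{\<tau> \<in> S. \<tau> b \<in> N}. \<forall>b\<in>tuples. \<tau>' b = y \<otimes> \<tau> b \<otimes> inv y"
    if "\<tau> \<in> {\<tau> \<in> S. \<tau> b \<in> N}" "y \<in> carrier G" for \<tau> y
    using stableD(5)[OF S, of \<tau> y] that b N.inv_op_closed2[of y "\<tau> b"] by force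
  then show ?thesis
    unfolding stable_def using stableD[OF S] by auto
qed

lemma stable_delta_vimage:
  assumes S: "stable S" and C: "C \<subseteq> tuples" and N: "N \<lhd> G"
  shows "stable {\<tau> \<in> S. \<forall>b\<in>C. delta \<tau> b \<in> N}"
proof -
  interpret N: normal N G by fact
  have "\<exists>\<tau>'\<in>{\<tau> \<in> S. \<forall>b\<in>C. delta \<tau> b \<in> N}. \<forall>b\<in>tuples. \<tau>' b = y \<otimes> \<tau> b \<otimes> inv y"
    if \<tau>: "\<tau> \<in> {\<tau> \<in> S. \<forall>b\<in>C. delta \<tau> b \<in> N}" and y: "y \<in> carrier G" for \<tau> y
  proof -
    obtain \<tau>' where \<tau>': "\<tau>' \<in> S" "\<And>b. b \<in> tuples \<Longrightarrow> \<tau>' b = y \<otimes> \<tau> b \<otimes> inv y"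
      using stableD(5)[OF S _ y, of \<tau>] \<tau> by blast
    have "delta \<tau>' b = y \<otimes> delta \<tau> b \<otimes> inv y" if "b \<in> C" for b
      by (rule delta_conj[OF stableD(1)[OF S] subsetD[OF C] y \<tau>'(2)]) (use \<tau> that in auto)
    then show ?thesis using \<tau>' \<tau> y N.inv_op_closed2 by auto
  qed
  moreover have "delta (\<lambda>b. \<one>) b = \<one>" for b by (simp add: delta_def)
  ultimately show ?thesis
    unfolding stable_def using stableD[OF S] C
    by (auto simp: relator_delta_inv relator_delta_mult subset_iff)
qed

text \<open>The affine formula used from here on: the integer \<open>n\<close> is a free parameter,
  and every word value responds to it by a power of its derivative along \<open>c\<close>.\<close>

lemma word_shift:
  assumes "\<tau> \<in> words" "b \<in> tuples" "c \<in> tuples"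
  shows "\<tau> (\<lambda>i. b i \<otimes> c i [^] (n::int)) = \<tau> b \<otimes> delta \<tau> c [^] n"
proof -
  have c: "(\<lambda>i. c i [^] n) \<in> tuples" using assms(3) by simp
  have "\<tau> (\<lambda>i. b i \<otimes> c i [^] n) = \<tau> base \<otimes> (delta \<tau> b \<otimes> delta \<tau> c [^] n)"
    using word_delta[OF assms(1) mult_tuples[OF assms(2) c]]
      delta_add[OF assms(1,2) c] delta_pow[OF assms(1,3)] by simp
  also have "\<dots> = \<tau> base \<otimes> delta \<tau> b \<otimes> delta \<tau> c [^] n" using assms by (simp add: m_assoc)
  finally show ?thesis using word_delta[OF assms(1,2)] by simp
qed

end

section \<open>The rationally irreducible case\<close>

context fg_abelian_normal begin

lemma pows_gcd:
  assumes V: "subgroup V G" and "pows i \<subseteq> V" "pows j \<subseteq> V"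
  shows "pows (gcd i j) \<subseteq> V"
proof
  fix x assume "x \<in> pows (gcd i j)"
  then obtain y where y: "y \<in> A" "x = y [^] gcd i j" by (auto simp: pows_def)
  obtain u v where uv: "u * i + v * j = gcd i j" using bezout_int by blast
  have "y [^] gcd i j = (y [^] u) [^] i \<otimes> (y [^] v) [^] j"
    using y(1) by (simp add: int_pow_pow flip: uv int_pow_mult)
  moreover have "(y [^] u) [^] i \<in> V" "(y [^] v) [^] j \<in> V"
    using assms(2,3) pow_closed[OF y(1)] by (auto simp: pows_def)
  ultimately show "x \<in> V" using y subgroup.m_closed[OF V] by simp
qed

lemma pows_one: "pows 1 = A"
  by (auto simp: pows_def image_iff)

text \<open>Nakayama with the trivial subgroup: \<open>A = A^p\<close> yields an \<open>l\<close>
  congruent to 1 modulo \<open>p\<close> with \<open>A^l\<close> trivial, and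
  \<open>l \<noteq> 0\<close> because \<open>p > 1\<close>. The factor \<open>{\<one>}\<close> in
  the hypothesis gives it the shape of \<open>pow_mem_of_supplement\<close>.\<close>

lemma trivial_of_supplement:
  assumes tf: "\<And>x m. x \<in> A \<Longrightarrow> x [^] (m::int) = \<one> \<Longrightarrow> m \<noteq> 0 \<Longrightarrow> x = \<one>"
    and "p > (1::int)" and "A \<subseteq> {\<one>} <#> pows p"
  shows "A = {\<one>}"
proof -
  obtain l where l: "[l = 1] (mod p)" "pows l \<subseteq> {\<one>}"
    using pow_mem_of_supplement[OF triv_subgroup assms(3)] by blast
  have "l \<noteq> 0" using l(1) assms(2) by (auto simp: cong_def)
  then have "x = \<one>" if "x \<in> A" for x using that tf[of x l] l(2) by (auto simp: pows_def)
  then show ?thesis using A.one_closed by blast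
qed

end

lemma generated_mod_mono:
  assumes G: "group G" and "d \<le> k" "generated_mod G d N" "N \<subseteq> carrier G"
  shows "generated_mod G k N"
proof -
  interpret group G by fact
  obtain h where h: "h ` {..<d} \<subseteq> carrier G" "generate G (h ` {..<d} \<union> N) = carrier G"
    using assms(3) by (auto simp: generated_mod_def)
  define f where "f i = (if i < d then h i else \<one>\<^bsub>G\<^esub>)" for i
  have f: "f ` {..<k} \<subseteq> carrier G" using h(1) by (auto simp: f_def)
  have "h ` {..<d} \<union> N \<subseteq> f ` {..<k} \<union> N" using assms(2) by (auto simp: f_def image_iff)
  from mono_generate[OF this] have "carrier G \<subseteq> generate G (f ` {..<k} \<union> N)" using h(2) by simp
  moreover have "generate G (f ` {..<k} \<union> N) \<subseteq> carrier G" using f assms(4) by (intro generate_incl) auto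
  ultimately show ?thesis using f by (auto simp: generated_mod_def)
qed

text \<open>The condition \<open>irreducible\<close> expresses without tensor products that
  \<open>A\<close> tensored with the rationals is an irreducible module for
  \<open>G\<close>.\<close>

locale irreducible_lifting = lifting_problem +
  fixes d :: nat
  assumes k_def: "k = Suc d"
    and finite_quotients: "N \<in> fin_index_normal G \<Longrightarrow> generated_mod G d N"
    and irreducible: "B \<lhd> G \<Longrightarrow> B \<subseteq> A \<Longrightarrow> B \<noteq> {\<one>} \<Longrightarrow> \<exists>m>0. pows m \<subseteq> B"
    and torsion_free: "x \<in> A \<Longrightarrow> x [^] (m::int) = \<one> \<Longrightarrow> m \<noteq> 0 \<Longrightarrow> x = \<one>"
    and nontrivial: "A \<noteq> {\<one>}"
begin

text \<open>This settles the finitely many primes dividing \<open>m\<close>; one tuple for all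
  primes is the remaining problem.\<close>

lemma lift_mod_pows:
  assumes "m > 0"
  shows "\<exists>b\<in>tuples. A \<subseteq> (\<lambda>\<tau>. \<tau> b) ` relators <#> pows m"
proof -
  obtain S where S: "transversal G S A (pows m)" using pows_transversal[OF assms] by blast
  have gen: "generated_mod G k N" if N: "N \<in> fin_index_normal G" for N
    using generated_mod_mono[OF is_group _ finite_quotients[OF N], of k] N k_def
      normal_imp_subgroup[of N G] subgroup.subset[of N G] by (auto simp: fin_index_normal_def)
  have g: "g ` {..<k} \<subseteq> carrier G" using g_closed by auto
  obtain b where b: "\<forall>i. b i \<in> A" "generate G ((\<lambda>i. g i \<otimes> b i) ` {..<k} \<union> pows m) = carrier G"
    using lift_generators[OF normal comm pows_normal pows_subset S g g_gens gen] by blast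
  then have "b \<in> tuples" by (intro tuplesI) blast
  then show ?thesis using supplement_relator_values[OF _ pows_normal pows_subset b(2)] by blast
qed

text \<open>Shifts by multiples of \<open>m\<close> are invisible modulo \<open>A^m\<close>, so they
  remain free after the primes dividing \<open>m\<close> have been settled.\<close>

lemma supplement_shift:
  assumes b: "b \<in> tuples" and c: "c \<in> tuples" and sup: "A \<subseteq> (\<lambda>\<tau>. \<tau> b) ` relators <#> pows m"
  shows "A \<subseteq> (\<lambda>\<tau>. \<tau> (\<lambda>i. b i \<otimes> c i [^] (m * n))) ` relators <#> pows m"
proof
  fix x assume "x \<in> A"
  then obtain \<tau> z where \<tau>: "\<tau> \<in> relators" "z \<in> pows m" "x = \<tau> b \<otimes> z"
    using sup unfolding set_mult_def by blast
  define y where "y = delta \<tau> c [^] (m * n)"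
  have y: "y \<in> pows m"
    using pows_mult[of m n] \<tau>(1) c unfolding y_def pows_def by (auto simp: relators_words)
  interpret P: normal "pows m" G by (rule pows_normal)
  have "\<tau> (\<lambda>i. b i \<otimes> c i [^] (m * n)) = \<tau> b \<otimes> y"
    unfolding y_def by (rule word_shift[OF relators_words[OF \<tau>(1)] b c])
  then have "x = \<tau> (\<lambda>i. b i \<otimes> c i [^] (m * n)) \<otimes> (inv y \<otimes> z)"
    using \<tau> y b by (simp add: m_assoc inv_mult_cancel relators_words)
  moreover have "inv y \<otimes> z \<in> pows m" using y \<tau>(2) by simp
  ultimately show "x \<in> (\<lambda>\<tau>. \<tau> (\<lambda>i. b i \<otimes> c i [^] (m * n))) ` relators <#> pows m"
    using \<tau>(1) unfolding set_mult_def by blast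
qed

text \<open>Constant relators have the same values at every tuple. These values form a nontrivial
  normal subgroup, which contains some \<open>A^m\<close>, so a tuple that is good modulo this
  \<open>m\<close> is good outright.\<close>

lemma generators_if_constant_relator:
  assumes \<tau>: "\<tau> \<in> relators" "\<And>b. b \<in> tuples \<Longrightarrow> delta \<tau> b = \<one>" "\<tau> base \<noteq> \<one>"
  shows "\<exists>b\<in>tuples. A \<subseteq> (\<lambda>\<tau>. \<tau> b) ` relators"
proof -
  define C where "C = {\<tau> \<in> relators. \<forall>b\<in>tuples. delta \<tau> b \<in> {\<one>}}"
  have C: "stable C" unfolding C_def
    by (rule stable_delta_vimage[OF stable_relators order_refl one_is_normal])
  have "\<tau> base \<in> (\<lambda>\<tau>. \<tau> base) ` C" using \<tau> by (auto simp: C_def)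
  moreover have "(\<lambda>\<tau>. \<tau> base) ` C \<subseteq> A"
    using relators_closed[OF stableD(1)[OF C] base_tuples] by auto
  ultimately obtain m where m: "m > 0" "pows m \<subseteq> (\<lambda>\<tau>. \<tau> base) ` C"
    using irreducible[OF normal_eval_image[OF C base_tuples]] \<tau>(3) by blast
  obtain b where b: "b \<in> tuples" "A \<subseteq> (\<lambda>\<tau>. \<tau> b) ` relators <#> pows m"
    using lift_mod_pows[OF m(1)] by blast
  interpret V: normal "(\<lambda>\<tau>. \<tau> b) ` relators" G by (rule normal_eval_image[OF stable_relators b(1)])
  have "\<sigma> base = \<sigma> b" if "\<sigma> \<in> C" for \<sigma>
    using that b word_delta[of \<sigma> b] by (auto simp: C_def relators_words)
  then have "(\<lambda>\<tau>. \<tau> base) ` C = (\<lambda>\<tau>. \<tau> b) ` C" by (rule image_cong[OF refl])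
  then have "pows m \<subseteq> (\<lambda>\<tau>. \<tau> b) ` relators" using m(2) by (auto simp: C_def)
  then have "(\<lambda>\<tau>. \<tau> b) ` relators <#> pows m \<subseteq> (\<lambda>\<tau>. \<tau> b) ` relators"
    unfolding set_mult_def using V.m_closed by blast
  then show ?thesis using b by blast
qed

text \<open>
  The direction \<open>b2\<close> makes the values at \<open>\<tau>\<close> with \<open>delta \<tau> b1 = \<one>\<close> contain \<open>A\<^sup>J\<close>, whatever multiple
  of \<open>b1\<close> is added afterwards. Adding \<open>m s\<close> times \<open>b1\<close> changes a matrix of relator values by a
  scalar, and \<open>s\<close> is chosen so that its determinant is prime to \<open>J\<close> away from \<open>m\<close>.
\<close>

lemma generators_if_two_directions:
  assumes b1: "b1 \<in> tuples" "\<tau>1 \<in> relators" "delta \<tau>1 b1 \<noteq> \<one>"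
    and b2: "b2 \<in> tuples" "\<tau>2 \<in> relators" "delta \<tau>2 b1 = \<one>" "delta \<tau>2 b2 \<noteq> \<one>"
  shows "\<exists>b\<in>tuples. A \<subseteq> (\<lambda>\<tau>. \<tau> b) ` relators"
proof -
  have dc: "delta \<tau> b \<in> A" if "\<tau> \<in> relators" "b \<in> tuples" for \<tau> b
    using that relators_words by simp
  have "(\<lambda>\<tau>. delta \<tau> b1) ` relators \<subseteq> A" using dc b1 by auto
  moreover have "(\<lambda>\<tau>. delta \<tau> b1) ` relators \<noteq> {\<one>}" using b1 by blast
  ultimately obtain m1 where m1: "m1 > 0" "pows m1 \<subseteq> (\<lambda>\<tau>. delta \<tau> b1) ` relators"
    using irreducible[OF normal_delta_image[OF stable_relators b1(1)]] by blast
  \<comment> \<open>The factor \<open>r!\<close> makes every prime up to \<open>r\<close> divide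
    \<open>m\<close>, as \<open>det_add_scalar_avoids_primes\<close> requires.\<close>
  define m where "m = m1 * int (fact r)"
  have m: "m > 0" "pows m \<subseteq> (\<lambda>\<tau>. delta \<tau> b1) ` relators"
    unfolding m_def using m1(1) subset_trans[OF pows_mult m1(2)] by (simp_all add: fact_gt_zero)
  have small: "int p dvd m" if "prime p" "p \<le> r" for p
  proof -
    have "p dvd fact r" using that prime_dvd_fact_iff by blast
    then show ?thesis unfolding m_def by (metis dvd_mult of_nat_dvd_iff)
  qed
  define K where "K = {\<tau> \<in> relators. \<forall>b\<in>{b1}. delta \<tau> b \<in> {\<one>}}"
  have K: "stable K" unfolding K_def
    by (rule stable_delta_vimage[OF stable_relators _ one_is_normal]) (simp add: b1)
  obtain a0 where a0: "a0 \<in> tuples" "A \<subseteq> (\<lambda>\<tau>. \<tau> a0) ` relators <#> pows m"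
    using lift_mod_pows[OF m(1)] by blast
  define c where "c t = (\<lambda>i. a0 i \<otimes> b2 i [^] (m * t))" for t :: int
  have c: "c t \<in> tuples" for t unfolding c_def using a0 b2 by simp
  \<comment> \<open>The values of \<open>\<tau>2\<close> along \<open>c t\<close> form an arithmetic
    progression, with nonzero step because \<open>A\<close> is torsion-free; they cannot vanish at
    both 0 and 1.\<close>
  have "\<exists>t. \<tau>2 (c t) \<noteq> \<one>"
  proof (rule ccontr)
    assume "\<not> ?thesis"
    then have "\<tau>2 (c t) = \<one>" for t by blast
    moreover have "\<tau>2 (c t) = \<tau>2 a0 \<otimes> delta \<tau>2 b2 [^] (m * t)" for t
      unfolding c_def by (rule word_shift[OF relators_words[OF b2(2)] a0(1) b2(1)])
    ultimately have *: "\<tau>2 a0 \<otimes> delta \<tau>2 b2 [^] (m * t) = \<one>" for t by metis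
    have "\<tau>2 a0 = \<one>" using *[of 0] a0 b2 relators_words by simp
    then have "delta \<tau>2 b2 [^] m = \<one>" using *[of 1] dc[OF b2(2,1)] by simp
    then have "delta \<tau>2 b2 = \<one>" by (rule torsion_free[OF dc[OF b2(2,1)]]) (use m(1) in simp)
    then show False using b2(4) by simp
  qed
  then obtain t where t: "\<tau>2 (c t) \<noteq> \<one>" by blast
  have "\<tau>2 \<in> K" using b2 by (simp add: K_def)
  then have "(\<lambda>\<tau>. \<tau> (c t)) ` K \<noteq> {\<one>}" using t by blast
  moreover have "(\<lambda>\<tau>. \<tau> (c t)) ` K \<subseteq> A" using relators_closed[OF stableD(1)[OF K] c] by auto
  ultimately obtain J where J: "J > 0" "pows J \<subseteq> (\<lambda>\<tau>. \<tau> (c t)) ` K"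
    using irreducible[OF normal_eval_image[OF K c]] by blast
  have "\<exists>\<tau>. i < r \<longrightarrow> \<tau> \<in> relators \<and> delta \<tau> b1 = a i [^] m" for i
    using m(2) a_closed[of i] unfolding pows_def by (cases "i < r") force+
  then obtain \<sigma> where \<sigma>: "\<And>i. i < r \<Longrightarrow> \<sigma> i \<in> relators" "\<And>i. i < r \<Longrightarrow> delta (\<sigma> i) b1 = a i [^] m"
    by metis
  have "\<exists>v. i < r \<longrightarrow> \<sigma> i (c t) = lincomb a r v" for i
    using lincomb_surj relators_closed[OF \<sigma>(1) c] by blast
  then obtain N where N: "\<And>i. i < r \<Longrightarrow> \<sigma> i (c t) = lincomb a r (N i)" by metis
  \<comment> \<open>In the scalar \<open>m * m * s\<close> one \<open>m\<close> comes from
    \<open>delta (\<sigma> i) b1 = a i [^] m\<close>, the other from the shift exponent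
    \<open>m * s\<close>, which preserves the lift modulo \<open>A^m\<close>.\<close>
  have "\<exists>s::int. \<forall>p::nat. prime p \<longrightarrow> int p dvd J \<longrightarrow> \<not> int p dvd m * m \<longrightarrow>
    \<not> int p dvd det (mat r r (\<lambda>(i,j). N i j + (if i = j then (m * m) * s else 0)))"
    by (rule det_add_scalar_avoids_primes) (use J small in auto)
  then obtain s where s: "\<And>p::nat. prime p \<Longrightarrow> int p dvd J \<Longrightarrow> \<not> int p dvd m * m \<Longrightarrow>
    \<not> int p dvd det (mat r r (\<lambda>(i,j). N i j + (if i = j then (m * m) * s else 0)))"
    by blast
  define f where "f = det (mat r r (\<lambda>(i,j). N i j + (if i = j then (m * m) * s else 0)))"
  define e where "e = (\<lambda>i. c t i \<otimes> b1 i [^] (m * s))"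
  have e: "e \<in> tuples" unfolding e_def using c b1 by simp
  have ev: "\<tau> e = \<tau> (c t) \<otimes> delta \<tau> b1 [^] (m * s)" if "\<tau> \<in> relators" for \<tau>
    unfolding e_def by (rule word_shift[OF relators_words[OF that] c b1(1)])
  define V where "V = (\<lambda>\<tau>. \<tau> e) ` relators"
  have V: "subgroup V G"
    unfolding V_def by (rule normal_imp_subgroup[OF normal_eval_image[OF stable_relators e]])
  have "\<tau> (c t) = \<tau> e" if "\<tau> \<in> K" for \<tau>
    using that ev[of \<tau>] c relators_words[of \<tau>] by (simp add: K_def)
  then have "(\<lambda>\<tau>. \<tau> (c t)) ` K = (\<lambda>\<tau>. \<tau> e) ` K" by (rule image_cong[OF refl])
  then have VJ: "pows J \<subseteq> V" using J(2) by (auto simp: V_def K_def)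
  have "lincomb a r (\<lambda>j. N i j + (if i = j then (m * m) * s else 0)) \<in> V" if i: "i < r" for i
  proof -
    have "lincomb a r (\<lambda>j. N i j + (if i = j then (m * m) * s else 0)) =
        lincomb a r (\<lambda>j. N i j + (if j = i then (m * m) * s else 0))"
      by (rule lincomb_cong) auto
    also have "\<dots> = \<sigma> i (c t) \<otimes> (a i [^] m) [^] (m * s)"
      using i a_closed[OF i] by (simp add: lincomb_add lincomb_unit N int_pow_pow mult.assoc)
    also have "\<dots> = \<sigma> i e" using ev[OF \<sigma>(1)[OF i]] \<sigma>(2)[OF i] by simp
    finally show ?thesis using \<sigma>(1)[OF i] by (simp add: V_def)
  qed
  then have Vf: "pows f \<subseteq> V"
    unfolding f_def by (intro pows_subset_of_gens[OF V] pow_det_mem[OF V])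
  have "A \<subseteq> V <#> pows m"
    unfolding V_def e_def using supplement_shift[OF c b1(1)] supplement_shift[OF a0(1) b2(1) a0(2)]
    unfolding c_def by blast
  then obtain l where l: "[l = 1] (mod m)" "pows l \<subseteq> V" using pow_mem_of_supplement[OF V] by blast
  \<comment> \<open>A prime dividing \<open>l\<close> does not divide \<open>m\<close>, since
    \<open>l\<close> is congruent to 1 modulo \<open>m\<close>. A prime that divides
    \<open>J\<close> but not \<open>m\<close> does not divide \<open>f\<close>, by the choice of
    \<open>s\<close>.\<close>
  have "gcd (gcd l J) f = 1"
  proof (rule ccontr)
    assume ne: "gcd (gcd l J) f \<noteq> 1"
    have "gcd (gcd l J) f \<noteq> 0" using J(1) by auto
    then have "nat (gcd (gcd l J) f) \<noteq> 1" using ne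
      by (metis gcd_ge_0_int int_nat_eq of_nat_1)
    then obtain p where p: "prime p" "p dvd nat (gcd (gcd l J) f)" using prime_factor_nat by blast
    then have "int p dvd gcd (gcd l J) f" by (metis gcd_ge_0_int int_dvd_int_iff int_nat_eq)
    then have dvds: "int p dvd l" "int p dvd J" "int p dvd f" by auto
    have "\<not> int p dvd m"
    proof
      assume "int p dvd m"
      then have "[l = 1] (mod int p)" using l(1) cong_dvd_modulus by blast
      then have "int p dvd 1" using dvds(1) cong_dvd_iff by blast
      then show False using p(1) not_prime_unit prime_nat_int_transfer by blast
    qed
    then have "\<not> int p dvd m * m" using p(1) by (metis prime_dvd_multD prime_nat_int_transfer)
    then show False using s[OF p(1) dvds(2)] dvds(3) by (simp add: f_def)
  qed
  then have "A \<subseteq> V" using pows_gcd[OF V pows_gcd[OF V l(2) VJ] Vf] by (simp add: pows_one)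
  then show ?thesis using e by (auto simp: V_def)
qed

text \<open>
  Here \<open>\<tau> \<mapsto> delta \<tau> b\<close> embeds the relators into \<open>A\<close>, so \<open>\<tau> \<mapsto> \<tau> base\<close> factors through it, up to
  a power, by an endomorphism \<open>\<psi>\<close> of \<open>A\<close>. Thus \<open>\<psi> b\<close> yields a splitting modulo almost every
  prime \<open>p\<close>. By the pigeonhole principle at least \<open>|A/A\<^sup>p|\<^sup>d\<close> tuples have the same value as a given one at the
  relator \<open>w\<close>, which generates all relators up to index prime to \<open>p\<close>. Translating them gives too
  many splittings.
\<close>

lemma one_direction_impossible:
  assumes const: "\<And>\<tau>. \<tau> \<in> relators \<Longrightarrow> (\<And>b. b \<in> tuples \<Longrightarrow> delta \<tau> b = \<one>) \<Longrightarrow> \<tau> base = \<one>"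
    and one_dir: "\<And>b \<tau> \<sigma> c. b \<in> tuples \<Longrightarrow> \<tau> \<in> relators \<Longrightarrow> delta \<tau> b \<noteq> \<one> \<Longrightarrow>
      \<sigma> \<in> relators \<Longrightarrow> delta \<sigma> b = \<one> \<Longrightarrow> c \<in> tuples \<Longrightarrow> delta \<sigma> c = \<one>"
  shows False
proof (cases "\<exists>b\<in>tuples. \<exists>w\<in>relators. delta w b \<noteq> \<one>")
  case False
  \<comment> \<open>If no relator moves, all are constant, hence trivial by \<open>const\<close>,
    and a lift modulo \<open>A^2\<close> forces \<open>A = A^2\<close>.\<close>
  obtain b where b: "b \<in> tuples" "A \<subseteq> (\<lambda>\<tau>. \<tau> b) ` relators <#> pows 2"
    using lift_mod_pows[of 2] by auto
  have "\<tau> b = \<one>" if "\<tau> \<in> relators" for \<tau>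
    using word_delta[OF relators_words[OF that] b(1)] const[OF that] False that b(1) by auto
  then have "(\<lambda>\<tau>. \<tau> b) ` relators \<subseteq> {\<one>}" by auto
  then have "A \<subseteq> {\<one>} <#> pows 2"
    by (rule subset_trans[OF b(2) mono_set_mult[OF _ order_refl]])
  then show False using trivial_of_supplement[OF torsion_free, where p = 2] nontrivial by simp
next
  case True
  then obtain b w where b: "b \<in> tuples" and w: "w \<in> relators" "delta w b \<noteq> \<one>" by blast
  have dc: "delta \<tau> c \<in> A" if "\<tau> \<in> relators" "c \<in> tuples" for \<tau> c
    using that relators_words by simp
  have zero: "\<tau> c = \<one>" if "\<tau> \<in> relators" "delta \<tau> b = \<one>" "c \<in> tuples" for \<tau> c
    using word_delta[OF relators_words[OF that(1)] that(3)] const[OF that(1)]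
      one_dir[OF b w that(1,2)] that(3) by auto
  \<comment> \<open>By \<open>zero\<close>, the derivative along \<open>b\<close> determines a
    relator as a function on tuples; this makes \<open>\<psi>\<close> below well defined.\<close>
  have inj: "\<tau> c = \<sigma> c" if "\<tau> \<in> relators" "\<sigma> \<in> relators" "delta \<tau> b = delta \<sigma> b" "c \<in> tuples" for \<tau> \<sigma> c
  proof -
    have R: "(\<lambda>b. inv (\<tau> b)) \<in> relators" using stableD(3)[OF stable_relators that(1)] .
    then have R': "(\<lambda>b. inv (\<tau> b) \<otimes> \<sigma> b) \<in> relators" using stableD(4)[OF stable_relators _ that(2)] by blast
    have "delta (\<lambda>b. inv (\<tau> b) \<otimes> \<sigma> b) b = \<one>"
      using relator_delta_mult[OF R that(2) b] relator_delta_inv[OF that(1) b] that(3) dc[OF that(2) b] by simp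
    then have "inv (\<tau> c) \<otimes> \<sigma> c = \<one>" using zero[OF R' _ that(4)] by simp
    then show ?thesis using that relators_closed A.mem_carrier
      by (metis inv_closed inv_equality inv_inv)
  qed
  have "(\<lambda>\<tau>. delta \<tau> b) ` relators \<subseteq> A" using dc b by auto
  moreover have "(\<lambda>\<tau>. delta \<tau> b) ` relators \<noteq> {\<one>}" using w by blast
  ultimately obtain m where m: "m > 0" "pows m \<subseteq> (\<lambda>\<tau>. delta \<tau> b) ` relators"
    using irreducible[OF normal_delta_image[OF stable_relators b]] by blast
  \<comment> \<open>Sending \<open>delta \<tau> b\<close> to \<open>\<tau> base\<close> is defined
    only on a subgroup of \<open>A\<close>. That subgroup contains \<open>A^m\<close>, so
    precomposing with the \<open>m\<close>-th power gives an endomorphism of all of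
    \<open>A\<close>.\<close>
  define \<psi> where "\<psi> y = (SOME \<tau>. \<tau> \<in> relators \<and> delta \<tau> b = y [^] m) base" for y
  have \<psi>_eq: "\<psi> y = \<tau> base" if "\<tau> \<in> relators" "delta \<tau> b = y [^] m" for y \<tau>
  proof -
    have "(SOME \<tau>. \<tau> \<in> relators \<and> delta \<tau> b = y [^] m) \<in> relators \<and>
        delta (SOME \<tau>. \<tau> \<in> relators \<and> delta \<tau> b = y [^] m) b = y [^] m"
      by (rule someI[of _ \<tau>]) (use that in simp)
    then show ?thesis unfolding \<psi>_def using that base_tuples by (intro inj) auto
  qed
  have \<psi>_ex: "\<exists>\<tau>\<in>relators. delta \<tau> b = y [^] m" if "y \<in> A" for y
  proof -
    have "y [^] m \<in> (\<lambda>\<tau>. delta \<tau> b) ` relators" using m(2) that unfolding pows_def by blast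
    then show ?thesis by force
  qed
  have \<psi>: "equivariant \<psi>"
    unfolding equivariant_def
  proof (intro conjI ballI)
    fix x assume x: "x \<in> A"
    obtain \<tau> where \<tau>: "\<tau> \<in> relators" "delta \<tau> b = x [^] m" using \<psi>_ex[OF x] by blast
    show "\<psi> x \<in> A" using \<psi>_eq[OF \<tau>] relators_closed[OF \<tau>(1) base_tuples] by simp
    show "\<psi> (x \<otimes> y) = \<psi> x \<otimes> \<psi> y" if y: "y \<in> A" for y
    proof -
      obtain \<sigma> where \<sigma>: "\<sigma> \<in> relators" "delta \<sigma> b = y [^] m" using \<psi>_ex[OF y] by blast
      have "\<psi> (x \<otimes> y) = \<tau> base \<otimes> \<sigma> base"
        by (rule \<psi>_eq[OF stableD(4)[OF stable_relators \<tau>(1) \<sigma>(1)]])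
          (simp add: relator_delta_mult \<tau> \<sigma> b pow_mult x y)
      then show ?thesis using \<psi>_eq[OF \<tau>] \<psi>_eq[OF \<sigma>] by simp
    qed
    show "\<psi> (y \<otimes> x \<otimes> inv y) = y \<otimes> \<psi> x \<otimes> inv y" if y: "y \<in> carrier G" for y
    proof -
      obtain \<tau>' where \<tau>': "\<tau>' \<in> relators" "\<And>b. b \<in> tuples \<Longrightarrow> \<tau>' b = y \<otimes> \<tau> b \<otimes> inv y"
        using stableD(5)[OF stable_relators \<tau>(1) y] by blast
      have "delta \<tau>' b = (y \<otimes> x \<otimes> inv y) [^] m"
        using delta_conj[OF \<tau>(1) b y \<tau>'(2)] conj_pow[OF y] x \<tau>(2) by simp
      from \<psi>_eq[OF \<tau>'(1) this] show ?thesis using \<tau>'(2)[OF base_tuples] \<psi>_eq[OF \<tau>] by simp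
    qed
  qed
  define c0 where "c0 = (\<lambda>i. \<psi> (b i))"
  have c0: "c0 \<in> tuples" unfolding c0_def by (rule tuplesI) (use \<psi> b in \<open>simp add: equivariant_def\<close>)
  \<comment> \<open>The derivative along \<open>c0\<close> is the \<open>m\<close>-th power of the
    constant term, so a suitable power of \<open>c0\<close> can cancel all constant terms modulo
    \<open>A^p\<close> simultaneously.\<close>
  have dc0: "delta \<tau> c0 = \<tau> base [^] m" if "\<tau> \<in> relators" for \<tau>
    unfolding c0_def delta_equivariant[OF \<psi> relators_words[OF that] b]
    by (rule \<psi>_eq[OF relator_delta_pow[OF that b]])
  \<comment> \<open>The intersection of \<open>BB\<close> is the normal closure of
    \<open>delta w b\<close>. The exponent \<open>m1\<close> measures how far the single relator
    \<open>w\<close> is from controlling all relators.\<close>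
  define BB where "BB = {B. B \<lhd> G \<and> B \<subseteq> A \<and> delta w b \<in> B}"
  have BA: "A \<in> BB" using dc[OF w(1) b] normal by (simp add: BB_def)
  have "subgroup (\<Inter>BB) G"
    by (rule subgroups_Inter) (use BA in \<open>auto simp: BB_def normal_imp_subgroup\<close>)
  moreover have "x \<otimes> y \<otimes> inv x \<in> \<Inter>BB" if "x \<in> carrier G" "y \<in> \<Inter>BB" for x y
    using that by (auto simp: BB_def normal.inv_op_closed2)
  ultimately have "\<Inter>BB \<lhd> G" by (auto simp: normal_inv_iff)
  moreover have "\<Inter>BB \<subseteq> A" "\<Inter>BB \<noteq> {\<one>}" using BA w(2) by (auto simp: BB_def)
  ultimately obtain m1 where m1: "m1 > 0" "pows m1 \<subseteq> \<Inter>BB" using irreducible by blast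
  \<comment> \<open>A prime above \<open>m * m1\<close> divides neither \<open>m\<close> nor
    \<open>m1\<close>, so both are invertible modulo \<open>p\<close>.\<close>
  obtain p :: nat where p: "prime p" "nat (m * m1) < p" using bigger_prime by blast
  have p1: "int p > 1" using p(1) prime_gt_1_nat by auto
  have "m * m1 < int p" using p(2) m m1 by (simp add: nat_less_iff)
  moreover have "m \<le> m * m1" "m1 \<le> m * m1" using m(1) m1(1) by (auto simp: mult_le_cancel_left1 mult_le_cancel_right1)
  ultimately have "\<not> int p dvd m" "\<not> int p dvd m1" using m(1) m1(1) zdvd_imp_le by fastforce+
  then have cop: "coprime (int p) m" "coprime (int p) m1"
    using p(1) by (meson prime_imp_coprime prime_nat_int_transfer)+
  obtain v where "[m * v = 1] (mod int p)" using cop(1) cong_solve_coprime_int coprime_commute by metis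
  then have "int p dvd m * v - 1" by (simp add: cong_iff_dvd_diff)
  then have "int p dvd 1 + m * (- v)" by (metis add_uminus_conv_diff dvd_minus_iff minus_diff_eq mult_minus_right)
  \<comment> \<open>\<open>u\<close> is minus the inverse of \<open>m\<close> modulo
    \<open>p\<close>. With it every relator takes the value
    \<open>\<tau> base [^] (1 + m * u)\<close> at \<open>as\<close>, which lies in
    \<open>A^p\<close>: this is the splitting.\<close>
  then obtain u where u: "int p dvd 1 + m * u" by blast
  let ?P = "pows (int p)"
  interpret P: normal ?P G by (rule pows_normal)
  have P_mem: "x [^] (int p * n) \<in> ?P" if "x \<in> A" for x n
    using pows_mult[of "int p" n] that by (auto simp: pows_def)
  define as where "as = (\<lambda>i. base i \<otimes> c0 i [^] u)"
  have as: "as \<in> tuples" unfolding as_def using c0 by simp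
  have as_P: "\<tau> as \<in> ?P" if \<tau>: "\<tau> \<in> relators" for \<tau>
  proof -
    have A: "\<tau> base \<in> A" by (rule relators_closed[OF \<tau> base_tuples])
    have "\<tau> as = \<tau> base \<otimes> (\<tau> base [^] m) [^] u"
      unfolding as_def word_shift[OF relators_words[OF \<tau>] base_tuples c0] dc0[OF \<tau>] ..
    also have "\<dots> = \<tau> base [^] (1 + m * u)" using A by (simp add: int_pow_pow int_pow_mult)
    finally show ?thesis using u P_mem[OF A] by (auto elim: dvdE)
  qed
  \<comment> \<open>The relators with value in \<open>A^p\<close> at \<open>c\<close> have
    derivatives filling a normal subgroup that contains \<open>delta w b\<close>, hence
    \<open>A^m1\<close>. By \<open>inj\<close>, \<open>\<tau> c [^] m1\<close> is then in
    \<open>A^p\<close>, and \<open>m1\<close> is prime to \<open>p\<close>.\<close>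
  have all_P: "\<tau> c \<in> ?P" if c: "c \<in> tuples" and wc: "w c \<in> ?P" and \<tau>: "\<tau> \<in> relators" for c \<tau>
  proof -
    define S where "S = {\<tau> \<in> relators. \<tau> c \<in> ?P}"
    have S: "stable S" unfolding S_def by (rule stable_eval_vimage[OF stable_relators c pows_normal])
    have "(\<lambda>\<tau>. delta \<tau> b) ` S \<in> BB"
      using normal_delta_image[OF S b] dc[OF stableD(1)[OF S] b] w wc by (auto simp: BB_def S_def)
    then have "pows m1 \<subseteq> (\<lambda>\<tau>. delta \<tau> b) ` S" using m1 by blast
    moreover have "delta \<tau> b [^] m1 \<in> pows m1" using dc[OF \<tau> b] by (auto simp: pows_def)
    ultimately obtain \<sigma> where \<sigma>: "\<sigma> \<in> S" "delta \<tau> b [^] m1 = delta \<sigma> b" by blast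
    have A: "\<tau> c \<in> A" by (rule relators_closed[OF \<tau> c])
    have "\<tau> c [^] m1 = \<sigma> c"
      using inj[OF relator_delta_pow(1)[OF \<tau> b] stableD(1)[OF S \<sigma>(1)] _ c]
        relator_delta_pow(2)[OF \<tau> b] \<sigma>(2) by simp
    then have *: "\<tau> c [^] m1 \<in> ?P" using \<sigma>(1) by (simp add: S_def)
    obtain x y where xy: "x * int p + y * m1 = 1"
      using bezout_int[of "int p" m1] cop(2) by (auto simp: coprime_iff_gcd_eq_1)
    have "\<tau> c = \<tau> c [^] (int p * x + m1 * y)" using A xy by (simp add: mult.commute)
    also have "\<dots> = \<tau> c [^] (int p * x) \<otimes> (\<tau> c [^] m1) [^] y"
      using A by (simp add: int_pow_mult int_pow_pow)
    also have "\<dots> \<in> ?P" using P_mem[OF A] subgroup_int_pow_closed[OF P.subgroup_axioms *] by simp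
    finally show ?thesis .
  qed
  obtain S where S: "transversal G S A ?P" using pows_transversal[of "int p"] p1 by auto
  have finS: "finite S" and SA: "\<And>s. s \<in> S \<Longrightarrow> s \<in> A" using S by (auto simp: transversal_def)
  obtain s0 where s0: "s0 \<in> S" using transversalD[OF S A.one_closed] by blast
  define D where "D = ({..<k} \<rightarrow>\<^sub>E S)"
  have finD: "finite D" unfolding D_def using finS by (simp add: finite_PiE)
  define ext where "ext f = (\<lambda>i. if i < k then f i else \<one>)" for f :: "nat \<Rightarrow> 'a"
  have ext: "ext f \<in> tuples" if "f \<in> D" for f
  proof -
    have "f i \<in> A" if "i < k" for i using \<open>f \<in> D\<close> that SA by (auto simp: D_def)
    then show ?thesis unfolding ext_def by (intro tuplesI) simp
  qed
  define q where "q f = (SOME s. s \<in> S \<and> inv s \<otimes> w (ext f) \<in> ?P)" for f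
  have q: "q f \<in> S" "inv (q f) \<otimes> w (ext f) \<in> ?P" if "f \<in> D" for f
  proof -
    have "\<exists>s. s \<in> S \<and> inv s \<otimes> w (ext f) \<in> ?P"
      using transversalD[OF S relators_closed[OF w(1) ext[OF that]]] by blast
    from someI_ex[OF this] show "q f \<in> S" "inv (q f) \<otimes> w (ext f) \<in> ?P" unfolding q_def by blast+
  qed
  \<comment> \<open>Here \<open>k = Suc d\<close> enters: \<open>card S ^ k\<close> tuples are
    distributed over at most \<open>card S\<close> classes.\<close>
  have "\<exists>s\<in>S. card S ^ d \<le> card {f \<in> D. q f = s}"
  proof (rule ccontr)
    assume "\<not> ?thesis"
    then have less: "card {f \<in> D. q f = s} < card S ^ d" if "s \<in> S" for s using that by force
    have "D = (\<Union>s\<in>S. {f \<in> D. q f = s})" using q(1) by blast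
    then have "card D \<le> (\<Sum>s\<in>S. card {f \<in> D. q f = s})" using card_UN_le[OF finS] by metis
    also have "\<dots> < (\<Sum>s\<in>S. card S ^ d)" using less s0 finS by (intro sum_strict_mono) auto
    also have "\<dots> = card D" by (simp add: D_def card_PiE k_def)
    finally show False by simp
  qed
  then obtain s1 where s1: "s1 \<in> S" "card S ^ d \<le> card {f \<in> D. q f = s1}" by blast
  define \<Phi> where "\<Phi> = {f \<in> D. q f = s1}"
  have "card S > 0" using s0 finS card_gt_0_iff by blast
  then have "card \<Phi> > 0" using s1(2) by (metis \<Phi>_def less_le_trans zero_less_power)
  then obtain f1 where f1: "f1 \<in> \<Phi>" by (metis card.empty equals0I less_irrefl)
  have \<Phi>: "f \<in> D" "q f = s1" if "f \<in> \<Phi>" for f using that by (auto simp: \<Phi>_def)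
  note ext1 = ext[OF \<Phi>(1)[OF f1]]
  \<comment> \<open>Two tuples in \<open>\<Phi>\<close> give \<open>w\<close> the same class, so
    their difference has its \<open>w\<close>-derivative in \<open>A^p\<close> and can be added to
    the splitting tuple \<open>as\<close>. The exponents -1 and 1 put \<open>z f\<close> into the
    form of \<open>word_shift\<close>.\<close>
  define z where "z f = (\<lambda>i. as i \<otimes> (ext f i \<otimes> ext f1 i [^] (-1::int)) [^] (1::int))" for f
  have zt: "(\<lambda>i. ext f i \<otimes> ext f1 i [^] (-1::int)) \<in> tuples" if "f \<in> \<Phi>" for f
    using ext[OF \<Phi>(1)[OF that]] ext1 by simp
  have z: "z f \<in> tuples" if "f \<in> \<Phi>" for f
    unfolding z_def by (rule mult_tuples[OF as pow_tuples[OF zt[OF that]]])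
  have wz: "w (z f) \<in> ?P" if f: "f \<in> \<Phi>" for f
  proof -
    note extf = ext[OF \<Phi>(1)[OF f]]
    note ww = relators_words[OF w(1)]
    have w1: "w (\<lambda>i. ext f i \<otimes> ext f1 i [^] (-1::int)) = w (ext f) \<otimes> delta w (ext f1) [^] (-1::int)"
      by (rule word_shift[OF ww extf ext1])
    have w2: "w (z f) = w as \<otimes> delta w (\<lambda>i. ext f i \<otimes> ext f1 i [^] (-1::int)) [^] (1::int)"
      unfolding z_def by (rule word_shift[OF ww as zt[OF f]])
    define x y t where xy: "x = w (ext f)" "y = w (ext f1)" "t = w base"
    have A: "x \<in> A" "y \<in> A" "t \<in> A" "s1 \<in> A"
      using relators_closed[OF w(1)] extf ext1 SA s1(1) by (auto simp: xy)
    have "delta w (\<lambda>i. ext f i \<otimes> ext f1 i [^] (-1::int)) = inv t \<otimes> (x \<otimes> inv (inv t \<otimes> y))"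
      unfolding delta_def w1 using A by (simp add: int_pow_neg delta_def flip: xy)
    also have "inv (inv t \<otimes> y) = t \<otimes> inv y" using A comm[of "inv y" t] by (simp add: inv_mult_group)
    also have "inv t \<otimes> (x \<otimes> (t \<otimes> inv y)) = inv t \<otimes> x \<otimes> (t \<otimes> inv y)" using A by (simp add: m_assoc)
    also have "\<dots> = (inv t \<otimes> t) \<otimes> (x \<otimes> inv y)" using A by (intro A_swap) auto
    \<comment> \<open>Inserting \<open>s1\<close>, the common class of \<open>x\<close> and
      \<open>y\<close>, splits the expression into two factors of \<open>A^p\<close>.\<close>
    also have "\<dots> = (inv s1 \<otimes> s1) \<otimes> (x \<otimes> inv y)" using A by simp
    also have "\<dots> = (inv s1 \<otimes> x) \<otimes> (s1 \<otimes> inv y)" using A by (intro A_swap) auto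
    also have "s1 \<otimes> inv y = inv (inv s1 \<otimes> y)" using A comm[of s1 "inv y"] by (simp add: inv_mult_group)
    also have "(inv s1 \<otimes> x) \<otimes> inv (inv s1 \<otimes> y) \<in> ?P"
      using q(2)[OF \<Phi>(1)[OF f]] q(2)[OF \<Phi>(1)[OF f1]] \<Phi>(2) f f1 by (simp add: xy)
    finally have "delta w (\<lambda>i. ext f i \<otimes> ext f1 i [^] (-1::int)) \<in> ?P" .
    then show ?thesis using w2 as_P[OF w(1)] by simp
  qed
  define Y where "Y f = generate G ((\<lambda>i. g i \<otimes> z f i) ` {..<k} \<union> ?P)" for f
  have zg: "(\<lambda>i. g i \<otimes> z f i) ` {..<k} \<subseteq> carrier G" if "f \<in> \<Phi>" for f
    using tuplesD[OF z[OF that]] g_closed by auto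
  have sY: "subgroup (Y f) G" if "f \<in> \<Phi>" for f
    unfolding Y_def by (rule generate_is_subgroup) (use zg[OF that] P.subset in blast)
  have inY: "g i \<otimes> z f i \<in> Y f" if "i < k" for i f
    unfolding Y_def using that by (intro generate.incl) auto
  have PY: "?P \<subseteq> Y f" for f unfolding Y_def by (auto intro: generate.incl)
  \<comment> \<open>An element of \<open>Y f\<close> in \<open>A\<close> is a relator value at
    \<open>z f\<close> times an element of \<open>A^p\<close>, and \<open>all_P\<close> applies to
    the relator value.\<close>
  have YA: "Y f \<inter> A = ?P" if f: "f \<in> \<Phi>" for f
  proof
    show "?P \<subseteq> Y f \<inter> A" using PY pows_subset by blast
    show "Y f \<inter> A \<subseteq> ?P"
    proof
      fix x assume x: "x \<in> Y f \<inter> A"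
      then have "x \<in> generate G ((\<lambda>i. g i \<otimes> z f i) ` {..<k}) <#> ?P"
        using generate_Un_normal[OF zg[OF f] pows_normal] by (simp add: Y_def)
      then obtain h y where h: "h \<in> generate G ((\<lambda>i. g i \<otimes> z f i) ` {..<k})" "y \<in> ?P" "x = h \<otimes> y"
        unfolding set_mult_def by blast
      have yA: "y \<in> A" using h(2) pows_subset by blast
      have "h = x \<otimes> inv y" using h generate_in_carrier[OF zg[OF f] h(1)] by (simp add: free_simps)
      moreover have "x \<otimes> inv y \<in> A" using x yA by simp
      ultimately have "h \<in> (\<lambda>\<tau>. \<tau> (z f)) ` relators" using relator_values[OF z[OF f]] h(1) by blast
      then have "h \<in> ?P" using all_P[OF z[OF f] wz[OF f]] by auto
      then show "x \<in> ?P" using h by simp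
    qed
  qed
  have YG: "Y f <#> A = carrier G" if f: "f \<in> \<Phi>" for f
  proof (rule generated_subset_eq[OF g_gens _ subgroup_set_mult_normal[OF sY[OF f] normal]])
    have "g i \<in> Y f <#> A" if i: "i < k" for i
    proof -
      have zi: "z f i \<in> A" using z[OF f] by simp
      have "g i = (g i \<otimes> z f i) \<otimes> inv (z f i)" using zi g_closed[OF i] by (simp add: m_assoc)
      then show ?thesis unfolding set_mult_def using inY[OF i] A.m_inv_closed[OF zi] by blast
    qed
    moreover have "A \<subseteq> Y f <#> A"
      using subgroup.one_closed[OF sY[OF f]] unfolding set_mult_def by force
    ultimately show "g ` {..<k} \<union> A \<subseteq> Y f <#> A" by blast
  qed
  have injY: "inj_on Y \<Phi>"
  proof (rule inj_onI)
    fix f f' assume f: "f \<in> \<Phi>" and f': "f' \<in> \<Phi>" and eq: "Y f = Y f'"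
    have "f i = f' i" if i: "i < k" for i
    proof -
      define x y c s where xy: "x = f i" "y = f' i" "c = ext f1 i [^] (-1::int)" "s = as i"
      have S2: "x \<in> S" "y \<in> S" using i \<Phi>(1)[OF f] \<Phi>(1)[OF f'] by (auto simp: xy D_def)
      have A: "x \<in> A" "y \<in> A" "c \<in> A" "s \<in> A"
        using S2 SA pow_closed[OF tuplesD[OF ext1]] as by (auto simp: xy)
      have zz: "z f i = s \<otimes> (x \<otimes> c)" "z f' i = s \<otimes> (y \<otimes> c)"
        using i A by (simp_all add: z_def ext_def xy)
      interpret Y: subgroup "Y f" G by (rule sY[OF f])
      have "inv (g i \<otimes> z f i) \<otimes> (g i \<otimes> z f' i) \<in> Y f"
        using inY[OF i, of f] inY[OF i, of f'] eq by auto
      also have "inv (g i \<otimes> z f i) \<otimes> (g i \<otimes> z f' i) = inv c \<otimes> (inv x \<otimes> y) \<otimes> c"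
        using A g_closed[OF i] by (simp add: zz free_simps)
      also have "inv c \<otimes> (inv x \<otimes> y) = (inv x \<otimes> y) \<otimes> inv c" using A by (simp add: comm)
      also have "(inv x \<otimes> y) \<otimes> inv c \<otimes> c = inv x \<otimes> y" using A by (simp add: m_assoc)
      finally have "inv x \<otimes> y \<in> ?P" using YA[OF f] A by auto
      moreover have "inv y \<otimes> y \<in> ?P" using A by simp
      ultimately have "x = y" using S S2 A unfolding transversal_def by blast
      then show ?thesis by (simp add: xy)
    qed
    then show "f = f'" using \<Phi>(1)[OF f] \<Phi>(1)[OF f'] unfolding D_def by (intro PiE_ext) auto
  qed
  have "?P \<noteq> A"
  proof
    assume "?P = A"
    then have "A \<subseteq> {\<one>} <#> ?P" unfolding set_mult_def by force
    then show False using trivial_of_supplement[OF torsion_free p1] nontrivial by simp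
  qed
  then have "card (Y ` \<Phi>) < card S ^ d"
  proof (intro complement_count[OF normal pows_normal pows_subset _ S])
    show "finite (Y ` \<Phi>)" using finD by (simp add: \<Phi>_def)
    show "subgroup X G \<and> X \<inter> A = ?P \<and> X <#> A = carrier G" if "X \<in> Y ` \<Phi>" for X
      using that sY YA YG by blast
  qed (auto intro: finite_quotients)
  then show False using s1(2) card_image[OF injY] by (simp add: \<Phi>_def)
qed

text \<open>If no tuple worked, the constant-relator lemma and the two-directions lemma would yield
  exactly the two hypotheses of \<open>one_direction_impossible\<close>.\<close>

theorem lifted_generators:
  "\<exists>b\<in>tuples. generate G ((\<lambda>i. g i \<otimes> b i) ` {..<k}) = carrier G"
proof -
  have "\<exists>b\<in>tuples. A \<subseteq> (\<lambda>\<tau>. \<tau> b) ` relators"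
    using generators_if_constant_relator generators_if_two_directions one_direction_impossible
    by blast
  then show ?thesis using generate_eq_carrier by blast
qed

end

section \<open>Reduction to the rationally irreducible case\<close>

definition noetherian_group :: "('a, 'b) monoid_scheme \<Rightarrow> bool"
  where "noetherian_group G \<longleftrightarrow>
    (\<forall>S. subgroup S G \<longrightarrow> (\<exists>Y. finite Y \<and> Y \<subseteq> S \<and> generate G Y = S))"

text \<open>All terms are normal in the whole group, so that the last nontrivial one is an abelian
  normal subgroup of \<open>G\<close>. In this form the property passes to quotients by
  \<open>chain_image\<close>.\<close>

definition virtually_soluble_chain :: "('a, 'b) monoid_scheme \<Rightarrow> (nat \<Rightarrow> 'a set) \<Rightarrow> nat \<Rightarrow> bool"
  where "virtually_soluble_chain G D n \<longleftrightarrow>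
    (\<forall>i. D i \<lhd> G) \<and> finite (rcosets\<^bsub>G\<^esub> (D 0)) \<and> D n = {\<one>\<^bsub>G\<^esub>} \<and>
    (\<forall>i. \<forall>x\<in>D i. \<forall>y\<in>D i. x \<otimes>\<^bsub>G\<^esub> y \<otimes>\<^bsub>G\<^esub> inv\<^bsub>G\<^esub> x \<otimes>\<^bsub>G\<^esub> inv\<^bsub>G\<^esub> y \<in> D (Suc i))"

lemma card_image_le_of_factor:
  assumes "finite (f ` X)" "\<And>x y. x \<in> X \<Longrightarrow> y \<in> X \<Longrightarrow> f x = f y \<Longrightarrow> g x = g y"
  shows "card (g ` X) \<le> card (f ` X)"
proof -
  have "g x = g (inv_into X f (f x))" if "x \<in> X" for x
    using that assms(2)[of x "inv_into X f (f x)"] by (simp add: f_inv_into_f inv_into_into)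
  then have "g ` X \<subseteq> (\<lambda>z. g (inv_into X f z)) ` (f ` X)" by auto
  then show ?thesis by (rule surj_card_le[OF assms(1)])
qed

lemma (in abelian_normal) subgroup_abelian_normal:
  assumes "B \<lhd> G" "B \<subseteq> A" shows "abelian_normal G B"
  using assms comm by (intro abelian_normal.intro abelian_normal_axioms.intro group_axioms) blast+

lemma (in abelian_normal) fg_abelian_normal_exists:
  assumes "noetherian_group G"
  shows "\<exists>a r. fg_abelian_normal G A a r"
proof -
  obtain Y where Y: "finite Y" "generate G Y = A"
    using assms A.subgroup_axioms unfolding noetherian_group_def by blast
  obtain r :: nat and a where "Y = a ` {i. i < r}"
    using finite_imp_nat_seg_image_inj_on[OF Y(1)] by metis
  then have "generate G (a ` {..<r}) = A" using Y(2) by (simp add: lessThan_def)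
  then have "fg_abelian_normal G A a r" by unfold_locales
  then show ?thesis by blast
qed

context fg_abelian_normal begin

text \<open>
  The number \<open>|A / A\<^sup>2|\<close> is \<open>2\<close> to the rank of \<open>A\<close>, so minimising it over the nontrivial normal
  subgroups of \<open>G\<close> inside a torsion-free group gives a rationally irreducible one.
\<close>

lemma irreducible_of_minimal:
  assumes min: "\<And>B. B \<lhd> G \<Longrightarrow> B \<subseteq> A \<Longrightarrow> B \<noteq> {\<one>} \<Longrightarrow>
      card ((\<lambda>x. pows 2 #> x) ` A) \<le> card ((\<lambda>x. abelian_normal.pows G B 2 #> x) ` B)"
    and B: "B \<lhd> G" "B \<subseteq> A" "B \<noteq> {\<one>}"
  shows "\<exists>m>0. pows m \<subseteq> B"
proof -
  interpret B: normal B G by fact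
  \<comment> \<open>\<open>C\<close> is the isolator of \<open>B\<close> in \<open>A\<close>. It has
    the same rank as \<open>B\<close> and satisfies \<open>C \<inter> A^2 = C^2\<close>, so
    \<open>C/C^2\<close> embeds in \<open>A/A^2\<close>.\<close>
  define C where "C = {x \<in> A. \<exists>m>0. x [^] (m::int) \<in> B}"
  have CI: "x \<in> C" if "x \<in> A" "x [^] (m::int) \<in> B" "m \<noteq> 0" for x m
  proof (cases "m > 0")
    case False
    have "x [^] (- m) \<in> B" using that by (simp add: int_pow_neg)
    then show ?thesis using that False by (auto simp: C_def intro!: exI[of _ "- m"])
  qed (use that in \<open>auto simp: C_def\<close>)
  have "subgroup C G"
  proof (rule subgroupI)
    show "C \<subseteq> carrier G" using A.subset by (auto simp: C_def)
    have "\<one> \<in> C" by (rule CI[of _ 1]) auto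
    then show "C \<noteq> {}" by blast
  next
    fix x assume "x \<in> C"
    then obtain m :: int where "m > 0" "x [^] m \<in> B" "x \<in> A" by (auto simp: C_def)
    then show "inv x \<in> C" by (intro CI[of _ m]) (auto simp: int_pow_inv)
  next
    fix x y assume "x \<in> C" "y \<in> C"
    then obtain m n :: int where mn: "m > 0" "x [^] m \<in> B" "x \<in> A" "n > 0" "y [^] n \<in> B" "y \<in> A"
      by (auto simp: C_def)
    have "(x \<otimes> y) [^] (m * n) = (x [^] m) [^] n \<otimes> (y [^] n) [^] m"
      using mn by (simp add: pow_mult int_pow_pow mult.commute)
    moreover have "(x [^] m) [^] n \<in> B" "(y [^] n) [^] m \<in> B"
      using subgroup_int_pow_closed[OF B.subgroup_axioms] mn by blast+
    ultimately have "(x \<otimes> y) [^] (m * n) \<in> B" by simp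
    then show "x \<otimes> y \<in> C" using mn by (intro CI[of _ "m * n"]) auto
  qed
  moreover have "g \<otimes> x \<otimes> inv g \<in> C" if g: "g \<in> carrier G" and x: "x \<in> C" for g x
  proof -
    obtain m :: int where m: "m > 0" "x [^] m \<in> B" "x \<in> A" using x by (auto simp: C_def)
    have "(g \<otimes> x \<otimes> inv g) [^] m \<in> B"
      using conj_pow[OF g, of x m] m B.inv_op_closed2[OF g m(2)] by simp
    then show ?thesis using m conj_closed[OF g m(3)] by (intro CI) auto
  qed
  ultimately have C: "C \<lhd> G" by (auto simp: normal_inv_iff)
  have CA: "C \<subseteq> A" by (auto simp: C_def)
  have "x \<in> C" if "x \<in> B" for x by (rule CI[of _ 1]) (use that B in auto)
  then have "C \<noteq> {\<one>}" using B(3) B.one_closed by blast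
  interpret C: abelian_normal G C by (rule subgroup_abelian_normal[OF C CA])
  interpret P: normal "pows 2" G by (rule pows_normal)
  interpret PC: normal "C.pows 2" G by (rule C.pows_normal)
  have rcos_eq: "N #> x = N #> y \<longleftrightarrow> x \<otimes> inv y \<in> N"
    if "subgroup N G" "x \<in> carrier G" "y \<in> carrier G" for N x y
    using that subgroup.rcos_module[OF that(1) group_axioms that(3,2)]
      repr_independence[OF _ that(3,1)] rcos_self[OF that(2,1)] by metis
  have fin: "finite ((\<lambda>x. pows 2 #> x) ` A)"
  proof -
    obtain S where S: "transversal G S A (pows 2)" using pows_transversal[of 2] by auto
    have "(\<lambda>x. pows 2 #> x) ` A \<subseteq> (\<lambda>x. pows 2 #> x) ` S"
    proof
      fix X assume "X \<in> (\<lambda>x. pows 2 #> x) ` A"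
      then obtain x where x: "x \<in> A" "X = pows 2 #> x" by auto
      obtain s where s: "s \<in> S" "s \<in> A" "inv s \<otimes> x \<in> pows 2" using transversalD[OF S x(1)] by blast
      have "x \<otimes> inv s \<in> pows 2" using s x by (simp add: comm)
      then have "pows 2 #> x = pows 2 #> s" using rcos_eq[OF P.subgroup_axioms, of x s] s x by simp
      then show "X \<in> (\<lambda>x. pows 2 #> x) ` S" using s(1) x(2) by blast
    qed
    then show ?thesis using S finite_surj by (auto simp: transversal_def)
  qed
  have "card ((\<lambda>x. C.pows 2 #> x) ` C) \<le> card ((\<lambda>x. pows 2 #> x) ` C)"
  proof (rule card_image_le_of_factor)
    show "finite ((\<lambda>x. pows 2 #> x) ` C)" using fin CA by (meson finite_subset image_mono)
    fix x y assume x: "x \<in> C" and y: "y \<in> C" and "pows 2 #> x = pows 2 #> y"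
    then have "x \<otimes> inv y \<in> pows 2" using rcos_eq[OF P.subgroup_axioms] by simp
    then obtain z where z: "z \<in> A" "x \<otimes> inv y = z [^] (2::int)" by (auto simp: pows_def)
    have "x \<otimes> inv y \<in> C" using x y by simp
    then obtain m :: int where m: "m > 0" "(x \<otimes> inv y) [^] m \<in> B" by (auto simp: C_def)
    have "z [^] (2 * m) \<in> B" using m(2) z by (simp add: int_pow_pow)
    then have "z \<in> C" using m(1) z(1) by (intro CI) auto
    then have "x \<otimes> inv y \<in> C.pows 2" using z(2) by (auto simp: C.pows_def)
    then show "C.pows 2 #> x = C.pows 2 #> y" using rcos_eq[OF PC.subgroup_axioms] x y by simp
  qed
  then have "card ((\<lambda>x. pows 2 #> x) ` A) \<le> card ((\<lambda>x. pows 2 #> x) ` C)"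
    using min[OF C CA \<open>C \<noteq> {\<one>}\<close>] by simp
  \<comment> \<open>By minimality \<open>C/C^2\<close> is at least as large as \<open>A/A^2\<close>,
    so its image is everything and \<open>A = C A^2\<close>. Nakayama for \<open>p = 2\<close> then
    yields an odd, hence nonzero, exponent \<open>l\<close> with \<open>A^l\<close> inside
    \<open>C\<close>.\<close>
  then have eq: "(\<lambda>x. pows 2 #> x) ` C = (\<lambda>x. pows 2 #> x) ` A"
    by (intro card_seteq[OF fin]) (use CA in auto)
  have "A \<subseteq> C <#> pows 2"
  proof
    fix x assume x: "x \<in> A"
    then obtain y where y: "y \<in> C" "pows 2 #> x = pows 2 #> y" using eq by blast
    then have "x \<otimes> inv y \<in> pows 2" using x rcos_eq[OF P.subgroup_axioms] by simp
    moreover have "x = y \<otimes> (x \<otimes> inv y)" using x y CA comm[of y "x \<otimes> inv y"]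
      by (auto simp: m_assoc)
    ultimately show "x \<in> C <#> pows 2" using y(1) unfolding set_mult_def by blast
  qed
  then obtain l where l: "[l = 1] (mod 2)" "pows l \<subseteq> C"
    using pow_mem_of_supplement[OF C.A.subgroup_axioms] by blast
  have l0: "l \<noteq> 0" using l(1) by (auto simp: cong_def)
  have "\<exists>m>0. x [^] (m::int) \<in> B" if x: "x \<in> A" for x
  proof -
    have "x [^] l \<in> C" using l(2) x by (auto simp: pows_def)
    then obtain m :: int where m: "m > 0" "(x [^] l) [^] m \<in> B" by (auto simp: C_def)
    then have "x [^] (l * m) \<in> B" using x by (simp add: int_pow_pow)
    then have "x \<in> C" using x l0 m(1) by (intro CI[of x "l * m"]) auto
    then show ?thesis by (simp add: C_def)
  qed
  then have "\<forall>i. \<exists>m::int. i < r \<longrightarrow> m > 0 \<and> a i [^] m \<in> B" using a_closed by blast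
  from choice[OF this] obtain m :: "nat \<Rightarrow> int"
    where m: "\<And>i. i < r \<Longrightarrow> m i > 0" "\<And>i. i < r \<Longrightarrow> a i [^] m i \<in> B" by blast
  have "a j [^] (\<Prod>i<r. m i) \<in> B" if j: "j < r" for j
  proof -
    have "(\<Prod>i<r. m i) = m j * (\<Prod>i\<in>{..<r} - {j}. m i)" using j by (simp add: prod.remove)
    then have "a j [^] (\<Prod>i<r. m i) = (a j [^] m j) [^] (\<Prod>i\<in>{..<r} - {j}. m i)"
      using a_closed[OF j] by (simp add: int_pow_pow)
    then show ?thesis using subgroup_int_pow_closed[OF B.subgroup_axioms m(2)[OF j]] by simp
  qed
  then have "pows (\<Prod>i<r. m i) \<subseteq> B" by (rule pows_subset_of_gens[OF B.subgroup_axioms])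
  moreover have "(\<Prod>i<r. m i) > 0" using m(1) by (intro prod_pos) auto
  ultimately show ?thesis by blast
qed

end

context group begin

lemma generated_mod_trivial:
  "generated_mod G k {\<one>} \<longleftrightarrow> generated_mod G k {}"
proof -
  have "generate G (Y \<union> {\<one>}) = generate G Y" if Y: "Y \<subseteq> carrier G" for Y
  proof -
    have "generate G Y <#> {\<one>} = generate G Y"
      using generate_incl[OF Y] unfolding set_mult_def by force
    then show ?thesis using generate_Un_normal[OF Y one_is_normal] by simp
  qed
  then have "(Y \<subseteq> carrier G \<and> generate G (Y \<union> {\<one>}) = carrier G) \<longleftrightarrow>
      (Y \<subseteq> carrier G \<and> generate G (Y \<union> {}) = carrier G)" for Y
    by auto
  then show ?thesis unfolding generated_mod_def by (simp only:)
qed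

lemma generated_of_proper_quotients:
  assumes noeth: "noetherian_group G" and chain: "virtually_soluble_chain G D n"
    and fin_quot: "\<And>N. N \<in> fin_index_normal G \<Longrightarrow> generated_mod G d N"
    and proper: "\<And>M. M \<lhd> G \<Longrightarrow> M \<noteq> {\<one>} \<Longrightarrow> generated_mod G (Suc d) M"
  shows "generated_mod G (Suc d) {}"
proof (cases "D 0 = {\<one>}")
  case True
  \<comment> \<open>A trivial subgroup of finite index means that \<open>G\<close> is finite and
    counts among its own finite quotients.\<close>
  then have "{\<one>} \<in> fin_index_normal G"
    using chain one_is_normal by (simp add: fin_index_normal_def FactGroup_def virtually_soluble_chain_def)
  then have "generated_mod G (Suc d) {\<one>}"
    by (intro generated_mod_mono[OF is_group _ fin_quot]) auto
  then show ?thesis by (simp add: generated_mod_trivial)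
next
  case False
  have D: "\<And>i. D i \<lhd> G" "D n = {\<one>}"
    "\<And>i x y. x \<in> D i \<Longrightarrow> y \<in> D i \<Longrightarrow> x \<otimes> y \<otimes> inv x \<otimes> inv y \<in> D (Suc i)"
    using chain unfolding virtually_soluble_chain_def by blast+
  obtain i where i: "D i \<noteq> {\<one>}" "D (Suc i) = {\<one>}"
    using False D(2) ex_least_nat_less[of "\<lambda>i. D i = {\<one>}" n] by blast
  interpret A0: abelian_normal G "D i"
  proof (intro abelian_normal.intro abelian_normal_axioms.intro group_axioms D(1))
    interpret normal "D i" G by (rule D(1))
    fix x y assume xy: "x \<in> D i" "y \<in> D i"
    have "x \<otimes> y \<otimes> inv x \<otimes> inv y = \<one>" using D(3)[OF xy] i(2) by simp
    then have "x \<otimes> y \<otimes> inv x \<otimes> inv y \<otimes> (y \<otimes> x) = y \<otimes> x" using xy by simp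
    then show "x \<otimes> y = y \<otimes> x" using xy by (simp add: free_simps)
  qed
  have gens: "\<exists>g. (\<forall>i<Suc d. g i \<in> carrier G) \<and> generate G (g ` {..<Suc d} \<union> M) = carrier G"
    if "M \<lhd> G" "M \<noteq> {\<one>}" for M
    using proper[OF that] unfolding generated_mod_def by (auto simp: image_subset_iff)
  show ?thesis
  proof (cases "\<exists>x\<in>D i. \<exists>m::int. x \<noteq> \<one> \<and> m \<noteq> 0 \<and> x [^] m = \<one>")
    case True
    then obtain x m where x: "x \<in> D i" "x \<noteq> \<one>" "m \<noteq> 0" "x [^] (m::int) = \<one>" by blast
    \<comment> \<open>\<open>P\<close> is finitely generated and abelian of finite exponent, hence
      finite; this appears below as a transversal for \<open>P^|m| = {\<one>}\<close>, so the
      lifting can go down to the trivial subgroup.\<close>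
    define P where "P = {x \<in> D i. x [^] m = \<one>}"
    have "subgroup P G"
      by (rule subgroupI) (use A0.A.subset in \<open>auto simp: P_def int_pow_inv A0.pow_mult intro: exI[of _ \<one>]\<close>)
    moreover have "g \<otimes> y \<otimes> inv g \<in> P" if "g \<in> carrier G" "y \<in> P" for g y
      using that A0.conj_pow[OF that(1), of y m] A0.conj_closed[OF that(1), of y] by (auto simp: P_def)
    ultimately have P: "P \<lhd> G" by (auto simp: normal_inv_iff)
    have PD: "P \<subseteq> D i" and Pne: "P \<noteq> {\<one>}" using x by (auto simp: P_def)
    interpret P: abelian_normal G P by (rule A0.subgroup_abelian_normal[OF P PD])
    obtain a r where ar: "fg_abelian_normal G P a r" using P.fg_abelian_normal_exists[OF noeth] by blast
    interpret P: fg_abelian_normal G P a r by (rule ar)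
    have "x [^] \<bar>m\<bar> = \<one>" if "x \<in> P" for x
      using that by (cases "m < 0") (auto simp: P_def int_pow_neg)
    moreover have "P \<noteq> {}" using P.A.one_closed by blast
    ultimately have "P.pows \<bar>m\<bar> = {\<one>}" unfolding P.pows_def by auto
    then obtain S where S: "transversal G S P {\<one>}" using P.pows_transversal[of "\<bar>m\<bar>"] x(3) by auto
    obtain g where g: "\<forall>i<Suc d. g i \<in> carrier G" "generate G (g ` {..<Suc d} \<union> P) = carrier G"
      using gens[OF P Pne] by blast
    have fq: "generated_mod G (Suc d) N" if N: "N \<in> fin_index_normal G" for N
      using generated_mod_mono[OF is_group _ fin_quot[OF N], of "Suc d"] N
        normal_imp_subgroup[of N G] subgroup.subset[of N G] by (auto simp: fin_index_normal_def)
    have gc: "g ` {..<Suc d} \<subseteq> carrier G" using g(1) by auto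
    have "{\<one>} \<subseteq> P" using P.A.one_closed by simp
    from lift_generators[OF P P.comm one_is_normal this S gc g(2) fq]
    obtain b where b: "\<forall>i. b i \<in> P"
      "generate G ((\<lambda>i. g i \<otimes> b i) ` {..<Suc d} \<union> {\<one>}) = carrier G" by blast
    then have "generated_mod G (Suc d) {\<one>}"
      unfolding generated_mod_def using g(1) by (intro exI[of _ "\<lambda>i. g i \<otimes> b i"]) auto
    then show ?thesis by (simp add: generated_mod_trivial)
  next
    case False
    define Q where "Q A \<longleftrightarrow> A \<lhd> G \<and> A \<subseteq> D i \<and> A \<noteq> {\<one>}" for A
    have "Q (D i)" using D(1) i(1) by (simp add: Q_def)
    then obtain A where QA: "Q A" and min: "\<And>B. Q B \<Longrightarrow>
        card ((\<lambda>x. abelian_normal.pows G A 2 #> x) ` A) \<le> card ((\<lambda>x. abelian_normal.pows G B 2 #> x) ` B)"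
      using ex_has_least_nat[of Q "D i" "\<lambda>A. card ((\<lambda>x. abelian_normal.pows G A 2 #> x) ` A)"] by blast
    have A: "A \<lhd> G" "A \<subseteq> D i" "A \<noteq> {\<one>}" using QA by (auto simp: Q_def)
    interpret A: abelian_normal G A by (rule A0.subgroup_abelian_normal[OF A(1,2)])
    obtain a r where ar: "fg_abelian_normal G A a r" using A.fg_abelian_normal_exists[OF noeth] by blast
    interpret A: fg_abelian_normal G A a r by (rule ar)
    obtain g where g: "\<forall>i<Suc d. g i \<in> carrier G" "generate G (g ` {..<Suc d} \<union> A) = carrier G"
      using gens[OF A(1,3)] by blast
    interpret A: irreducible_lifting G A a r g "Suc d" d
    proof unfold_locales
      show "\<exists>m>0. A.pows m \<subseteq> B" if "B \<lhd> G" "B \<subseteq> A" "B \<noteq> {\<one>}" for B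
      proof (rule A.irreducible_of_minimal[OF _ that])
        fix C assume "C \<lhd> G" "C \<subseteq> A" "C \<noteq> {\<one>}"
        then have "Q C" using A(2) by (auto simp: Q_def)
        then show "card ((\<lambda>x. A.pows 2 #> x) ` A) \<le> card ((\<lambda>x. abelian_normal.pows G C 2 #> x) ` C)"
          by (rule min)
      qed
      show "x = \<one>" if "x \<in> A" "x [^] (m::int) = \<one>" "m \<noteq> 0" for x m
        using False that A(2) by blast
    qed (use g A(3) fin_quot in auto)
    obtain b where "b \<in> A.tuples" "generate G ((\<lambda>i. g i \<otimes> b i) ` {..<Suc d}) = carrier G"
      using A.lifted_generators by blast
    moreover have "(\<lambda>i. g i \<otimes> b i) ` {..<Suc d} \<subseteq> carrier G"
      using A.tuplesD[OF calculation(1)] g(1) by auto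
    ultimately show ?thesis unfolding generated_mod_def by (intro exI[of _ "\<lambda>i. g i \<otimes> b i"]) simp
  qed
qed

end

section \<open>Transfer along surjective homomorphisms\<close>

locale surjective_group_hom = group_hom +
  assumes surj: "h ` carrier G = carrier H"
begin

definition preimage :: "'c set \<Rightarrow> 'a set"
  where "preimage N = {x \<in> carrier G. h x \<in> N}"

lemma preimage_subgroup:
  assumes "subgroup N H" shows "subgroup (preimage N) G"
proof -
  interpret N: subgroup N H by fact
  have "\<one>\<^bsub>G\<^esub> \<in> preimage N" by (simp add: preimage_def)
  then show ?thesis by (intro G.subgroupI) (auto simp: preimage_def)
qed

lemma preimage_normal: "N \<lhd> H \<Longrightarrow> preimage N \<lhd> G"
  using preimage_subgroup[OF normal_imp_subgroup]
  by (auto simp: G.normal_inv_iff preimage_def normal.inv_op_closed2)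

lemma image_preimage: "N \<subseteq> carrier H \<Longrightarrow> h ` preimage N = N"
  using surj by (auto simp: preimage_def)

lemma preimage_fin_index:
  assumes "N \<in> fin_index_normal H" shows "preimage N \<in> fin_index_normal G"
proof -
  have N: "N \<lhd> H" and fin: "finite (rcosets\<^bsub>H\<^esub> N)"
    using assms by (auto simp: fin_index_normal_def FactGroup_def)
  interpret N: normal N H by (rule N)
  interpret P: normal "preimage N" G by (rule preimage_normal[OF N])
  have "preimage N #>\<^bsub>G\<^esub> x = {y \<in> carrier G. h y \<in> N #>\<^bsub>H\<^esub> h x}" if x: "x \<in> carrier G" for x
  proof -
    have "y \<in> preimage N #>\<^bsub>G\<^esub> x \<longleftrightarrow> h y \<in> N #>\<^bsub>H\<^esub> h x" if y: "y \<in> carrier G" for y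
    proof -
      have "y \<in> preimage N #>\<^bsub>G\<^esub> x \<longleftrightarrow> y \<otimes>\<^bsub>G\<^esub> inv\<^bsub>G\<^esub> x \<in> preimage N"
        by (rule P.rcos_module[OF G.group_axioms x y])
      also have "\<dots> \<longleftrightarrow> h y \<otimes>\<^bsub>H\<^esub> inv\<^bsub>H\<^esub> h x \<in> N"
        unfolding preimage_def using x y by simp
      also have "\<dots> \<longleftrightarrow> h y \<in> N #>\<^bsub>H\<^esub> h x"
        by (rule N.rcos_module[OF H.group_axioms, symmetric]) (use x y in auto)
      finally show ?thesis .
    qed
    moreover have "preimage N #>\<^bsub>G\<^esub> x \<subseteq> carrier G" using x P.subset G.r_coset_subset_G by blast
    ultimately show ?thesis by blast
  qed
  moreover have "N #>\<^bsub>H\<^esub> h x \<in> rcosets\<^bsub>H\<^esub> N" if "x \<in> carrier G" for x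
    using that by (intro H.rcosetsI N.subset) auto
  ultimately have "rcosets\<^bsub>G\<^esub> (preimage N) \<subseteq> (\<lambda>C. {y \<in> carrier G. h y \<in> C}) ` (rcosets\<^bsub>H\<^esub> N)"
    unfolding RCOSETS_def[of G] by blast
  then have "finite (rcosets\<^bsub>G\<^esub> (preimage N))" using fin finite_surj by blast
  then show ?thesis using preimage_normal[OF N] by (simp add: fin_index_normal_def FactGroup_def)
qed

lemma generated_mod_image:
  assumes "N \<lhd> H" "generated_mod G k (preimage N)"
  shows "generated_mod H k N"
proof -
  obtain f where f: "f ` {..<k} \<subseteq> carrier G" "generate G (f ` {..<k} \<union> preimage N) = carrier G"
    using assms(2) by (auto simp: generated_mod_def)
  have Nc: "N \<subseteq> carrier H" using assms(1) normal_imp_subgroup subgroup.subset by blast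
  have "generate H (h ` (f ` {..<k} \<union> preimage N)) = carrier H"
    using f surj by (subst generate_img) (auto simp: preimage_def)
  then have "generate H ((h \<circ> f) ` {..<k} \<union> N) = carrier H"
    using image_preimage[OF Nc] by (simp add: image_Un image_comp)
  then show ?thesis unfolding generated_mod_def using f(1) by (intro exI[of _ "h \<circ> f"]) auto
qed

lemma generated_mod_preimage:
  assumes "N \<lhd> H" "generated_mod H k N"
  shows "generated_mod G k (preimage N)"
proof -
  obtain f where f: "f ` {..<k} \<subseteq> carrier H" "generate H (f ` {..<k} \<union> N) = carrier H"
    using assms(2) by (auto simp: generated_mod_def)
  have Nc: "N \<subseteq> carrier H" using assms(1) normal_imp_subgroup subgroup.subset by blast
  define e where "e i = inv_into (carrier G) h (f i)" for i
  have e: "e i \<in> carrier G" "h (e i) = f i" if "i < k" for i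
    using that f(1) surj by (auto simp: e_def inv_into_into f_inv_into_f)
  let ?Y = "e ` {..<k} \<union> preimage N"
  have Y: "?Y \<subseteq> carrier G" using e by (auto simp: preimage_def)
  have "(h \<circ> e) ` {..<k} = f ` {..<k}" using e by (intro image_cong) auto
  then have "h ` ?Y = f ` {..<k} \<union> N" using image_preimage[OF Nc] by (simp add: image_Un image_comp)
  then have img: "h ` generate G ?Y = carrier H" using generate_img[OF Y] f(2) by simp
  have "carrier G \<subseteq> generate G ?Y"
  proof
    fix x assume x: "x \<in> carrier G"
    then obtain y where y: "y \<in> generate G ?Y" "h x = h y" using img by (metis hom_closed imageE)
    have yc: "y \<in> carrier G" using y(1) Y G.generate_in_carrier by blast
    have "h (x \<otimes>\<^bsub>G\<^esub> inv\<^bsub>G\<^esub> y) = \<one>\<^bsub>H\<^esub>" using x yc y(2) by simp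
    then have "x \<otimes>\<^bsub>G\<^esub> inv\<^bsub>G\<^esub> y \<in> preimage N"
      using x yc subgroup.one_closed[OF normal_imp_subgroup[OF assms(1)]] by (simp add: preimage_def)
    then have "x \<otimes>\<^bsub>G\<^esub> inv\<^bsub>G\<^esub> y \<in> generate G ?Y" by (intro generate.incl) simp
    from generate.eng[OF this y(1)]
    have "(x \<otimes>\<^bsub>G\<^esub> inv\<^bsub>G\<^esub> y) \<otimes>\<^bsub>G\<^esub> y \<in> generate G ?Y" .
    then show "x \<in> generate G ?Y" using x yc by (simp add: G.m_assoc)
  qed
  then have "generate G ?Y = carrier G" using G.generate_incl[OF Y] by blast
  then show ?thesis unfolding generated_mod_def using e(1) by blast
qed

lemma noetherian_image:
  assumes "noetherian_group G" shows "noetherian_group H"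
  unfolding noetherian_group_def
proof (intro allI impI)
  fix S assume S: "subgroup S H"
  obtain Y where Y: "finite Y" "Y \<subseteq> preimage S" "generate G Y = preimage S"
    using assms preimage_subgroup[OF S] unfolding noetherian_group_def by blast
  have "generate H (h ` Y) = h ` preimage S"
    using generate_img[of Y] Y by (auto simp: preimage_def)
  then show "\<exists>Y. finite Y \<and> Y \<subseteq> S \<and> generate H Y = S"
    using Y image_preimage[OF subgroup.subset[OF S]] by (intro exI[of _ "h ` Y"]) auto
qed

lemma chain_image:
  assumes "virtually_soluble_chain G D n" shows "virtually_soluble_chain H (\<lambda>i. h ` D i) n"
proof -
  have D: "\<And>i. D i \<lhd> G" "finite (rcosets\<^bsub>G\<^esub> (D 0))" "D n = {\<one>\<^bsub>G\<^esub>}"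
    "\<And>i x y. x \<in> D i \<Longrightarrow> y \<in> D i \<Longrightarrow> x \<otimes>\<^bsub>G\<^esub> y \<otimes>\<^bsub>G\<^esub> inv\<^bsub>G\<^esub> x \<otimes>\<^bsub>G\<^esub> inv\<^bsub>G\<^esub> y \<in> D (Suc i)"
    using assms unfolding virtually_soluble_chain_def by blast+
  have Dc: "D i \<subseteq> carrier G" for i using D(1) normal_imp_subgroup subgroup.subset by blast
  have "h ` D i \<lhd> H" for i
    by (rule normal.surj_hom_normal_subgroup[OF D(1) group_hom_axioms surj])
  moreover have "finite (rcosets\<^bsub>H\<^esub> (h ` D 0))"
  proof -
    have "h ` D 0 #>\<^bsub>H\<^esub> h x = h ` (D 0 #>\<^bsub>G\<^esub> x)" if "x \<in> carrier G" for x
      using that Dc[of 0] by (force simp: r_coset_def)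
    then have "rcosets\<^bsub>H\<^esub> (h ` D 0) \<subseteq> (\<lambda>C. h ` C) ` (rcosets\<^bsub>G\<^esub> (D 0))"
      unfolding RCOSETS_def surj[symmetric] by auto
    then show ?thesis using D(2) finite_surj by blast
  qed
  moreover have "h x \<otimes>\<^bsub>H\<^esub> h y \<otimes>\<^bsub>H\<^esub> inv\<^bsub>H\<^esub> h x \<otimes>\<^bsub>H\<^esub> inv\<^bsub>H\<^esub> h y \<in> h ` D (Suc i)"
    if "x \<in> D i" "y \<in> D i" for x y i
  proof -
    have "x \<in> carrier G" "y \<in> carrier G" using that Dc by blast+
    then have "h x \<otimes>\<^bsub>H\<^esub> h y \<otimes>\<^bsub>H\<^esub> inv\<^bsub>H\<^esub> h x \<otimes>\<^bsub>H\<^esub> inv\<^bsub>H\<^esub> h y =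
        h (x \<otimes>\<^bsub>G\<^esub> y \<otimes>\<^bsub>G\<^esub> inv\<^bsub>G\<^esub> x \<otimes>\<^bsub>G\<^esub> inv\<^bsub>G\<^esub> y)" by simp
    then show ?thesis using D(4)[OF that] by blast
  qed
  ultimately show ?thesis using D(3) by (simp add: virtually_soluble_chain_def)
qed

end

theorem (in group) generated_by_Suc:
  assumes noeth: "noetherian_group G" and chain: "virtually_soluble_chain G D n"
    and fin_quot: "\<And>N. N \<in> fin_index_normal G \<Longrightarrow> generated_mod G d N"
  shows "generated_mod G (Suc d) {}"
proof (rule ccontr)
  assume neg: "\<not> ?thesis"
  define Bad where "Bad = {N. N \<lhd> G \<and> \<not> generated_mod G (Suc d) N}"
  have "{\<one>} \<in> Bad" using neg one_is_normal by (simp add: Bad_def generated_mod_trivial)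
  then have "Bad \<noteq> {}" by blast
  moreover have "\<Union>CC \<in> Bad" if CC: "CC \<noteq> {}" "subset.chain Bad CC" for CC
  proof -
    have Bad: "N \<lhd> G" "\<not> generated_mod G (Suc d) N" if "N \<in> CC" for N
      using that CC(2) by (auto simp: subset.chain_def Bad_def)
    have sub: "N \<subseteq> carrier G" if "N \<in> CC" for N
      using Bad(1)[OF that] normal_imp_subgroup subgroup.subset by blast
    have "subgroup (\<Union>CC) G"
    proof (rule subgroupI)
      show "\<Union>CC \<subseteq> carrier G" using sub by blast
      obtain N where N: "N \<in> CC" using CC(1) by blast
      then have "\<one> \<in> N" using Bad(1) normal_imp_subgroup subgroup.one_closed by blast
      then show "\<Union>CC \<noteq> {}" using N by blast
    next
      fix x assume "x \<in> \<Union>CC"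
      then obtain N where N: "N \<in> CC" "x \<in> N" by blast
      then show "inv x \<in> \<Union>CC"
        using subgroup.m_inv_closed[OF normal_imp_subgroup[OF Bad(1)[OF N(1)]]] by blast
    next
      fix x y assume "x \<in> \<Union>CC" "y \<in> \<Union>CC"
      then have "finite {x, y}" "{x, y} \<subseteq> \<Union>CC" by auto
      from finite_subset_Union_chain[OF this CC] obtain N where N: "N \<in> CC" "{x, y} \<subseteq> N" by blast
      then have "x \<otimes> y \<in> N"
        using subgroup.m_closed[OF normal_imp_subgroup[OF Bad(1)[OF N(1)]]] by blast
      then show "x \<otimes> y \<in> \<Union>CC" using N by blast
    qed
    moreover have "g \<otimes> x \<otimes> inv g \<in> \<Union>CC" if "g \<in> carrier G" "x \<in> \<Union>CC" for g x
      using that Bad(1) normal_conj(1) by blast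
    ultimately have U: "\<Union>CC \<lhd> G" by (auto simp: normal_inv_iff)
    have "\<not> generated_mod G (Suc d) (\<Union>CC)"
    proof
      assume "generated_mod G (Suc d) (\<Union>CC)"
      then obtain f where f: "f ` {..<Suc d} \<subseteq> carrier G"
        "generate G (f ` {..<Suc d} \<union> \<Union>CC) = carrier G" by (auto simp: generated_mod_def)
      obtain Y where Y: "finite Y" "Y \<subseteq> carrier G" "generate G Y = carrier G"
        using noeth subgroup_self unfolding noetherian_group_def by blast
      \<comment> \<open>This makes unions of chains stay bad: each of the finitely many generators
        of \<open>G\<close> uses one element of the union, and all these elements lie in a single
        member of the chain.\<close>
      have "\<exists>u c. u \<in> generate G (f ` {..<Suc d}) \<and> c \<in> \<Union>CC \<and> y = u \<otimes> c" if "y \<in> Y" for y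
        using that Y(2) f(2) generate_Un_normal[OF f(1) U] unfolding set_mult_def by blast
      then obtain u c where uc: "\<And>y. y \<in> Y \<Longrightarrow> u y \<in> generate G (f ` {..<Suc d})"
        "\<And>y. y \<in> Y \<Longrightarrow> c y \<in> \<Union>CC" "\<And>y. y \<in> Y \<Longrightarrow> y = u y \<otimes> c y" by metis
      have "finite (c ` Y)" "c ` Y \<subseteq> \<Union>CC" using Y(1) uc(2) by auto
      from finite_subset_Union_chain[OF this CC] obtain N where N: "N \<in> CC" "c ` Y \<subseteq> N" by blast
      have sX: "subgroup (generate G (f ` {..<Suc d} \<union> N)) G"
        by (rule generate_is_subgroup) (use f(1) sub[OF N(1)] in blast)
      have "y \<in> generate G (f ` {..<Suc d}) <#> N" if y: "y \<in> Y" for y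
      proof -
        have "c y \<in> N" using N(2) y by blast
        then have "u y \<otimes> c y \<in> generate G (f ` {..<Suc d}) <#> N"
          using uc(1)[OF y] unfolding set_mult_def by blast
        then show ?thesis using uc(3)[OF y] by simp
      qed
      then have "Y \<subseteq> generate G (f ` {..<Suc d}) <#> N" by blast
      then have "Y \<subseteq> generate G (f ` {..<Suc d} \<union> N)"
        using generate_Un_normal[OF f(1) Bad(1)[OF N(1)]] by simp
      from generated_subset_eq[OF Y(3) this sX] have "generated_mod G (Suc d) N"
        unfolding generated_mod_def using f(1) by blast
      then show False using Bad(2)[OF N(1)] by blast
    qed
    then show ?thesis using U by (simp add: Bad_def)
  qed
  ultimately have "\<exists>M\<in>Bad. \<forall>N\<in>Bad. M \<subseteq> N \<longrightarrow> N = M" by (rule subset_Zorn_nonempty)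
  then obtain M where M: "M \<lhd> G" "\<not> generated_mod G (Suc d) M"
    and max: "\<And>N. N \<lhd> G \<Longrightarrow> M \<subset> N \<Longrightarrow> generated_mod G (Suc d) N"
    unfolding Bad_def by blast
  interpret M: normal M G by fact
  interpret Q: group "G Mod M" by (rule M.factorgroup_is_group)
  interpret \<pi>: surjective_group_hom G "G Mod M" "\<lambda>x. M #> x"
    by unfold_locales (auto simp: M.r_coset_hom_Mod carrier_FactGroup)
  have pre_one: "\<pi>.preimage {\<one>\<^bsub>G Mod M\<^esub>} = M"
    using coset_join1[OF _ _ M.subgroup_axioms] coset_join2[OF _ M.subgroup_axioms] M.subset
    by (auto simp: \<pi>.preimage_def)
  have "generated_mod (G Mod M) (Suc d) {}"
  proof (rule Q.generated_of_proper_quotients[OF \<pi>.noetherian_image[OF noeth] \<pi>.chain_image[OF chain]])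
    fix N assume N: "N \<in> fin_index_normal (G Mod M)"
    show "generated_mod (G Mod M) d N"
      using \<pi>.generated_mod_image fin_quot[OF \<pi>.preimage_fin_index[OF N]] N
      by (simp add: fin_index_normal_def)
  next
    fix N assume N: "N \<lhd> G Mod M" "N \<noteq> {\<one>\<^bsub>G Mod M\<^esub>}"
    have "\<one>\<^bsub>G Mod M\<^esub> \<in> N" by (rule subgroup.one_closed[OF normal_imp_subgroup[OF N(1)]])
    then have "\<pi>.preimage {\<one>\<^bsub>G Mod M\<^esub>} \<subseteq> \<pi>.preimage N" by (auto simp: \<pi>.preimage_def)
    then have "M \<subseteq> \<pi>.preimage N" using pre_one by simp
    moreover have "M \<noteq> \<pi>.preimage N"
    proof
      assume "M = \<pi>.preimage N"
      then have "\<pi>.preimage N = \<pi>.preimage {\<one>\<^bsub>G Mod M\<^esub>}" using pre_one by simp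
      then show False
        using \<pi>.image_preimage[of N] \<pi>.image_preimage[of "{\<one>\<^bsub>G Mod M\<^esub>}"] N
          subgroup.subset[OF normal_imp_subgroup[OF N(1)]] Q.one_closed by simp
    qed
    ultimately have "generated_mod G (Suc d) (\<pi>.preimage N)"
      using max[OF \<pi>.preimage_normal[OF N(1)]] by blast
    then show "generated_mod (G Mod M) (Suc d) N" by (rule \<pi>.generated_mod_image[OF N(1)])
  qed
  then have "generated_mod G (Suc d) (\<pi>.preimage {\<one>\<^bsub>G Mod M\<^esub>})"
    using Q.generated_mod_trivial[of "Suc d"] \<pi>.generated_mod_preimage[OF Q.one_is_normal] by blast
  then show False using M(2) pre_one by simp
qed

section \<open>Virtually polycyclic groups and profinite completions\<close>

text \<open>The exponents \<open>n\<close> with \<open>\<xi> [^] n\<close> in the image of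
  \<open>S\<close> form a subgroup of the integers, so they are the multiples of one
  \<open>n0\<close>. An element of \<open>S\<close> realising \<open>n0\<close>, with generators of
  the kernel part, generates \<open>S\<close>. Exponents treat finite and infinite cyclic groups
  alike.\<close>

lemma (in group_hom) subgroup_fg_of_cyclic_image:
  assumes \<xi>: "\<xi> \<in> carrier H" "\<And>z. z \<in> carrier H \<Longrightarrow> \<exists>n::int. z = \<xi> [^]\<^bsub>H\<^esub> n"
    and ker: "\<exists>Y. finite Y \<and> Y \<subseteq> S \<inter> kernel G H h \<and> generate G Y = S \<inter> kernel G H h"
    and S: "subgroup S G"
  shows "\<exists>Y. finite Y \<and> Y \<subseteq> S \<and> generate G Y = S"
proof -
  interpret S: subgroup S G by fact
  obtain Y where Y: "finite Y" "Y \<subseteq> S \<inter> kernel G H h" "generate G Y = S \<inter> kernel G H h"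
    using ker by blast
  define I where "I = {n::int. \<exists>s\<in>S. h s = \<xi> [^]\<^bsub>H\<^esub> n}"
  have diff: "m - n * q \<in> I" if mn: "m \<in> I" "n \<in> I" for m n q
  proof -
    obtain s t where st: "s \<in> S" "t \<in> S" "h s = \<xi> [^]\<^bsub>H\<^esub> m" "h t = \<xi> [^]\<^bsub>H\<^esub> n"
      using mn by (auto simp: I_def)
    have "h (s \<otimes>\<^bsub>G\<^esub> t [^]\<^bsub>G\<^esub> (- q)) = \<xi> [^]\<^bsub>H\<^esub> m \<otimes>\<^bsub>H\<^esub> (\<xi> [^]\<^bsub>H\<^esub> n) [^]\<^bsub>H\<^esub> (- q)"
      using st by (simp add: hom_int_pow)
    also have "\<dots> = \<xi> [^]\<^bsub>H\<^esub> (m + n * (- q))"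
      using \<xi>(1) by (simp only: H.int_pow_pow H.int_pow_mult)
    finally have "h (s \<otimes>\<^bsub>G\<^esub> t [^]\<^bsub>G\<^esub> (- q)) = \<xi> [^]\<^bsub>H\<^esub> (m - n * q)" by simp
    moreover have "s \<otimes>\<^bsub>G\<^esub> t [^]\<^bsub>G\<^esub> (- q) \<in> S"
      using st G.subgroup_int_pow_closed[OF S] by blast
    ultimately show ?thesis by (auto simp: I_def)
  qed
  have "h \<one>\<^bsub>G\<^esub> = \<xi> [^]\<^bsub>H\<^esub> (0::int)" by simp
  then have "0 \<in> I" using S.one_closed unfolding I_def by blast
  have "\<exists>n0\<in>I. \<forall>n\<in>I. n0 dvd n"
  proof (cases "\<exists>n\<in>I. n > 0")
    case True
    then have "\<exists>n::nat. n > 0 \<and> int n \<in> I" by (metis pos_int_cases)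
    then obtain n0 :: nat where n0: "n0 > 0" "int n0 \<in> I" "\<And>n::nat. n > 0 \<Longrightarrow> int n \<in> I \<Longrightarrow> n0 \<le> n"
      using exists_least_iff[of "\<lambda>n. n > 0 \<and> int n \<in> I"] by (metis not_le)
    have "int n0 dvd n" if n: "n \<in> I" for n
    proof (rule ccontr)
      assume "\<not> int n0 dvd n"
      then have pos: "n mod int n0 > 0" using n0(1) by (simp add: dvd_eq_mod_eq_0 order_le_neq_trans)
      moreover have "n mod int n0 \<in> I"
        using diff[OF n n0(2), of "n div int n0"] by (simp add: minus_mult_div_eq_mod)
      ultimately have "n0 \<le> nat (n mod int n0)" by (intro n0(3)) auto
      then have "int n0 \<le> n mod int n0" using pos by (simp add: le_nat_iff)
      moreover have "n mod int n0 < int n0" using n0(1) by simp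
      ultimately show False by linarith
    qed
    then show ?thesis using n0(2) by blast
  next
    case False
    have "n = 0" if n: "n \<in> I" for n
    proof -
      have "- n \<in> I" using diff[OF \<open>0 \<in> I\<close> n, of 1] by simp
      then have "\<not> 0 < n" "\<not> 0 < - n" using False n by blast+
      then show ?thesis by simp
    qed
    then show ?thesis using \<open>0 \<in> I\<close> by auto
  qed
  then obtain n0 s0 where n0: "\<And>n. n \<in> I \<Longrightarrow> n0 dvd n" "s0 \<in> S" "h s0 = \<xi> [^]\<^bsub>H\<^esub> n0"
    by (auto simp: I_def)
  let ?Z = "insert s0 Y"
  have ZS: "?Z \<subseteq> S" using Y n0 by auto
  then have Zc: "?Z \<subseteq> carrier G" using S.subset by blast
  have "S \<subseteq> generate G ?Z"
  proof
    fix s assume s: "s \<in> S"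
    then obtain n where n: "h s = \<xi> [^]\<^bsub>H\<^esub> (n::int)" using \<xi>(2)[of "h s"] by auto
    then have "n \<in> I" using s by (auto simp: I_def)
    then obtain q where q: "n = n0 * q" using n0(1) by (auto elim: dvdE)
    define t where "t = s0 [^]\<^bsub>G\<^esub> q"
    have t: "t \<in> S" "t \<in> carrier G" using G.subgroup_int_pow_closed[OF S n0(2)] by (auto simp: t_def)
    have "h t = \<xi> [^]\<^bsub>H\<^esub> n" using n0 \<xi>(1) by (simp add: t_def hom_int_pow H.int_pow_pow q)
    then have "s \<otimes>\<^bsub>G\<^esub> inv\<^bsub>G\<^esub> t \<in> S \<inter> kernel G H h" using s t n \<xi>(1) by (simp add: kernel_def)
    then have "s \<otimes>\<^bsub>G\<^esub> inv\<^bsub>G\<^esub> t \<in> generate G ?Z"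
      using Y(3) G.mono_generate[of Y ?Z] by blast
    moreover have "t \<in> generate G ?Z"
      unfolding t_def by (intro G.subgroup_int_pow_closed G.generate_is_subgroup Zc) (auto intro: generate.incl)
    ultimately have "(s \<otimes>\<^bsub>G\<^esub> inv\<^bsub>G\<^esub> t) \<otimes>\<^bsub>G\<^esub> t \<in> generate G ?Z" by (rule generate.eng)
    then show "s \<in> generate G ?Z" using s t by (simp add: G.m_assoc)
  qed
  then have "generate G ?Z = S" using G.generate_subgroup_incl[OF ZS S] by blast
  then show ?thesis using Y(1) ZS by blast
qed

context group begin

text \<open>The induction varies \<open>S\<close>, since the hypothesis is needed for
  \<open>S \<inter> K\<close>, the part of \<open>S\<close> that vanishes in the cyclic
  factor.\<close>

lemma polycyclic_seq_fg:
  assumes "polycyclic_seq G K" "subgroup S G" "S \<subseteq> K"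
  shows "\<exists>Y. finite Y \<and> Y \<subseteq> S \<and> generate G Y = S"
  using assms
proof (induction arbitrary: S rule: polycyclic_seq.induct)
  case unity
  then have "S = {\<one>}" using subgroup.one_closed by fastforce
  then show ?case using generate_empty by (intro exI[of _ "{}"]) auto
next
  case (extension K H)
  interpret H: group "G\<lparr>carrier := H\<rparr>" using extension.hyps by (simp add: subgroup_imp_group)
  interpret K: normal K "G\<lparr>carrier := H\<rparr>" by fact
  let ?Q = "(G\<lparr>carrier := H\<rparr>) Mod K"
  interpret Q: group ?Q by (rule K.factorgroup_is_group)
  interpret \<pi>: group_hom "G\<lparr>carrier := H\<rparr>" ?Q "\<lambda>x. K #>\<^bsub>G\<lparr>carrier := H\<rparr>\<^esub> x"
    by unfold_locales (rule K.r_coset_hom_Mod)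
  have ker: "kernel (G\<lparr>carrier := H\<rparr>) ?Q (\<lambda>x. K #>\<^bsub>G\<lparr>carrier := H\<rparr>\<^esub> x) = K"
    using H.coset_join1[OF _ _ K.subgroup_axioms] H.coset_join2[OF _ K.subgroup_axioms] K.subset
    by (auto simp: kernel_def)
  obtain \<xi> where \<xi>: "\<xi> \<in> carrier ?Q" "carrier ?Q = range (\<lambda>n::int. \<xi> [^]\<^bsub>?Q\<^esub> n)"
    using extension.hyps Q.cyclic_group by blast
  have sH: "subgroup H G" and SH: "S \<subseteq> H" and S: "subgroup S G" using extension by auto
  have "subgroup K G" using K.subgroup_axioms sH incl_subgroup by blast
  then have "subgroup (S \<inter> K) G" using S subgroups_Inter_pair by blast
  then obtain Y where Y: "finite Y" "Y \<subseteq> S \<inter> K" "generate G Y = S \<inter> K"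
    using extension.IH[of "S \<inter> K"] by blast
  have "\<exists>Y. finite Y \<and> Y \<subseteq> S \<and> generate (G\<lparr>carrier := H\<rparr>) Y = S"
  proof (rule \<pi>.subgroup_fg_of_cyclic_image[OF \<xi>(1)])
    show "\<exists>n::int. z = \<xi> [^]\<^bsub>?Q\<^esub> n" if "z \<in> carrier ?Q" for z using that \<xi>(2) by blast
    show "subgroup S (G\<lparr>carrier := H\<rparr>)" by (rule subgroup_incl[OF S sH SH])
    show "\<exists>Y. finite Y \<and> Y \<subseteq> S \<inter> kernel (G\<lparr>carrier := H\<rparr>) ?Q (\<lambda>x. K #>\<^bsub>G\<lparr>carrier := H\<rparr>\<^esub> x) \<and>
        generate (G\<lparr>carrier := H\<rparr>) Y = S \<inter> kernel (G\<lparr>carrier := H\<rparr>) ?Q (\<lambda>x. K #>\<^bsub>G\<lparr>carrier := H\<rparr>\<^esub> x)"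
      unfolding ker using Y SH generate_consistent[OF _ sH, of Y] by (intro exI[of _ Y]) auto
  qed
  then show ?case using generate_consistent[OF _ sH] SH by (metis order_trans)
qed

lemma polycyclic_seq_imp_solvable_seq:
  "polycyclic_seq G H \<Longrightarrow> solvable_seq G H"
proof (induction rule: polycyclic_seq.induct)
  case unity
  show ?case by (rule solvable_seq.unity)
next
  case (extension K H)
  then show ?case by (intro solvable_seq.extension[OF extension.IH]) (auto intro: group.cyclic_imp_abelian_group[OF normal.factorgroup_is_group])
qed

lemma virtually_polycyclic_noetherian:
  assumes "virtually_polycyclic G" shows "noetherian_group G"
  unfolding noetherian_group_def
proof (intro allI impI)
  fix S assume S: "subgroup S G"
  interpret S: subgroup S G by fact
  obtain H where H: "subgroup H G" "finite (rcosets H)" "polycyclic (G\<lparr>carrier := H\<rparr>)"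
    using assms unfolding virtually_polycyclic_def by blast
  interpret H: group "G\<lparr>carrier := H\<rparr>" using H(1) by (simp add: subgroup_imp_group)
  have SH: "subgroup (S \<inter> H) G" using S H(1) subgroups_Inter_pair by blast
  have "\<exists>Y. finite Y \<and> Y \<subseteq> S \<inter> H \<and> generate (G\<lparr>carrier := H\<rparr>) Y = S \<inter> H"
    using H(3) unfolding polycyclic_def
    by (intro H.polycyclic_seq_fg[of H] subgroup_incl[OF SH H(1)]) auto
  then obtain Y where Y: "finite Y" "Y \<subseteq> S \<inter> H" "generate G Y = S \<inter> H"
    using generate_consistent[OF _ H(1)] by (metis le_inf_iff)
  define rep where "rep C = (SOME t. t \<in> S \<inter> C)" for C
  have rep: "rep C \<in> S \<inter> C" if "s \<in> S \<inter> C" for s C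
    unfolding rep_def by (rule someI[of "\<lambda>t. t \<in> S \<inter> C"]) (rule that)
  \<comment> \<open>One representative, taken inside \<open>S\<close>, for each of the finitely many
    cosets of \<open>H\<close> that meet \<open>S\<close>.\<close>
  define T where "T = rep ` {C \<in> rcosets H. S \<inter> C \<noteq> {}}"
  have T: "finite T" "T \<subseteq> S" using H(2) rep by (auto simp: T_def)
  have YT: "Y \<union> T \<subseteq> S" using Y T by blast
  have "S \<subseteq> generate G (Y \<union> T)"
  proof
    fix s assume s: "s \<in> S"
    have C: "s \<in> H #> s" "H #> s \<in> rcosets H"
      using rcos_self[OF _ H(1)] rcosetsI[OF subgroup.subset[OF H(1)]] s by auto
    define t where "t = rep (H #> s)"
    have t: "t \<in> S" "t \<in> H #> s" using rep[of s "H #> s"] s C by (auto simp: t_def)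
    have "t \<in> T" using s C by (auto simp: T_def t_def)
    then have tg: "t \<in> generate G (Y \<union> T)" by (intro generate.incl) simp
    have "t \<otimes> inv s \<in> H" using subgroup.rcos_module_imp[OF H(1) group_axioms _ t(2)] s by simp
    then have "inv (t \<otimes> inv s) \<in> S \<inter> H" using s t subgroup.m_inv_closed[OF H(1)] by blast
    then have "s \<otimes> inv t \<in> S \<inter> H" using s t by (simp add: inv_mult_group)
    then have "s \<otimes> inv t \<in> generate G (Y \<union> T)" using Y(3) mono_generate[of Y "Y \<union> T"] by blast
    then have "s \<otimes> inv t \<otimes> t \<in> generate G (Y \<union> T)" using tg by (rule generate.eng)
    then show "s \<in> generate G (Y \<union> T)" using s t by (simp add: m_assoc)
  qed
  then have "generate G (Y \<union> T) = S" using generate_subgroup_incl[OF YT S] by blast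
  then show "\<exists>Y. finite Y \<and> Y \<subseteq> S \<and> generate G Y = S" using Y(1) T(1) YT by blast
qed

lemma virtually_polycyclic_chain:
  assumes "virtually_polycyclic G" shows "\<exists>D n. virtually_soluble_chain G D n"
proof -
  obtain H where H: "subgroup H G" "finite (rcosets H)" "polycyclic (G\<lparr>carrier := H\<rparr>)"
    using assms unfolding virtually_polycyclic_def by blast
  interpret H: group "G\<lparr>carrier := H\<rparr>" using H(1) by (simp add: subgroup_imp_group)
  interpret incl: group_hom "G\<lparr>carrier := H\<rparr>" G "\<lambda>x. x"
    by unfold_locales (use subgroup.subset[OF H(1)] in \<open>auto simp: hom_def\<close>)
  have "solvable_seq (G\<lparr>carrier := H\<rparr>) H"
    using H(3) H.polycyclic_seq_imp_solvable_seq by (simp add: polycyclic_def)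
  from incl.solvable_imp_solvable_img[OF this] have "solvable_seq G H" by simp
  then obtain n where n: "(derived G ^^ n) H = {\<one>}" using solvable_imp_trivial_derived_seq by blast
  \<comment> \<open>The derived series has to start from a normal subgroup for its terms to be
    normal in \<open>G\<close>; starting inside \<open>H\<close>, it ends because that of
    \<open>H\<close> does.\<close>
  have "\<exists>N\<in>fin_index_normal G. \<forall>X\<in>{H}. N \<subseteq> X" by (rule finite_index_core) (use H in auto)
  then obtain N where N: "N \<in> fin_index_normal G" "N \<subseteq> H" by blast
  define D where "D i = (derived G ^^ i) N" for i
  have D: "D i \<lhd> G" for i
    unfolding D_def by (induction i) (use N derived_is_normal in \<open>auto simp: fin_index_normal_def\<close>)
  have "D n \<subseteq> {\<one>}" using mono_exp_of_derived[OF N(2), of n] n by (simp add: D_def)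
  then have "D n = {\<one>}" using subgroup.one_closed[OF normal_imp_subgroup[OF D]] by blast
  moreover have "x \<otimes> y \<otimes> inv x \<otimes> inv y \<in> D (Suc i)" if "x \<in> D i" "y \<in> D i" for x y i
    using that unfolding D_def funpow.simps comp_def derived_def[of _ "(derived G ^^ i) N"]
    by (intro generate.incl) blast
  moreover have "finite (rcosets (D 0))" using N by (simp add: D_def fin_index_normal_def FactGroup_def)
  ultimately have "virtually_soluble_chain G D n" using D by (simp add: virtually_soluble_chain_def)
  then show ?thesis by blast
qed

section \<open>From topological generators of the completion to generators of finite
  quotients\<close>

lemma profinite_completion_projection:
  assumes "N \<in> fin_index_normal G"
  shows "group_hom (profinite_completion G) (G Mod N) (\<lambda>x. x N)"
proof (intro group_hom.intro group_hom_axioms.intro group_profinite_completion homI)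
  show "group (G Mod N)" using assms normal.factorgroup_is_group by (auto simp: fin_index_normal_def)
qed (use assms in \<open>auto simp: profinite_completion_def\<close>)

lemma canonical_image_in_completion:
  assumes "y \<in> carrier G"
  shows "(\<lambda>N\<in>fin_index_normal G. N #> y) \<in> carrier (profinite_completion G)"
  using assms transition_map
  by (auto simp: profinite_completion_def fin_index_normal_def carrier_FactGroup)

text \<open>Prescribing the coordinate at \<open>N\<close> cuts out an open set, nonempty because it
  contains the canonical image of a group element. A dense subgroup meets all these sets, so it
  projects onto \<open>G Mod N\<close>.\<close>

lemma generated_mod_of_dense:
  assumes S: "S \<subseteq> carrier (profinite_completion G)" "finite S"
    and dense: "profinite_topology G closure_of (generate (profinite_completion G) S) =
      carrier (profinite_completion G)"
    and N: "N \<in> fin_index_normal G"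
  shows "generated_mod G (card S) N"
proof -
  let ?C = "profinite_completion G"
  interpret p: group_hom ?C "G Mod N" "\<lambda>x. x N" by (rule profinite_completion_projection[OF N])
  have nN: "N \<lhd> G" using N by (simp add: fin_index_normal_def)
  interpret N: normal N G by (rule nN)
  interpret \<pi>: surjective_group_hom G "G Mod N" "\<lambda>x. N #> x"
    by unfold_locales (auto simp: N.r_coset_hom_Mod carrier_FactGroup)
  have "carrier (G Mod N) \<subseteq> (\<lambda>x. x N) ` generate ?C S"
  proof
    fix z assume "z \<in> carrier (G Mod N)"
    then obtain y where y: "y \<in> carrier G" "z = N #> y" by (auto simp: carrier_FactGroup)
    define c where "c = (\<lambda>N\<in>fin_index_normal G. N #> y)"
    have c: "c \<in> carrier ?C" unfolding c_def by (rule canonical_image_in_completion[OF y(1)])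
    define U where "U = {x \<in> topspace (profinite_topology G). x N \<in> {z}}"
    have "continuous_map (profinite_topology G) (discrete_topology (carrier (G Mod N))) (\<lambda>x. x N)"
      unfolding profinite_topology_def
      by (rule continuous_map_from_subtopology, rule continuous_map_product_projection[OF N])
    then have "openin (profinite_topology G) U"
      unfolding U_def by (rule openin_continuous_map_preimage) (use y in \<open>auto simp: carrier_FactGroup\<close>)
    moreover have "c \<in> U" using c N y(2) by (simp add: U_def topspace_profinite_topology c_def)
    moreover have "c \<in> profinite_topology G closure_of (generate ?C S)" using c dense by simp
    ultimately obtain x where "x \<in> generate ?C S" "x \<in> U" by (meson in_closure_of)
    then show "z \<in> (\<lambda>x. x N) ` generate ?C S" by (auto simp: U_def)
  qed
  moreover have "(\<lambda>x. x N) ` generate ?C S \<subseteq> carrier (G Mod N)"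
    using p.G.generate_incl[OF S(1)] by auto
  ultimately have gen: "generate (G Mod N) ((\<lambda>x. x N) ` S) = carrier (G Mod N)"
    unfolding p.generate_img[OF S(1)] by (intro equalityI)
  obtain e where e: "bij_betw e {..<card S} S"
    using ex_bij_betw_nat_finite[OF S(2)] by (auto simp: atLeast0LessThan)
  have eS: "e ` {..<card S} = S" using e by (rule bij_betw_imp_surj_on)
  have "(\<lambda>i. e i N) ` {..<card S} = (\<lambda>x. x N) ` S"
    using image_image[of "\<lambda>x. x N" e "{..<card S}"] eS by simp
  moreover have "(\<lambda>x. x N) ` S \<subseteq> carrier (G Mod N)" using S(1) by auto
  ultimately have "generated_mod (G Mod N) (card S) {}"
    unfolding generated_mod_def using gen by (intro exI[of _ "\<lambda>i. e i N"]) simp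
  then have "generated_mod (G Mod N) (card S) {\<one>\<^bsub>G Mod N\<^esub>}"
    using group.generated_mod_trivial[OF N.factorgroup_is_group] by blast
  then have "generated_mod G (card S) (\<pi>.preimage {\<one>\<^bsub>G Mod N\<^esub>})"
    by (rule \<pi>.generated_mod_preimage[OF group.one_is_normal[OF N.factorgroup_is_group]])
  moreover have "\<pi>.preimage {\<one>\<^bsub>G Mod N\<^esub>} = N"
    using coset_join1[OF _ _ N.subgroup_axioms] coset_join2[OF _ N.subgroup_axioms] N.subset
    by (auto simp: \<pi>.preimage_def)
  ultimately show ?thesis by simp
qed

end

theorem theorem1:
  fixes G :: "('a, 'b) monoid_scheme"
  assumes "group G"
    and "virtually_polycyclic G"
  shows "gen_rank G \<le> top_gen_rank (profinite_completion G) (profinite_topology G) + 1"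
proof -
  interpret group G by fact
  let ?D = "{S. finite S \<and> S \<subseteq> carrier (profinite_completion G) \<and>
    profinite_topology G closure_of (generate (profinite_completion G) S) = carrier (profinite_completion G)}"
  show ?thesis
  proof (cases "?D = {}")
    case True
    \<comment> \<open>Without a finite topological generating set the infimum is taken over the
      empty set and equals \<infinity>.\<close>
    then show ?thesis unfolding top_gen_rank_def by (simp only: image_empty) (simp add: top_enat_def)
  next
    case False
    define I where "I = (\<lambda>S. enat (card S)) ` ?D"
    have "I \<noteq> {}" unfolding I_def using False by (simp only: image_is_empty not_False_eq_True)
    \<comment> \<open>A nonempty set of extended naturals has a least element, so the topological
      rank is attained by an actual set \<open>S\<close>.\<close>
    then have "Inf I \<in> I" unfolding Inf_enat_def by (auto intro: LeastI)
    then have "top_gen_rank (profinite_completion G) (profinite_topology G) \<in> (\<lambda>S. enat (card S)) ` ?D"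
      unfolding top_gen_rank_def I_def .
    then obtain S where S: "S \<in> ?D"
      "top_gen_rank (profinite_completion G) (profinite_topology G) = enat (card S)" by blast
    obtain D n where "virtually_soluble_chain G D n" using virtually_polycyclic_chain[OF assms(2)] by blast
    then have "generated_mod G (Suc (card S)) {}"
      using S(1) generated_mod_of_dense
      by (intro generated_by_Suc[OF virtually_polycyclic_noetherian[OF assms(2)]]) auto
    then obtain f where f: "f ` {..<Suc (card S)} \<subseteq> carrier G"
      "generate G (f ` {..<Suc (card S)}) = carrier G" by (auto simp: generated_mod_def)
    have "gen_rank G \<le> enat (card (f ` {..<Suc (card S)}))"
      unfolding gen_rank_def using f by (intro INF_lower) auto
    also have "\<dots> \<le> enat (Suc (card S))" using card_image_le[of "{..<Suc (card S)}" f] by simp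
    finally show ?thesis using S(2) by (simp add: one_enat_def)
  qed
qed

end
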